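(* Let $d>0$, and suppose that $\phi,\psi$ satisfy (C1) or (C2) on $\Delta$. Then for each positive integer $N$, the functions $\eta^{\pm}(u,\xi)$ can be expressed in the form $$\eta^{\pm}(u,\xi)=\sum_{n=1}^{N-1}\frac{\mathsf{A}_n^{\pm}(\xi)}{u^n}+R_N^{\pm}(u,\xi),$$ where, for any $\sigma>0$ and $0<r<d$, the remainder terms $R_N^{\pm}(u,\xi)$ satisfy $$\left|R_N^{\pm}(u,\xi)\right|\le C^{\pm}(r)\left(\frac{2r}{N}+\frac{1}{\Re u-\sigma}\right)\frac{e^{V^{\pm}(\sigma,\xi)}}{\max\left(1,\mp\operatorname{sgn}(\Re\xi)|\Re\xi|^{\rho}\right)}\frac{N!}{(2r|u|)^N}$$ provided $\Re u>\sigma$ and $\xi\in\Gamma^{\pm}(d)$.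
   Context: Setting. $u$ is a complex parameter. $\mathbf{G}$ is a domain in the complex $\xi$-plane (or, more generally, a domain of a Riemann surface spread over the $\xi$-plane, in which case $|\xi|,\Re\xi,\Im\xi$ refer to the projection of $\xi$), and $\phi,\psi$ are holomorphic in $\mathbf{G}$ and independent of $u$. $\Delta\subset\mathbf{G}$ is a domain. Upper signs go with upper signs and lower with lower throughout. Condition (C1): there are positive constants $c,\rho$, independent of $u$ and $\xi$, such that for all $\xi\in\Delta$, $|\phi(\xi)|\le\frac{c}{1+|\xi|^{1+\rho}}$ and $|\psi(\xi)|\le\frac{c}{1+|\xi|^{1+\rho}}$. Condition (C2): there are positive constants $c,\rho$, independent of $u$ and $\xi$, such that for all $\xi\in\Delta$, $|\phi(\xi)|\le\frac{c}{1+|\xi|^{1/2+\rho}}$, $|\phi'(\xi)|\le\frac{c}{1+|\xi|^{1+\rho}}$ and $|\psi(\xi)|\le\frac{c}{1+|\xi|^{1+\rho}}$. The number $\rho$ in the claim is the one from whichever condition is assumed. Domains $\Gamma^{\pm}(d)$. For $d>0$, $\Gamma^{\pm}(d)$ denote any non-empty subdomains of $\Delta$ such that (i) the distance between each point of $\Gamma^{\pm}(d)$ and each boundary point of $\Delta$ is at least $d$ (i.e. the open disc of radius $d$ about each point of $\Gamma^{\pm}(d)$ lies in $\Delta$); (ii) if $\xi\in\Gamma^{\pm}(d)$ then $\xi\mp x\in\Gamma^{\pm}(d)$ for all $x>0$. It is assumed that $d$ is such that these domains are non-empty. Paths. For $\xi\in\Gamma^{+}(d)$, $\mathscr{P}(-\infty,\xi)$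 is the horizontal half-line running from $-\infty+i\Im\xi$ to $\xi$; for $\xi\in\Gamma^{-}(d)$, $\mathscr{P}(+\infty,\xi)$ is the horizontal half-line running from $+\infty+i\Im\xi$ to $\xi$. Coefficients. $\mathsf{A}_0^{\pm}(\xi)=1$ and, for $n\ge0$ and $\xi\in\Gamma^{\pm}(d)$, $$\mathsf{A}_{n+1}^{\pm}(\xi)=-\frac12\phi(\xi)\mathsf{A}_n^{\pm}(\xi)\mp\frac12\frac{d\mathsf{A}_n^{\pm}(\xi)}{d\xi}\mp\frac12\int_{\mathscr{P}(\mp\infty,\xi)}\left(\frac14\phi^2(t)\mp\frac12\phi'(t)-\psi(t)\right)\mathsf{A}_n^{\pm}(t)\,dt .$$ Regions. For $r>0$, $B(r)=\{t\in\mathbb{C}:|t|<r\}$ and $U(r)=\{t\in\mathbb{C}:\Re t>0,\ |\Im t|<r\}\cup B(r)$. The functions $\eta^{\pm}$ and $F^{\pm}$. Under (C1) or (C2) the equation $\frac{d^2W}{d\xi^2}=(u^2+u\phi(\xi)+\psi(\xi))W$ has unique solutions of the form $W^{\pm}(u,\xi)=\exp\left(\pm u\xi\pm\frac12\int_{\alpha^{\pm}}^{\xi}\phi(t)\,dt\right)(1+\eta^{\pm}(u,\xi))$ for $\Re u>0$, $\xi\in\Gamma^{\pm}(d)$ (with $\alpha^{\pm}\in\mathbf{G}$ fixed, integration contours in $\mathbf{G}$, possibly infinite if the integrals converge), such that $\eta^{\pm}$ is analytic in $\{\Re u>0\}\times\Gamma^{\pm}(d)$ and $\lim_{\Re\xi\to\mp\infty}\eta^{\pm}(u,\xi)=0$.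 Moreover $\eta^{\pm}(u,\xi)=\int_0^{+\infty}e^{-ut}F^{\pm}(t,\xi)\,dt$, where $F^{\pm}$ is analytic in $U(2d)\times\Gamma^{\pm}(d)$, $F^{\pm}(t,\xi)=\sum_{n\ge0}\frac{\mathsf{A}_{n+1}^{\pm}(\xi)}{n!}t^n$ for $(t,\xi)\in B(2d)\times\Gamma^{\pm}(d)$, and for each $\sigma>0$, $0<r<d$ there is $K^{\pm}=K^{\pm}(\sigma,r)>0$ with $|F^{\pm}(t,\xi)|\le K^{\pm}e^{\sigma\Re t}/\max(1,\mp\operatorname{sgn}(\Re\xi)|\Re\xi|^{\rho})$ on $U(2r)\times\Gamma^{\pm}(d)$. The quantities $V^{\pm}$ and $C^{\pm}$. For $\sigma>0$ and $\xi\in\Gamma^{\pm}(d)$, $$V^{\pm}(\sigma,\xi)=\begin{cases}\displaystyle\frac{6}{\sigma}\int_{\mathscr{P}(\mp\infty,\xi)}\left(\frac14|\phi^2(t)|+\left|\frac12\phi'(t)\pm\psi(t)\right|\right)|dt| & \text{if }\phi\not\equiv0,\\[2mm] \displaystyle\frac1\sigma\int_{\mathscr{P}(\mp\infty,\xi)}|\psi(t)|\,|dt| & \text{if }\phi\equiv0,\end{cases}$$ and for $0<r<d$, $$C^{\pm}=C^{\pm}(r)=2\sup_{|t|=2r,\ \xi\in\Gamma^{\pm}(d)}\left(\max\left(1,\mp\operatorname{sgn}(\Re\xi)|\Re\xi|^{\rho}\right)|F^{\pm}(t,\xi)|\right).$$ *)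

theory Defs
  imports "HOL-Analysis.Analysis"
begin

text \<open>
  A Riemann surface spread over the complex plane is modelled by an open subset \<open>G\<close> of a Hausdorff
  space together with a projection \<open>p\<close> that is a local homeomorphism on \<open>G\<close>; \<open>\<bar>\<xi>\<bar>\<close>, \<open>Re \<xi>\<close>, \<open>Im \<xi>\<close>
  mean those of \<open>p \<xi>\<close>. Domains of the plane are the case \<open>p = id\<close>.
  The sign \<open>s\<close> is \<open>1\<close> for the upper and \<open>-1\<close> for the lower choice of signs.
\<close>

definition is_domain :: "'a::topological_space set \<Rightarrow> bool" where
  "is_domain S \<longleftrightarrow> open S \<and> connected S \<and> S \<noteq> {}"

definition spread_over_plane :: "('a::t2_space \<Rightarrow> complex) \<Rightarrow> 'a set \<Rightarrow> bool" where
  "spread_over_plane p G \<longleftrightarrow>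
     (\<forall>\<xi>\<in>G. \<exists>D q. \<xi> \<in> D \<and> D \<subseteq> G \<and> open D \<and> open (p ` D) \<and> homeomorphism D (p ` D) p q)"

text \<open>
  Differentiation with respect to the local coordinate \<open>p\<close>, written as a limit of difference
  quotients so that no chart has to be chosen.
\<close>

definition has_coord_deriv ::
    "('a::t2_space \<Rightarrow> complex) \<Rightarrow> ('a \<Rightarrow> complex) \<Rightarrow> complex \<Rightarrow> 'a \<Rightarrow> bool" where
  "has_coord_deriv p f f' \<xi> \<longleftrightarrow> ((\<lambda>\<zeta>. (f \<zeta> - f \<xi>) / (p \<zeta> - p \<xi>)) \<longlongrightarrow> f') (at \<xi>)"

definition coord_deriv :: "('a::t2_space \<Rightarrow> complex) \<Rightarrow> ('a \<Rightarrow> complex) \<Rightarrow> 'a \<Rightarrow> complex" where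
  "coord_deriv p f \<xi> = Lim (at \<xi>) (\<lambda>\<zeta>. (f \<zeta> - f \<xi>) / (p \<zeta> - p \<xi>))"

definition surface_holomorphic_on ::
    "('a::t2_space \<Rightarrow> complex) \<Rightarrow> ('a \<Rightarrow> complex) \<Rightarrow> 'a set \<Rightarrow> bool" where
  "surface_holomorphic_on p f S \<longleftrightarrow> (\<forall>\<xi>\<in>S. \<exists>f'. has_coord_deriv p f f' \<xi>)"

lemma has_coord_deriv_plane:
  "has_coord_deriv id f f' z \<longleftrightarrow> (f has_field_derivative f') (at z)"
  by (simp add: has_coord_deriv_def has_field_derivative_iff)

lemma coord_deriv_eqI:
  assumes "has_coord_deriv p f f' \<xi>" "at \<xi> \<noteq> bot"
  shows "coord_deriv p f \<xi> = f'"
  using assms unfolding coord_deriv_def has_coord_deriv_def by (intro tendsto_Lim)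

lemma surface_holomorphic_on_plane:
  "open S \<Longrightarrow> surface_holomorphic_on id f S \<longleftrightarrow> f holomorphic_on S"
  by (simp add: surface_holomorphic_on_def has_coord_deriv_plane holomorphic_on_open)

text \<open>
  Holomorphy in two variables, the second one on the surface: complex (Frechet) differentiability
  at every point of \<open>U \<times> S\<close>, for \<open>U\<close> and \<open>S\<close> open.
\<close>

definition jointly_holomorphic_on ::
    "('a::t2_space \<Rightarrow> complex) \<Rightarrow> (complex \<Rightarrow> 'a \<Rightarrow> complex) \<Rightarrow> complex set \<Rightarrow> 'a set \<Rightarrow> bool" where
  "jointly_holomorphic_on p f U S \<longleftrightarrow>
     (\<forall>t\<in>U. \<forall>\<xi>\<in>S. \<exists>a b.
        ((\<lambda>(t', \<zeta>). (f t' \<zeta> - f t \<xi> - a * (t' - t) - b * (p \<zeta> - p \<xi>)) /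
            of_real (norm (t' - t, p \<zeta> - p \<xi>))) \<longlongrightarrow> 0) (at (t, \<xi>)))"

definition condC1 ::
    "('a::t2_space \<Rightarrow> complex) \<Rightarrow> 'a set \<Rightarrow> ('a \<Rightarrow> complex) \<Rightarrow> ('a \<Rightarrow> complex) \<Rightarrow> real \<Rightarrow> bool" where
  "condC1 p \<Delta> \<phi> \<psi> \<rho> \<longleftrightarrow> \<rho> > 0 \<and> (\<exists>c>0. \<forall>\<xi>\<in>\<Delta>.
      cmod (\<phi> \<xi>) \<le> c / (1 + cmod (p \<xi>) powr (1 + \<rho>)) \<and>
      cmod (\<psi> \<xi>) \<le> c / (1 + cmod (p \<xi>) powr (1 + \<rho>)))"

definition condC2 ::
    "('a::t2_space \<Rightarrow> complex) \<Rightarrow> 'a set \<Rightarrow> ('a \<Rightarrow> complex) \<Rightarrow> ('a \<Rightarrow> complex) \<Rightarrow> real \<Rightarrow> bool" where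
  "condC2 p \<Delta> \<phi> \<psi> \<rho> \<longleftrightarrow> \<rho> > 0 \<and> (\<exists>c>0. \<forall>\<xi>\<in>\<Delta>.
      cmod (\<phi> \<xi>) \<le> c / (1 + cmod (p \<xi>) powr (1/2 + \<rho>)) \<and>
      cmod (coord_deriv p \<phi> \<xi>) \<le> c / (1 + cmod (p \<xi>) powr (1 + \<rho>)) \<and>
      cmod (\<psi> \<xi>) \<le> c / (1 + cmod (p \<xi>) powr (1 + \<rho>)))"

text \<open>
  \<open>horizontal_ray p s S \<xi> \<gamma>\<close>: \<open>\<gamma>\<close> traverses in \<open>S\<close> the points \<open>\<gamma> x = \<xi> - s x\<close>, \<open>x \<ge> 0\<close>, i.e. it is the
  lift starting at \<open>\<xi>\<close> of the horizontal half-line from \<open>p \<xi>\<close> to \<open>-s \<infinity>\<close>. For \<open>S\<close> inside the surface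
  such a lift is unique on \<open>{0..}\<close>.
\<close>

definition horizontal_ray ::
    "('a::t2_space \<Rightarrow> complex) \<Rightarrow> real \<Rightarrow> 'a set \<Rightarrow> 'a \<Rightarrow> (real \<Rightarrow> 'a) \<Rightarrow> bool" where
  "horizontal_ray p s S \<xi> \<gamma> \<longleftrightarrow> continuous_on {0..} \<gamma> \<and> \<gamma> 0 = \<xi> \<and>
     (\<forall>x\<ge>0. \<gamma> x \<in> S \<and> p (\<gamma> x) = p \<xi> - of_real (s * x))"

definition the_ray :: "('a::t2_space \<Rightarrow> complex) \<Rightarrow> real \<Rightarrow> 'a set \<Rightarrow> 'a \<Rightarrow> real \<Rightarrow> 'a" where
  "the_ray p s S \<xi> = (SOME \<gamma>. horizontal_ray p s S \<xi> \<gamma>)"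

text \<open>
  \<open>\<Gamma>\<close> is an admissible choice of the subdomain belonging to \<open>s\<close> and \<open>d\<close>. The open disc of radius \<open>d\<close>
  about a point of the surface is a subset containing the point that \<open>p\<close> maps homeomorphically
  onto the plane disc \<open>ball (p \<xi>) d\<close>.
\<close>

definition admissible_subdomain ::
    "('a::t2_space \<Rightarrow> complex) \<Rightarrow> 'a set \<Rightarrow> real \<Rightarrow> real \<Rightarrow> 'a set \<Rightarrow> bool" where
  "admissible_subdomain p \<Delta> s d \<Gamma> \<longleftrightarrow> is_domain \<Gamma> \<and> \<Gamma> \<subseteq> \<Delta> \<and>
     (\<forall>\<xi>\<in>\<Gamma>. \<exists>D q. \<xi> \<in> D \<and> D \<subseteq> \<Delta> \<and> open D \<and> homeomorphism D (ball (p \<xi>) d) p q) \<and>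
     (\<forall>\<xi>\<in>\<Gamma>. \<exists>\<gamma>. horizontal_ray p s \<Gamma> \<xi> \<gamma>)"

text \<open>
  Integrals over the half-line coming from \<open>-s \<infinity>\<close> and ending at \<open>\<xi>\<close>, with respect to \<open>dt\<close> and to
  \<open>\<bar>dt\<bar>\<close>; the parametrization \<open>t = \<xi> - s x\<close> gives \<open>dt = -s dx\<close> with \<open>x\<close> running from \<open>\<infinity>\<close> down to \<open>0\<close>.
\<close>

definition path_int ::
    "('a::t2_space \<Rightarrow> complex) \<Rightarrow> real \<Rightarrow> 'a set \<Rightarrow> ('a \<Rightarrow> complex) \<Rightarrow> 'a \<Rightarrow> complex" where
  "path_int p s \<Gamma> f \<xi> = of_real s * integral {0..} (\<lambda>x. f (the_ray p s \<Gamma> \<xi> x))"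

definition path_abs_int ::
    "('a::t2_space \<Rightarrow> complex) \<Rightarrow> real \<Rightarrow> 'a set \<Rightarrow> ('a \<Rightarrow> real) \<Rightarrow> 'a \<Rightarrow> real" where
  "path_abs_int p s \<Gamma> f \<xi> = integral {0..} (\<lambda>x. f (the_ray p s \<Gamma> \<xi> x))"

primrec A_coeff ::
    "('a::t2_space \<Rightarrow> complex) \<Rightarrow> real \<Rightarrow> 'a set \<Rightarrow> ('a \<Rightarrow> complex) \<Rightarrow> ('a \<Rightarrow> complex) \<Rightarrow>
     nat \<Rightarrow> 'a \<Rightarrow> complex" where
  "A_coeff p s \<Gamma> \<phi> \<psi> 0 = (\<lambda>\<xi>. 1)"
| "A_coeff p s \<Gamma> \<phi> \<psi> (Suc n) = (\<lambda>\<xi>.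
     - (1/2) * \<phi> \<xi> * A_coeff p s \<Gamma> \<phi> \<psi> n \<xi>
     - of_real s * (1/2) * coord_deriv p (A_coeff p s \<Gamma> \<phi> \<psi> n) \<xi>
     - of_real s * (1/2) * path_int p s \<Gamma>
         (\<lambda>t. (1/4 * (\<phi> t)\<^sup>2 - of_real s * (1/2) * coord_deriv p \<phi> t - \<psi> t)
              * A_coeff p s \<Gamma> \<phi> \<psi> n t) \<xi>)"

definition U_region :: "real \<Rightarrow> complex set" where
  "U_region r = {t. Re t > 0 \<and> \<bar>Im t\<bar> < r} \<union> ball 0 r"

definition weight :: "('a \<Rightarrow> complex) \<Rightarrow> real \<Rightarrow> real \<Rightarrow> 'a \<Rightarrow> real" where
  "weight p s \<rho> \<xi> = max 1 (- s * sgn (Re (p \<xi>)) * \<bar>Re (p \<xi>)\<bar> powr \<rho>)"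

text \<open>
  \<open>\<Phi>\<close> stands for the integral of \<open>\<phi>\<close> from \<open>\<alpha>\<close> to \<open>\<xi>\<close>: a change of the (finite or infinite) base point
  or of the contours only adds a constant to this antiderivative, hence multiplies \<open>W\<close> by a nonzero
  constant, and leaves \<open>\<eta>\<close> unchanged.
\<close>

definition W_fun ::
    "('a::t2_space \<Rightarrow> complex) \<Rightarrow> real \<Rightarrow> ('a \<Rightarrow> complex) \<Rightarrow> (complex \<Rightarrow> 'a \<Rightarrow> complex) \<Rightarrow>
     complex \<Rightarrow> 'a \<Rightarrow> complex" where
  "W_fun p s \<Phi> \<eta> u \<xi> =
     exp (of_real s * u * p \<xi> + of_real s * (1/2) * \<Phi> \<xi>) * (1 + \<eta> u \<xi>)"

definition solves_ODE ::
    "('a::t2_space \<Rightarrow> complex) \<Rightarrow> 'a set \<Rightarrow> ('a \<Rightarrow> complex) \<Rightarrow> ('a \<Rightarrow> complex) \<Rightarrow>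
     complex \<Rightarrow> ('a \<Rightarrow> complex) \<Rightarrow> bool" where
  "solves_ODE p \<Gamma> \<phi> \<psi> u W \<longleftrightarrow> (\<exists>W'. \<forall>\<xi>\<in>\<Gamma>.
     has_coord_deriv p W (W' \<xi>) \<xi> \<and>
     has_coord_deriv p W' ((u\<^sup>2 + u * \<phi> \<xi> + \<psi> \<xi>) * W \<xi>) \<xi>)"

definition is_eta ::
    "('a::t2_space \<Rightarrow> complex) \<Rightarrow> real \<Rightarrow> 'a set \<Rightarrow> ('a \<Rightarrow> complex) \<Rightarrow> ('a \<Rightarrow> complex) \<Rightarrow>
     ('a \<Rightarrow> complex) \<Rightarrow> (complex \<Rightarrow> 'a \<Rightarrow> complex) \<Rightarrow> bool" where
  "is_eta p s \<Gamma> \<phi> \<psi> \<Phi> \<eta> \<longleftrightarrow>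
     (\<forall>u. Re u > 0 \<longrightarrow> solves_ODE p \<Gamma> \<phi> \<psi> u (W_fun p s \<Phi> \<eta> u)) \<and>
     jointly_holomorphic_on p \<eta> {u. Re u > 0} \<Gamma> \<and>
     (\<forall>u. Re u > 0 \<longrightarrow>
        (\<eta> u \<longlongrightarrow> 0) (inf (principal \<Gamma>) (filtercomap (\<lambda>\<xi>. - s * Re (p \<xi>)) at_top)))"

definition is_Borel_transform ::
    "('a::t2_space \<Rightarrow> complex) \<Rightarrow> real \<Rightarrow> real \<Rightarrow> real \<Rightarrow> 'a set \<Rightarrow> ('a \<Rightarrow> complex) \<Rightarrow> ('a \<Rightarrow> complex) \<Rightarrow>
     (complex \<Rightarrow> 'a \<Rightarrow> complex) \<Rightarrow> (complex \<Rightarrow> 'a \<Rightarrow> complex) \<Rightarrow> bool" where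
  "is_Borel_transform p s \<rho> d \<Gamma> \<phi> \<psi> \<eta> F \<longleftrightarrow>
     (\<forall>u. Re u > 0 \<longrightarrow> (\<forall>\<xi>\<in>\<Gamma>.
        ((\<lambda>t. exp (- u * of_real t) * F (of_real t) \<xi>) has_integral \<eta> u \<xi>) {0..})) \<and>
     jointly_holomorphic_on p F (U_region (2 * d)) \<Gamma> \<and>
     (\<forall>t\<in>ball 0 (2 * d). \<forall>\<xi>\<in>\<Gamma>.
        (\<lambda>n. A_coeff p s \<Gamma> \<phi> \<psi> (Suc n) \<xi> / fact n * t ^ n) sums F t \<xi>) \<and>
     (\<forall>\<sigma>>0. \<forall>r. 0 < r \<and> r < d \<longrightarrow> (\<exists>K>0. \<forall>t\<in>U_region (2 * r). \<forall>\<xi>\<in>\<Gamma>.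
        cmod (F t \<xi>) \<le> K * exp (\<sigma> * Re t) / weight p s \<rho> \<xi>))"

definition V_bound ::
    "('a::t2_space \<Rightarrow> complex) \<Rightarrow> real \<Rightarrow> 'a set \<Rightarrow> 'a set \<Rightarrow> ('a \<Rightarrow> complex) \<Rightarrow> ('a \<Rightarrow> complex) \<Rightarrow>
     real \<Rightarrow> 'a \<Rightarrow> real" where
  "V_bound p s G \<Gamma> \<phi> \<psi> \<sigma> \<xi> =
     (if \<exists>z\<in>G. \<phi> z \<noteq> 0
      then 6 / \<sigma> * path_abs_int p s \<Gamma>
        (\<lambda>t. 1/4 * cmod ((\<phi> t)\<^sup>2) + cmod (1/2 * coord_deriv p \<phi> t + of_real s * \<psi> t)) \<xi>
      else 1 / \<sigma> * path_abs_int p s \<Gamma> (\<lambda>t. cmod (\<psi> t)) \<xi>)"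

definition C_const ::
    "('a \<Rightarrow> complex) \<Rightarrow> real \<Rightarrow> real \<Rightarrow> 'a set \<Rightarrow> (complex \<Rightarrow> 'a \<Rightarrow> complex) \<Rightarrow> real \<Rightarrow> real" where
  "C_const p s \<rho> \<Gamma> F r =
     2 * (SUP (t, \<xi>) \<in> sphere 0 (2 * r) \<times> \<Gamma>. weight p s \<rho> \<xi> * cmod (F t \<xi>))"

end

theory Submission
  imports Defs "HOL-Complex_Analysis.Complex_Analysis"
begin

text \<open>
  Write \<open>f = \<phi>\<^sup>2/4 - s \<phi>'/2 - \<psi>\<close>, let \<open>J g\<close> be the integral of \<open>g\<close> over the horizontal ray, and let
  \<open>C\<close> be \<open>C_const\<close>.  The recursion for the coefficients says that all \<open>t\<close>-derivatives at \<open>0\<close> of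
  \<open>\<partial>\<^sub>t F + s/2 \<partial>\<^sub>\<xi> F + \<phi> F/2 + J (f F)/2\<close> vanish, so this expression vanishes for all \<open>t\<close> in the
  half-strip by the identity theorem.  Integrating the equation along the characteristic that joins
  \<open>(T, \<xi> - s t/2)\<close> to \<open>(T + t, \<xi>)\<close>, where \<open>\<bar>T\<bar> = 2 r\<close>, shows that a bound
  \<open>\<bar>F (T + t) \<xi>\<bar> \<le> Q e\<^bsup>\<sigma> t + V \<xi>\<^esup> / weight\<close> for all \<open>t\<close> and \<open>\<xi>\<close> can be improved from \<open>Q\<close> to
  \<open>C/2 + Q/2\<close>.  Some such bound holds by assumption, hence it holds with \<open>Q = C\<close>.
  Cauchy's inequality on circles of radius \<open>2 r\<close> then bounds the derivatives of \<open>F\<close>, and \<open>N\<close>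
  integrations by parts in the Laplace integral give the estimate of the remainder.
\<close>

subsection \<open>Parameter integrals and derivatives of holomorphic functions\<close>

text \<open>Condition (C2) bounds \<open>\<phi>\<close> only by a power \<open>1/2 + \<rho>\<close>,
  too weak in general for integrability along a ray, so the term \<open>\<phi> F / 2\<close> cannot
  be charged to an integral of the modulus of \<open>\<phi>\<close>. It is split by a quadratic
  inequality: a multiple of \<open>\<sigma>\<close> is paid by the growth
  \<open>exp (\<sigma> t)\<close>, and a multiple of \<open>\<phi>^2 / \<sigma>\<close> by
  \<open>V\<close>, where \<open>\<phi>\<close> occurs squared. Leaving a share
  \<open>\<sigma> / 6\<close> for the integral term is the origin of the factor
  \<open>6 / \<sigma>\<close>. The integral term couples the bound at a point with the bounds on a
  whole ray. The factor \<open>exp V\<close> is chosen for it: along a ray it is an antiderivative,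
  up to sign, of the density of \<open>V\<close> times itself, so integrating the bound against the
  density gives back at most \<open>exp V\<close>. The gain \<open>Q / 2\<close> is the coefficient
  1/2 of both terms in the equation. The map from \<open>Q\<close> to \<open>C/2 + Q/2\<close> has
  the fixed point \<open>C\<close>, which explains the factor 2 in \<open>C_const\<close>. The
  iteration needs a finite bound to start from, and this is all that the unspecified constant in the
  growth hypothesis supplies. A single circle of starting points \<open>T\<close> serves every
  \<open>t\<close>, because the circle of radius \<open>2 r\<close> about \<open>t\<close> is its
  translate.\<close>

lemma integral_tendsto_at_top:
  fixes f :: "real \<Rightarrow> 'b::banach"
  assumes "(f has_integral I) {a..}"
  shows "((\<lambda>b. integral {a..b} f) \<longlongrightarrow> I) at_top"
proof (rule tendstoI)
  fix e :: real assume "e > 0"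
  then obtain B where B: "B > 0" and *: "\<And>c d. ball 0 B \<subseteq> cbox c d \<Longrightarrow>
      norm (integral (cbox c d) (\<lambda>x. if x \<in> {a..} then f x else 0) - I) < e"
    using assms unfolding has_integral_alt'[of f] by blast
  have "dist (integral {a..b} f) I < e" if b: "b \<ge> max B \<bar>a\<bar>" for b
  proof -
    \<comment> \<open>The box is stretched to the left beyond \<open>a\<close>, where the extension
      of \<open>f\<close> by zero vanishes, so only \<open>{a..b}\<close> contributes.\<close>
    have "ball 0 B \<subseteq> cbox (- max B \<bar>a\<bar>) b"
      using b by (auto simp: dist_norm)
    then have "norm (integral (cbox (- max B \<bar>a\<bar>) b) (\<lambda>x. if x \<in> {a..} then f x else 0) - I) < e"
      by (rule *)
    moreover have "{a..} \<inter> cbox (- max B \<bar>a\<bar>) b = {a..b}"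
      using b by (auto simp: max_def)
    ultimately show ?thesis
      using integral_restrict_Int[of "cbox (- max B \<bar>a\<bar>) b" "{a..}" f]
      by (simp only: dist_norm Int_commute)
  qed
  then show "\<forall>\<^sub>F b in at_top. dist (integral {a..b} f) I < e"
    using eventually_ge_at_top by (rule eventually_mono[rotated])
qed

lemma norm_integral_atLeast_le:
  fixes f :: "real \<Rightarrow> 'b::banach"
  assumes "f integrable_on {a..}" and "\<And>b. b \<ge> a \<Longrightarrow> norm (integral {a..b} f) \<le> B"
  shows "norm (integral {a..} f) \<le> B"
proof (rule tendsto_upperbound)
  show "((\<lambda>b. norm (integral {a..b} f)) \<longlongrightarrow> norm (integral {a..} f)) at_top"
    by (intro tendsto_norm integral_tendsto_at_top) (use assms(1) in blast)
  show "\<forall>\<^sub>F b in at_top. norm (integral {a..b} f) \<le> B"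
    using eventually_ge_at_top[of a] by eventually_elim (rule assms(2))
qed simp

lemma norm_deriv_le:
  assumes "f holomorphic_on ball z r" and "0 < e" and "cball w e \<subseteq> ball z r"
    and "\<And>x. x \<in> ball z r \<Longrightarrow> norm (f x) \<le> B"
  shows "norm ((deriv ^^ n) f w) \<le> fact n * B / e ^ n"
proof (rule Cauchy_inequality)
  show "continuous_on (cball w e) f"
    using assms holomorphic_on_imp_continuous_on continuous_on_subset by blast
  show "f holomorphic_on ball w e"
    using assms by (meson ball_subset_cball holomorphic_on_subset order_trans)
  show "norm (f x) \<le> B" if "norm (w - x) = e" for x
    using that assms(3) by (intro assms(4)) (auto simp: dist_norm subset_iff)
qed (use assms in auto)

text \<open>Cauchy's inequality on discs of radius \<open>r/2\<close> bounds the
  \<open>t\<close>-derivative by \<open>2 / r * h\<close>, hence also every difference quotient with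
  increment below \<open>r/2\<close>. Dominated convergence then passes to the limit. It speaks
  about sequences, so the limit at 0 is tested on sequences.\<close>

lemma has_field_derivative_param_integral:
  fixes k :: "complex \<Rightarrow> 'b::euclidean_space \<Rightarrow> complex"
  assumes r: "0 < r" and hol: "\<And>x. x \<in> S \<Longrightarrow> (\<lambda>t. k t x) holomorphic_on ball z r"
    and int: "\<And>t. t \<in> ball z r \<Longrightarrow> k t integrable_on S"
    and h: "h integrable_on S" and le: "\<And>t x. t \<in> ball z r \<Longrightarrow> x \<in> S \<Longrightarrow> norm (k t x) \<le> h x"
  shows "(\<lambda>x. deriv (\<lambda>t. k t x) z) integrable_on S" (is ?int)
    and "((\<lambda>t. integral S (k t)) has_field_derivative integral S (\<lambda>x. deriv (\<lambda>t. k t x) z)) (at z)"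
      (is ?der)
proof -
  define q where "q = (\<lambda>w x. (k (z + w) x - k z x) / w)"
  have q_le: "norm (q w x) \<le> 2 / r * h x" if w: "w \<noteq> 0" "norm w < r/2" and x: "x \<in> S" for w x
  proof -
    have "norm (k (z + w) x - k z x) \<le> (2 / r * h x) * norm ((z + w) - z)"
    proof (rule field_differentiable_bound[where S = "ball z (r/2)"])
      fix y assume y: "y \<in> ball z (r/2)"
      have "y \<in> ball z r" using y r by auto
      then show "((\<lambda>t. k t x) has_field_derivative deriv (\<lambda>t. k t x) y) (at y within ball z (r/2))"
        using holomorphic_derivI[OF hol[OF x]] by (meson has_field_derivative_at_within open_ball)
      have "cball y (r/2) \<subseteq> ball z r"
        using y by (simp add: cball_subset_ball_iff dist_commute)
      then have "norm ((deriv ^^ 1) (\<lambda>t. k t x) y) \<le> fact 1 * h x / (r/2) ^ 1"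
        using hol[OF x] le x r by (intro norm_deriv_le[where z = z and r = r]) auto
      then show "norm (deriv (\<lambda>t. k t x) y) \<le> 2 / r * h x"
        by (simp add: field_simps)
    qed (use w r in \<open>auto simp: dist_norm\<close>)
    then show ?thesis
      using w by (simp add: q_def norm_divide divide_le_eq)
  qed
  have q_lim: "((\<lambda>w. q w x) \<longlongrightarrow> deriv (\<lambda>t. k t x) z) (at 0)" if x: "x \<in> S" for x
    using holomorphic_derivI[OF hol[OF x] open_ball, of z UNIV] r
    by (simp add: q_def DERIV_def)
  have q_int: "q w integrable_on S" "integral S (q w) = (integral S (k (z + w)) - integral S (k z)) / w"
    if "norm w < r/2" for w
  proof -
    have "z + w \<in> ball z r" "z \<in> ball z r" using that r by (auto simp: dist_norm)
    then have "((\<lambda>x. (k (z + w) x - k z x) / w) has_integral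
        (integral S (k (z + w)) - integral S (k z)) / w) S"
      by (intro has_integral_divide has_integral_diff integrable_integral int)
    then show "q w integrable_on S" 
      "integral S (q w) = (integral S (k (z + w)) - integral S (k z)) / w"
      by (auto simp: q_def has_integral_iff)
  qed
  have seq: "(\<lambda>x. deriv (\<lambda>t. k t x) z) integrable_on S \<and>
      (\<lambda>n. integral S (q (X n))) \<longlonglongrightarrow> integral S (\<lambda>x. deriv (\<lambda>t. k t x) z)"
    if X: "X \<longlonglongrightarrow> 0" "\<And>n. X n \<noteq> 0" for X :: "nat \<Rightarrow> complex"
  proof -
    obtain n0 where n0: "\<And>n. n \<ge> n0 \<Longrightarrow> norm (X n) < r/2"
      using LIMSEQ_D[OF X(1), of "r/2"] r by auto
    have Xn: "norm (X (n + n0)) < r/2" for n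
      by (rule n0) simp
    have 1: "q (X (n + n0)) integrable_on S" for n
      by (rule q_int(1)) (rule Xn)
    have 2: "(\<lambda>x. 2 / r * h x) integrable_on S"
      using h by (rule integrable_on_mult_right)
    have 3: "(\<lambda>n. q (X (n + n0)) x) \<longlonglongrightarrow> deriv (\<lambda>t. k t x) z" if "x \<in> S" for x
    proof -
      have "(\<lambda>n. q (X n) x) \<longlonglongrightarrow> deriv (\<lambda>t. k t x) z"
        using q_lim[OF that, unfolded tendsto_at_iff_sequentially comp_def, rule_format, of X] X by simp
      then show ?thesis by (rule LIMSEQ_ignore_initial_segment)
    qed
    note dc = dominated_convergence[OF 1 2 q_le 3]
    have "(\<lambda>x. deriv (\<lambda>t. k t x) z) integrable_on S"
      by (rule dc(1)) (rule Xn X(2) | assumption)+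
    moreover have "(\<lambda>n. integral S (q (X (n + n0)))) \<longlonglongrightarrow> integral S (\<lambda>x. deriv (\<lambda>t. k t x) z)"
      by (rule dc(2)) (rule Xn X(2) | assumption)+
    ultimately show ?thesis
      by (simp add: LIMSEQ_offset)
  qed
  \<comment> \<open>Integrability of the limit is a by-product of dominated convergence along any
    null sequence; this is a concrete one.\<close>
  have X0: "(\<lambda>n. of_real (1 / real (Suc n)) :: complex) \<longlonglongrightarrow> 0"
    using tendsto_of_real[OF LIMSEQ_inverse_real_of_nat, where 'a = complex]
    by (simp add: inverse_eq_divide)
  show ?int
    by (rule conjunct1[OF seq[OF X0]]) (simp del: of_nat_Suc)
  have "((\<lambda>w. integral S (q w)) \<longlongrightarrow> integral S (\<lambda>x. deriv (\<lambda>t. k t x) z)) (at 0)"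
    unfolding tendsto_at_iff_sequentially comp_def by (intro allI impI, rule conjunct2, rule seq) simp_all
  moreover have "\<forall>\<^sub>F w in at 0. integral S (q w) = (integral S (k (z + w)) - integral S (k z)) / w"
    using q_int r by (auto simp: eventually_at intro!: exI[of _ "r/2"])
  ultimately show ?der
    unfolding DERIV_def by (rule Lim_transform_eventually)
qed

text \<open>The majorant may change from point to point, because \<open>F\<close> is bounded only
  locally in \<open>t\<close>. In this local form the condition passes to
  \<open>t\<close>-derivatives, which makes induction on the order of differentiation
  possible.\<close>

definition locally_dominated ::
    "complex set \<Rightarrow> 'b::euclidean_space set \<Rightarrow> (complex \<Rightarrow> 'b \<Rightarrow> complex) \<Rightarrow> bool" where
  "locally_dominated U S k \<longleftrightarrow> (\<forall>z\<in>U. \<exists>r>0. ball z r \<subseteq> U \<and>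
     (\<exists>h. h integrable_on S \<and> (\<forall>t\<in>ball z r. \<forall>x\<in>S. norm (k t x) \<le> h x)))"

text \<open>Halving the radius of the disc costs a factor \<open>2 / r\<close> in the majorant, by
  Cauchy's inequality.\<close>

lemma locally_dominated_deriv:
  fixes k :: "complex \<Rightarrow> 'b::euclidean_space \<Rightarrow> complex"
  assumes hol: "\<And>x. x \<in> S \<Longrightarrow> (\<lambda>t. k t x) holomorphic_on U"
    and dom: "locally_dominated U S k"
  shows "locally_dominated U S (\<lambda>t x. deriv (\<lambda>t. k t x) t)"
  unfolding locally_dominated_def
proof
  fix z assume "z \<in> U"
  then obtain r h where r: "r > 0" "ball z r \<subseteq> U" and h: "h integrable_on S"
      "\<And>t x. t \<in> ball z r \<Longrightarrow> x \<in> S \<Longrightarrow> norm (k t x) \<le> h x"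
    using dom unfolding locally_dominated_def by meson
  have "norm (deriv (\<lambda>t. k t x) t) \<le> 2 / r * h x" if t: "t \<in> ball z (r/2)" and x: "x \<in> S" for t x
  proof -
    have "cball t (r/2) \<subseteq> ball z r"
      using t by (simp add: cball_subset_ball_iff dist_commute)
    then have "norm ((deriv ^^ 1) (\<lambda>t. k t x) t) \<le> fact 1 * h x / (r/2) ^ 1"
      using holomorphic_on_subset[OF hol[OF x] r(2)] h x r
      by (intro norm_deriv_le[where z = z and r = r]) auto
    then show ?thesis by (simp add: field_simps)
  qed
  then have le: "\<forall>t\<in>ball z (r/2). \<forall>x\<in>S. norm (deriv (\<lambda>t. k t x) t) \<le> 2 / r * h x"
    by simp
  have "(\<lambda>x. 2 / r * h x) integrable_on S"
    using h(1) by (rule integrable_on_mult_right)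
  moreover have "ball z (r/2) \<subseteq> U"
    using r by (auto simp: subset_iff)
  moreover have "0 < r/2" using r by simp
  ultimately show "\<exists>r>0. ball z r \<subseteq> U \<and>
      (\<exists>h. h integrable_on S \<and> (\<forall>t\<in>ball z r. \<forall>x\<in>S. norm (deriv (\<lambda>t. k t x) t) \<le> h x))"
    using le by (intro exI[of _ "r/2"] conjI exI[of _ "\<lambda>x. 2 / r * h x"])
qed

lemma has_field_derivative_locally_dominated:
  fixes k :: "complex \<Rightarrow> 'b::euclidean_space \<Rightarrow> complex"
  assumes hol: "\<And>x. x \<in> S \<Longrightarrow> (\<lambda>t. k t x) holomorphic_on U"
    and int: "\<And>t. t \<in> U \<Longrightarrow> k t integrable_on S"
    and dom: "locally_dominated U S k" and z: "z \<in> U"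
  shows "(\<lambda>x. deriv (\<lambda>t. k t x) z) integrable_on S"
    and "((\<lambda>t. integral S (k t)) has_field_derivative integral S (\<lambda>x. deriv (\<lambda>t. k t x) z)) (at z)"
proof -
  obtain r h where r: "r > 0" "ball z r \<subseteq> U" and h: "h integrable_on S"
      "\<And>t x. t \<in> ball z r \<Longrightarrow> x \<in> S \<Longrightarrow> norm (k t x) \<le> h x"
    using dom z unfolding locally_dominated_def by meson
  have holb: "\<And>x. x \<in> S \<Longrightarrow> (\<lambda>t. k t x) holomorphic_on ball z r"
    using hol r(2) by (rule holomorphic_on_subset)
  have intb: "\<And>t. t \<in> ball z r \<Longrightarrow> k t integrable_on S"
    using int r(2) by blast
  show "(\<lambda>x. deriv (\<lambda>t. k t x) z) integrable_on S"
    by (rule has_field_derivative_param_integral(1)[OF r(1) holb intb h])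
  show "((\<lambda>t. integral S (k t)) has_field_derivative integral S (\<lambda>x. deriv (\<lambda>t. k t x) z)) (at z)"
    by (rule has_field_derivative_param_integral(2)[OF r(1) holb intb h])
qed

lemma holomorphic_param_integral:
  fixes k :: "complex \<Rightarrow> 'b::euclidean_space \<Rightarrow> complex"
  assumes "open U" and "\<And>x. x \<in> S \<Longrightarrow> (\<lambda>t. k t x) holomorphic_on U"
    and "\<And>t. t \<in> U \<Longrightarrow> k t integrable_on S" and "locally_dominated U S k"
  shows "(\<lambda>t. integral S (k t)) holomorphic_on U"
  unfolding holomorphic_on_open[OF assms(1)]
proof
  fix z assume "z \<in> U"
  show "\<exists>f'. ((\<lambda>t. integral S (k t)) has_field_derivative f') (at z)"
    by (rule exI, rule has_field_derivative_locally_dominated(2)[OF assms(2-4) \<open>z \<in> U\<close>])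
qed

text \<open>The induction removes the innermost derivative, so its hypothesis is applied to the
  kernel differentiated once in \<open>t\<close>. Differentiation under the integral holds only on
  the open set \<open>U\<close>, hence the congruence near \<open>z\<close>.\<close>

lemma higher_deriv_param_integral:
  fixes k :: "complex \<Rightarrow> 'b::euclidean_space \<Rightarrow> complex"
  assumes U: "open U" and z: "z \<in> U" and "\<And>x. x \<in> S \<Longrightarrow> (\<lambda>t. k t x) holomorphic_on U"
    and "\<And>t. t \<in> U \<Longrightarrow> k t integrable_on S" and "locally_dominated U S k"
  shows "(deriv ^^ n) (\<lambda>t. integral S (k t)) z = integral S (\<lambda>x. (deriv ^^ n) (\<lambda>t. k t x) z)"
  using assms(3-5)
proof (induction n arbitrary: k)
  case (Suc n)
  note der = has_field_derivative_locally_dominated[OF Suc.prems]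
  have IH: "(deriv ^^ n) (\<lambda>t. integral S (\<lambda>x. deriv (\<lambda>t. k t x) t)) z =
      integral S (\<lambda>x. (deriv ^^ n) (\<lambda>t. deriv (\<lambda>t. k t x) t) z)"
  proof (rule Suc.IH)
    show "(\<lambda>t. deriv (\<lambda>t. k t x) t) holomorphic_on U" if "x \<in> S" for x
      using Suc.prems(1)[OF that] U by (rule holomorphic_deriv)
    show "locally_dominated U S (\<lambda>t x. deriv (\<lambda>t. k t x) t)"
      by (rule locally_dominated_deriv[OF Suc.prems(1,3)])
  qed (rule der(1))
  have "(deriv ^^ Suc n) (\<lambda>t. integral S (k t)) z = (deriv ^^ n) (deriv (\<lambda>t. integral S (k t))) z"
    by (simp add: funpow_swap1)
  also have "\<dots> = (deriv ^^ n) (\<lambda>t. integral S (\<lambda>x. deriv (\<lambda>t. k t x) t)) z"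
  proof (rule higher_deriv_cong_ev)
    show "\<forall>\<^sub>F w in nhds z. deriv (\<lambda>t. integral S (k t)) w = integral S (\<lambda>x. deriv (\<lambda>t. k t x) w)"
      using eventually_nhds_in_open[OF U z]
      by eventually_elim (rule DERIV_imp_deriv, rule der(2))
  qed simp
  finally show ?case
    using IH by (simp add: funpow_swap1)
qed simp

text \<open>Taylor's formula of order one, where Cauchy's inequality on discs of radius
  \<open>r/2\<close> bounds the second derivative by \<open>2 B / (r/2)^2\<close>. An explicit error
  is wanted because it is uniform in any parameter on which \<open>f\<close> depends with the same
  \<open>B\<close>.\<close>

lemma difference_quotient_error:
  assumes "f holomorphic_on ball z r" and "0 < r" and "\<And>x. x \<in> ball z r \<Longrightarrow> norm (f x) \<le> B"
    and h: "h \<noteq> 0" "norm h < r/2"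
  shows "norm ((f (z + h) - f z) / h - deriv f z) \<le> 8 * B / r\<^sup>2 * norm h"
proof -
  have "norm ((deriv ^^ 0) f (z + h) - (\<Sum>i\<le>1. (deriv ^^ i) f z * ((z + h) - z) ^ i / fact i))
      \<le> 8 * B / r\<^sup>2 * norm ((z + h) - z) ^ Suc 1 / fact 1"
  proof (rule field_Taylor[where S = "ball z (r/2)"])
    fix i :: nat and x assume x: "x \<in> ball z (r/2)"
    then have xr: "x \<in> ball z r" using assms(2) by auto
    show "((deriv ^^ i) f has_field_derivative (deriv ^^ Suc i) f x) (at x within ball z (r/2))"
      using holomorphic_derivI[OF holomorphic_higher_deriv[OF assms(1) open_ball] open_ball xr]
      by (simp add: has_field_derivative_at_within)
    have "cball x (r/2) \<subseteq> ball z r"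
      using x by (simp add: cball_subset_ball_iff dist_commute)
    from norm_deriv_le[OF assms(1) _ this assms(3), of 2] assms(2)
    show "norm ((deriv ^^ Suc 1) f x) \<le> 8 * B / r\<^sup>2"
      by (simp add: numeral_2_eq_2[symmetric] power_divide)
  qed (use h assms(2) in \<open>auto simp: dist_norm\<close>)
  then have "norm (f (z + h) - f z - deriv f z * h) \<le> 8 * B / r\<^sup>2 * norm h * norm h"
    by (simp add: power2_eq_square algebra_simps)
  moreover have "(f (z + h) - f z) / h - deriv f z = (f (z + h) - f z - deriv f z * h) / h"
    using h by (simp add: field_simps)
  ultimately show ?thesis
    using h by (simp add: norm_divide divide_le_eq)
qed

text \<open>Differentiation in \<open>w\<close> commutes with \<open>t\<close>-derivatives of every
  order: the difference quotients in \<open>w\<close> are holomorphic in \<open>t\<close> and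
  converge uniformly on small discs, so Weierstrass' theorem carries the limit over to all
  \<open>t\<close>-derivatives.\<close>

lemma higher_deriv_mixed:
  fixes g :: "complex \<Rightarrow> complex \<Rightarrow> complex"
  assumes A: "open A" and r: "0 < r"
    and cont: "continuous_on (A \<times> ball z r) (\<lambda>(t, w). g t w)"
    and hol1: "\<And>w. w \<in> ball z r \<Longrightarrow> (\<lambda>t. g t w) holomorphic_on A"
    and hol2: "\<And>t. t \<in> A \<Longrightarrow> g t holomorphic_on ball z r"
  shows "(\<lambda>t. deriv (g t) z) holomorphic_on A"
    and "\<And>n t. t \<in> A \<Longrightarrow>
      ((\<lambda>w. (deriv ^^ n) (\<lambda>t. g t w) t) has_field_derivative (deriv ^^ n) (\<lambda>t. deriv (g t) z) t) (at z)"
proof -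
  define q where "q = (\<lambda>h t. (g t (z + h) - g t z) / h)"
  have holq: "q h holomorphic_on A" if "norm h < r" for h
    unfolding q_def divide_inverse using that r
    by (intro holomorphic_intros hol1) (auto simp: dist_norm)
  have unif: "\<exists>e>0. cball t e \<subseteq> A \<and> uniform_limit (cball t e) q (\<lambda>t. deriv (g t) z) (at 0)"
    if t: "t \<in> A" for t
  proof -
    obtain e where e: "e > 0" "cball t e \<subseteq> A" using A t open_contains_cball by blast
    \<comment> \<open>A compact polydisc yields one bound \<open>B\<close> for all \<open>t'\<close>
      near \<open>t\<close>, which makes the error of the difference quotient uniform.\<close>
    have "compact ((\<lambda>(t, w). g t w) ` (cball t e \<times> cball z (r/2)))"
    proof (intro compact_continuous_image continuous_on_subset[OF cont] compact_Times Sigma_mono)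
      show "cball z (r/2) \<subseteq> ball z r" using r by (simp add: cball_subset_ball_iff)
    qed (use e in auto)
    then obtain B where "\<And>y. y \<in> (\<lambda>(t, w). g t w) ` (cball t e \<times> cball z (r/2)) \<Longrightarrow> norm y \<le> B"
      by (meson compact_imp_bounded bounded_iff)
    then have B: "norm (g t' w) \<le> B" if "t' \<in> cball t e" "w \<in> cball z (r/2)" for t' w
      using that by blast
    have err: "norm (q h t' - deriv (g t') z) \<le> 8 * B / (r/2)\<^sup>2 * norm h"
      if t': "t' \<in> cball t e" and h: "h \<noteq> 0" "norm h < r/2/2" for h t'
      unfolding q_def
    proof (rule difference_quotient_error)
      show "g t' holomorphic_on ball z (r/2)"
        by (rule holomorphic_on_subset[OF hol2]) (use e t' r in auto)
    qed (use B t' h r in auto)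
    have "uniform_limit (cball t e) q (\<lambda>t. deriv (g t) z) (at 0)"
    proof (rule uniform_limitI)
      fix \<epsilon> :: real assume \<epsilon>: "\<epsilon> > 0"
      have "((\<lambda>h::complex. 8 * B / (r/2)\<^sup>2 * norm h) \<longlongrightarrow> 8 * B / (r/2)\<^sup>2 * norm (0::complex)) (at 0)"
        by (intro tendsto_intros)
      then have 1: "\<forall>\<^sub>F h::complex in at 0. 8 * B / (r/2)\<^sup>2 * norm h < \<epsilon>"
        using \<epsilon> by (intro order_tendstoD(2)) auto
      have 2: "\<forall>\<^sub>F h::complex in at 0. h \<noteq> 0 \<and> norm h < r/2/2"
        using r by (auto simp: eventually_at intro!: exI[of _ "r/2/2"])
      show "\<forall>\<^sub>F h in at 0. \<forall>t'\<in>cball t e. dist (q h t') (deriv (g t') z) < \<epsilon>"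
        using 1 2
      proof eventually_elim
        case (elim h)
        then show ?case
          unfolding dist_norm by (intro ballI le_less_trans[OF err]) auto
      qed
    qed
    with e show ?thesis by (intro exI[of _ e] conjI)
  qed
  have ev: "\<forall>\<^sub>F h in at 0. q h holomorphic_on A"
    using r holq by (auto simp: eventually_at intro!: exI[of _ r])
  show "(\<lambda>t. deriv (g t) z) holomorphic_on A"
    unfolding holomorphic_on_open[OF A]
  proof
    fix t assume "t \<in> A"
    from unif[OF this] obtain e where e: "e > 0" "cball t e \<subseteq> A"
      "uniform_limit (cball t e) q (\<lambda>t. deriv (g t) z) (at 0)" by blast
    have "\<forall>\<^sub>F h in at 0. continuous_on (cball t e) (q h) \<and> q h holomorphic_on ball t e"
      using ev
    proof eventually_elim
      case (elim h)
      then have "q h holomorphic_on cball t e" using e(2) by (rule holomorphic_on_subset)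
      then show ?case
        by (metis ball_subset_cball holomorphic_on_imp_continuous_on holomorphic_on_subset)
    qed
    then have "(\<lambda>t. deriv (g t) z) holomorphic_on ball t e"
      by (rule holomorphic_uniform_limit[OF _ e(3)]) auto
    then show "\<exists>f'. ((\<lambda>t. deriv (g t) z) has_field_derivative f') (at t)"
      using e(1) unfolding holomorphic_on_open[OF open_ball] by auto
  qed
  fix n t assume t: "t \<in> A"
  from unif[OF this] obtain e where e: "e > 0" "cball t e \<subseteq> A"
      "uniform_limit (cball t e) q (\<lambda>t. deriv (g t) z) (at 0)" by blast
  have lim: "((\<lambda>h. (deriv ^^ n) (q h) t) \<longlongrightarrow> (deriv ^^ n) (\<lambda>t. deriv (g t) z) t) (at 0)"
  proof (rule higher_deriv_complex_uniform_limit)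
    show "uniform_limit (ball t e) q (\<lambda>t. deriv (g t) z) (at 0)"
      using e(3) ball_subset_cball uniform_limit_on_subset by blast
    show "\<forall>\<^sub>F h in at 0. q h holomorphic_on ball t e"
      using ev by eventually_elim (rule holomorphic_on_subset, assumption, use e(2) in auto)
  qed (use e in auto)
  \<comment> \<open>By linearity the \<open>t\<close>-derivative of the quotient is a difference
    quotient in \<open>w\<close> of the \<open>t\<close>-derivative, so the limit just found is the
    derivative that is claimed.\<close>
  have eq: "(deriv ^^ n) (q h) t =
      ((deriv ^^ n) (\<lambda>t. g t (z + h)) t - (deriv ^^ n) (\<lambda>t. g t z) t) / h"
    if h: "h \<noteq> 0" "norm h < r" for h
  proof -
    have hol: "(\<lambda>t. g t (z + h)) holomorphic_on A" "(\<lambda>t. g t z) holomorphic_on A"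
      using h r by (auto intro!: hol1 simp: dist_norm)
    have "(deriv ^^ n) (\<lambda>t. inverse h * (g t (z + h) - g t z)) t =
        inverse h * (deriv ^^ n) (\<lambda>t. g t (z + h) - g t z) t"
      by (rule higher_deriv_cmult[OF _ t A]) (intro holomorphic_intros hol)
    also have "(deriv ^^ n) (\<lambda>t. g t (z + h) - g t z) t =
        (deriv ^^ n) (\<lambda>t. g t (z + h)) t - (deriv ^^ n) (\<lambda>t. g t z) t"
      by (rule higher_deriv_diff[OF hol A t])
    finally show ?thesis
      by (simp add: q_def divide_inverse mult.commute)
  qed
  have "\<forall>\<^sub>F h in at 0. (deriv ^^ n) (q h) t =
      ((deriv ^^ n) (\<lambda>t. g t (z + h)) t - (deriv ^^ n) (\<lambda>t. g t z) t) / h"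
    using r eq by (auto simp: eventually_at intro!: exI[of _ r])
  then show "((\<lambda>w. (deriv ^^ n) (\<lambda>t. g t w) t) has_field_derivative
      (deriv ^^ n) (\<lambda>t. deriv (g t) z) t) (at z)"
    unfolding DERIV_def by (rule Lim_transform_eventually[OF lim])
qed

subsection \<open>Charts and horizontal rays\<close>

text \<open>A chart is recorded by its inverse \<open>q\<close> on a plane disc, so that a function
  on the surface is studied as \<open>f (q w)\<close> with the plane theory of holomorphic
  functions.\<close>

definition local_chart ::
    "('a::t2_space \<Rightarrow> complex) \<Rightarrow> 'a set \<Rightarrow> complex \<Rightarrow> real \<Rightarrow> (complex \<Rightarrow> 'a) \<Rightarrow> bool" where
  "local_chart p S c r q \<longleftrightarrow> 0 < r \<and> q ` ball c r \<subseteq> S \<and> open (q ` ball c r) \<and>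
     homeomorphism (q ` ball c r) (ball c r) p q"

lemma local_chartD:
  assumes "local_chart p S c r q"
  shows "0 < r" "open (q ` ball c r)" "continuous_on (ball c r) q" "continuous_on (q ` ball c r) p"
    and "\<And>z. z \<in> ball c r \<Longrightarrow> q z \<in> S" "\<And>z. z \<in> ball c r \<Longrightarrow> p (q z) = z"
  using assms by (auto simp: local_chart_def homeomorphism_def)

lemma local_chart_homeomorphism:
  assumes "homeomorphism D (ball c r) p q" "open D" "D \<subseteq> S" "0 < r"
  shows "local_chart p S c r q"
  using assms unfolding local_chart_def by (metis homeomorphism_def)

text \<open>The homeomorphism supplied by \<open>spread_over_plane\<close> may have any open image;
  it is cut down to \<open>S\<close>, and a disc is chosen inside the image of what remains.\<close>

lemma ex_local_chart:
  assumes p: "spread_over_plane p G" and S: "open S" "S \<subseteq> G" and \<xi>: "\<xi> \<in> S"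
  obtains r q where "local_chart p S (p \<xi>) r q" "q (p \<xi>) = \<xi>"
proof -
  obtain D q where D: "\<xi> \<in> D" "open D" "open (p ` D)" and hom: "homeomorphism D (p ` D) p q"
    using p S(2) \<xi> unfolding spread_over_plane_def by (meson subsetD)
  have "openin (top_of_set (p ` D)) (p ` (D \<inter> S))"
    using hom by (rule homeomorphism_imp_open_map) (use S in \<open>auto simp: openin_open\<close>)
  then have "open (p ` (D \<inter> S))"
    using D(3) by (rule openin_open_trans)
  then obtain r where r: "0 < r" "ball (p \<xi>) r \<subseteq> p ` (D \<inter> S)"
    using D(1) \<xi> unfolding open_contains_ball by blast
  have qp: "q (p x) = x" if "x \<in> D" for x
    using hom that by (simp add: homeomorphism_def)
  have sub: "q ` ball (p \<xi>) r \<subseteq> D \<inter> S"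
    using r(2) qp by (auto simp: subset_iff)
  have "openin (top_of_set D) (q ` ball (p \<xi>) r)"
    using homeomorphism_symD[OF hom]
    by (rule homeomorphism_imp_open_map) (use r in \<open>auto simp: openin_open_eq[OF D(3)]\<close>)
  then have "open (q ` ball (p \<xi>) r)"
    using D(2) by (rule openin_open_trans)
  moreover have "homeomorphism (q ` ball (p \<xi>) r) (ball (p \<xi>) r) p q"
  proof (rule homeomorphism_symD, rule homeomorphism_of_subsets[OF homeomorphism_symD[OF hom]])
    show "ball (p \<xi>) r \<subseteq> p ` D" using r(2) by auto
  qed (use sub in auto)
  ultimately have "local_chart p S (p \<xi>) r q"
    using r(1) sub by (simp add: local_chart_def)
  with qp[OF D(1)] show thesis by (intro that)
qed

section \<open>Limits, derivatives and holomorphy read in charts\<close>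

lemma filterlim_chart:
  assumes ch: "local_chart p S c r q" and z: "z \<in> ball c r"
  shows "filterlim q (at (q z)) (at z)"
proof (rule filterlim_atI)
  show "(q \<longlongrightarrow> q z) (at z)"
    using local_chartD(3)[OF ch] z by (simp add: continuous_on_eq_continuous_at isCont_def)
  have "\<forall>\<^sub>F w in at z. w \<in> ball c r"
    using z by (intro eventually_at_in_open') auto
  moreover have "\<forall>\<^sub>F w in at z. w \<noteq> z"
    by (simp add: eventually_at_filter)
  ultimately show "\<forall>\<^sub>F w in at z. q w \<noteq> q z"
    by eventually_elim (metis local_chartD(6)[OF ch] z)
qed

lemma filterlim_chart_inverse:
  assumes ch: "local_chart p S c r q" and z: "z \<in> ball c r"
  shows "filterlim p (at z) (at (q z))"
proof (rule filterlim_atI)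
  have "(p \<longlongrightarrow> p (q z)) (at (q z))"
    using local_chartD(2,4)[OF ch] z by (simp add: continuous_on_eq_continuous_at isCont_def)
  then show "(p \<longlongrightarrow> z) (at (q z))"
    using local_chartD(6)[OF ch z] by simp
  have "\<forall>\<^sub>F w in at (q z). w \<in> q ` ball c r"
    using z by (intro eventually_at_in_open' local_chartD(2)[OF ch]) auto
  moreover have "\<forall>\<^sub>F w in at (q z). w \<noteq> q z"
    by (simp add: eventually_at_filter)
  ultimately show "\<forall>\<^sub>F w in at (q z). p w \<noteq> z"
    by eventually_elim (use local_chartD(6)[OF ch] in auto)
qed

lemma eventually_chart_inverse:
  assumes ch: "local_chart p S c r q" and z: "z \<in> ball c r"
  shows "\<forall>\<^sub>F \<zeta> in at (q z). q (p \<zeta>) = \<zeta>"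
proof -
  have "\<forall>\<^sub>F w in at (q z). w \<in> q ` ball c r"
    using z by (intro eventually_at_in_open' local_chartD(2)[OF ch]) auto
  then show ?thesis
    by eventually_elim (use local_chartD(6)[OF ch] in auto)
qed

text \<open>Points of the surface are not isolated because points of a disc are not. This makes
  \<open>coord_deriv\<close>, defined by \<open>Lim\<close>, equal to the derivative whenever that
  exists.\<close>

lemma at_chart_neq_bot:
  assumes ch: "local_chart p S c r q" and z: "z \<in> ball c r"
  shows "at (q z) \<noteq> bot"
proof
  assume "at (q z) = bot"
  then have "\<forall>\<^sub>F w in at (q z). False" by simp
  then have "\<forall>\<^sub>F w in at z. False"
    using filterlim_chart[OF assms] unfolding filterlim_iff by blast
  then show False by simp
qed

lemma has_coord_deriv_chart:
  assumes ch: "local_chart p S c r q" and z: "z \<in> ball c r"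
  shows "has_coord_deriv p f f' (q z) \<longleftrightarrow> ((\<lambda>w. f (q w)) has_field_derivative f') (at z)"
proof
  assume "has_coord_deriv p f f' (q z)"
  then have *: "((\<lambda>w. (f (q w) - f (q z)) / (p (q w) - p (q z))) \<longlongrightarrow> f') (at z)"
    unfolding has_coord_deriv_def by (rule filterlim_compose) (rule filterlim_chart[OF assms])
  have "\<forall>\<^sub>F w in at z. w \<in> ball c r"
    using z by (intro eventually_at_in_open') auto
  then have "\<forall>\<^sub>F w in at z. (f (q w) - f (q z)) / (p (q w) - p (q z)) = (f (q w) - f (q z)) / (w - z)"
    by eventually_elim (simp only: local_chartD(6)[OF ch] z)
  then show "((\<lambda>w. f (q w)) has_field_derivative f') (at z)"
    unfolding has_field_derivative_iff by (rule Lim_transform_eventually[OF *])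
next
  assume "((\<lambda>w. f (q w)) has_field_derivative f') (at z)"
  then have *: "((\<lambda>\<zeta>. (f (q (p \<zeta>)) - f (q z)) / (p \<zeta> - z)) \<longlongrightarrow> f') (at (q z))"
    unfolding has_field_derivative_iff
    by (rule filterlim_compose) (rule filterlim_chart_inverse[OF assms])
  have "\<forall>\<^sub>F \<zeta> in at (q z). (f (q (p \<zeta>)) - f (q z)) / (p \<zeta> - z) = (f \<zeta> - f (q z)) / (p \<zeta> - p (q z))"
    using eventually_chart_inverse[OF assms]
    by eventually_elim (simp add: local_chartD(6)[OF assms])
  then show "has_coord_deriv p f f' (q z)"
    unfolding has_coord_deriv_def by (rule Lim_transform_eventually[OF *])
qed

lemma coord_deriv_chart:
  assumes "local_chart p S c r q" "z \<in> ball c r" "((\<lambda>w. f (q w)) has_field_derivative f') (at z)"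
  shows "coord_deriv p f (q z) = f'"
  using assms by (intro coord_deriv_eqI at_chart_neq_bot has_coord_deriv_chart[THEN iffD2])

lemma isCont_chart:
  assumes ch: "local_chart p S c r q" and z: "z \<in> ball c r" and "isCont (\<lambda>w. f (q w)) z"
  shows "isCont f (q z)"
proof -
  have "((\<lambda>\<zeta>. f (q (p \<zeta>))) \<longlongrightarrow> f (q z)) (at (q z))"
    using assms(3) unfolding isCont_def by (rule filterlim_compose) (rule filterlim_chart_inverse[OF ch z])
  moreover have "\<forall>\<^sub>F \<zeta> in at (q z). f (q (p \<zeta>)) = f \<zeta>"
    using eventually_chart_inverse[OF ch z] by eventually_elim simp
  ultimately show ?thesis
    unfolding isCont_def by (rule Lim_transform_eventually)
qed

lemma surface_holomorphic_chart:
  assumes ch: "local_chart p S c r q" and "surface_holomorphic_on p f S"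
  shows "(\<lambda>w. f (q w)) holomorphic_on ball c r"
  unfolding holomorphic_on_open[OF open_ball]
proof
  fix z assume z: "z \<in> ball c r"
  then show "\<exists>f'. ((\<lambda>w. f (q w)) has_field_derivative f') (at z)"
    using assms(2) local_chartD(5)[OF ch z] unfolding surface_holomorphic_on_def
      has_coord_deriv_chart[OF ch z, symmetric] by blast
qed

lemma surface_holomorphic_on_continuous:
  assumes p: "spread_over_plane p G" "open S" "S \<subseteq> G" and f: "surface_holomorphic_on p f S"
  shows "continuous_on S f" and "continuous_on S (coord_deriv p f)"
proof -
  have "isCont f \<xi> \<and> isCont (coord_deriv p f) \<xi>" if \<xi>: "\<xi> \<in> S" for \<xi>
  proof -
    obtain r q where ch: "local_chart p S (p \<xi>) r q" and q: "q (p \<xi>) = \<xi>"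
      using ex_local_chart[OF p \<xi>] by blast
    have c: "p \<xi> \<in> ball (p \<xi>) r" using local_chartD(1)[OF ch] by simp
    have hol: "(\<lambda>w. f (q w)) holomorphic_on ball (p \<xi>) r"
      by (rule surface_holomorphic_chart[OF ch f])
    have hol': "(\<lambda>w. coord_deriv p f (q w)) holomorphic_on ball (p \<xi>) r"
    proof (rule holomorphic_transform)
      show "deriv (\<lambda>w. f (q w)) holomorphic_on ball (p \<xi>) r"
        using hol by (rule holomorphic_deriv) simp
      show "deriv (\<lambda>w. f (q w)) z = coord_deriv p f (q z)" if "z \<in> ball (p \<xi>) r" for z
        using coord_deriv_chart[OF ch that holomorphic_derivI[OF hol open_ball that]] by simp
    qed
    have "isCont (\<lambda>w. f (q w)) (p \<xi>)" "isCont (\<lambda>w. coord_deriv p f (q w)) (p \<xi>)"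
      using c holomorphic_on_imp_continuous_on[OF hol] holomorphic_on_imp_continuous_on[OF hol']
      by (simp_all add: continuous_on_eq_continuous_at)
    then show ?thesis
      using isCont_chart[OF ch c, of f] isCont_chart[OF ch c, of "coord_deriv p f"] q by simp
  qed
  then show "continuous_on S f" "continuous_on S (coord_deriv p f)"
    using p(2) by (simp_all add: continuous_on_eq_continuous_at)
qed

text \<open>Composing the defining limit with the chart in the second variable gives an ordinary
  Frechet derivative on pairs of complex numbers; injectivity of the chart keeps the punctured
  neighbourhoods punctured. Restriction to the two coordinate slices identifies \<open>a\<close> and
  \<open>b\<close> as the partial derivatives.\<close>

lemma jointly_holomorphic_chart:
  assumes ch: "local_chart p S c r q" and F: "jointly_holomorphic_on p F U S"
    and t: "t \<in> U" and z: "z \<in> ball c r"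
  shows "((\<lambda>x. F (fst x) (q (snd x))) has_derivative
      (\<lambda>h. deriv (\<lambda>t. F t (q z)) t * fst h + deriv (\<lambda>w. F t (q w)) z * snd h)) (at (t, z))"
    and "(\<lambda>t. F t (q z)) field_differentiable at t"
    and "(\<lambda>w. F t (q w)) field_differentiable at z"
proof -
  obtain a b where ab: "((\<lambda>(t', \<zeta>). (F t' \<zeta> - F t (q z) - a * (t' - t) - b * (p \<zeta> - p (q z))) /
            of_real (norm (t' - t, p \<zeta> - p (q z)))) \<longlongrightarrow> 0) (at (t, q z))"
    using F t local_chartD(5)[OF ch z] unfolding jointly_holomorphic_on_def by blast
  define g where "g = (\<lambda>x. F (fst x) (q (snd x)))"
  define D where "D = (\<lambda>h::complex \<times> complex. a * fst h + b * snd h)"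
  have ev: "\<forall>\<^sub>F x in at (t, z). x \<in> UNIV \<times> ball c r"
    using z by (intro eventually_at_in_open' open_Times) auto
  have lim: "filterlim (\<lambda>x. (fst x, q (snd x))) (at (t, q z)) (at (t, z))"
  proof (rule filterlim_atI)
    have "isCont q z"
      using local_chartD(3)[OF ch] z by (simp add: continuous_on_eq_continuous_at)
    then show "((\<lambda>x. (fst x, q (snd x))) \<longlongrightarrow> (t, q z)) (at (t, z))"
      by (intro tendsto_Pair) (auto intro!: tendsto_eq_intros isCont_tendsto_compose[of z q])
    have "\<forall>\<^sub>F x in at (t, z). x \<noteq> (t, z)"
      by (simp add: eventually_at_filter)
    with ev show "\<forall>\<^sub>F x in at (t, z). (fst x, q (snd x)) \<noteq> (t, q z)"
      by eventually_elim (metis local_chartD(6)[OF ch] z mem_Times_iff prod.collapse prod.inject)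
  qed
  have "((\<lambda>x. (g x - g (t, z) - D (x - (t, z))) / of_real (norm (x - (t, z)))) \<longlongrightarrow> 0) (at (t, z))"
  proof (rule Lim_transform_eventually[OF filterlim_compose[OF ab lim]])
    show "\<forall>\<^sub>F x in at (t, z). (case (fst x, q (snd x)) of (t', \<zeta>) \<Rightarrow>
        (F t' \<zeta> - F t (q z) - a * (t' - t) - b * (p \<zeta> - p (q z))) /
            of_real (norm (t' - t, p \<zeta> - p (q z)))) =
        (g x - g (t, z) - D (x - (t, z))) / of_real (norm (x - (t, z)))"
      using ev
    proof eventually_elim
      case (elim x)
      then show ?case
        using local_chartD(6)[OF ch, of "snd x"] local_chartD(6)[OF ch z]
        by (cases x) (simp add: g_def D_def algebra_simps)
    qed
  qed
  then have "((\<lambda>x. norm ((g x - g (t, z) - D (x - (t, z))) / of_real (norm (x - (t, z))))) \<longlongrightarrow> 0) (at (t, z))"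
    by (rule tendsto_norm_zero)
  then have "((\<lambda>x. norm (g x - g (t, z) - D (x - (t, z))) / norm (x - (t, z))) \<longlongrightarrow> 0) (at (t, z))"
    by (simp add: norm_divide)
  moreover have "bounded_linear D"
    unfolding D_def by (intro bounded_linear_add bounded_linear_const_mult bounded_linear_fst bounded_linear_snd)
  ultimately have der: "(g has_derivative D) (at (t, z))"
    by (simp add: has_derivative_iff_norm)
  have "((\<lambda>t'. (t', z)) has_derivative (\<lambda>h. (h, 0))) (at t)"
    by (auto intro!: derivative_eq_intros)
  from has_derivative_compose[OF this, of g D] der
  have 1: "((\<lambda>t. F t (q z)) has_field_derivative a) (at t)"
    by (simp add: g_def D_def has_field_derivative_def)
  have "((\<lambda>w. (t, w)) has_derivative (\<lambda>h. (0, h))) (at z)"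
    by (auto intro!: derivative_eq_intros)
  from has_derivative_compose[OF this, of g D] der
  have 2: "((\<lambda>w. F t (q w)) has_field_derivative b) (at z)"
    by (simp add: g_def D_def has_field_derivative_def)
  show "(\<lambda>t. F t (q z)) field_differentiable at t" "(\<lambda>w. F t (q w)) field_differentiable at z"
    using 1 2 unfolding field_differentiable_def by blast+
  show "((\<lambda>x. F (fst x) (q (snd x))) has_derivative
      (\<lambda>h. deriv (\<lambda>t. F t (q z)) t * fst h + deriv (\<lambda>w. F t (q w)) z * snd h)) (at (t, z))"
    using der by (simp add: DERIV_imp_deriv[OF 1] DERIV_imp_deriv[OF 2] g_def D_def)
qed

text \<open>Uniqueness of lifts: on the connected half-line the truth value of
  \<open>\<gamma> x = \<delta> x\<close> is locally constant. Where the lifts agree, local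
  injectivity of \<open>p\<close> keeps them together; where they differ, the Hausdorff property
  keeps them apart.\<close>

lemma horizontal_ray_unique:
  assumes p: "spread_over_plane p G" and S: "S \<subseteq> G"
    and \<gamma>: "horizontal_ray p s S \<xi> \<gamma>" and \<delta>: "horizontal_ray p s S \<xi> \<delta>" and x: "x \<ge> 0"
  shows "\<gamma> x = \<delta> x"
proof -
  have cont: "continuous_on {0..} \<gamma>" "continuous_on {0..} \<delta>" and "\<gamma> 0 = \<delta> 0"
    and pp: "\<And>x. x \<ge> 0 \<Longrightarrow> p (\<gamma> x) = p (\<delta> x)" and inS: "\<And>x. x \<ge> 0 \<Longrightarrow> \<gamma> x \<in> S"
    using \<gamma> \<delta> by (auto simp: horizontal_ray_def)
  have "(\<gamma> 0 = \<delta> 0) = (\<gamma> x = \<delta> x)"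
  proof (rule connected_equivalence_relation[where S = "{0..}"
        and R = "\<lambda>x y. (\<gamma> x = \<delta> x) = (\<gamma> y = \<delta> y)"])
    fix a :: real assume a: "a \<in> {0..}"
    have "\<exists>A B. open A \<and> open B \<and> \<gamma> a \<in> A \<and> \<delta> a \<in> B \<and>
        (\<forall>x\<ge>0. \<gamma> x \<in> A \<longrightarrow> \<delta> x \<in> B \<longrightarrow> (\<gamma> a = \<delta> a) = (\<gamma> x = \<delta> x))"
    proof (cases "\<gamma> a = \<delta> a")
      case True
      obtain D q where D: "\<gamma> a \<in> D" "open D" and hom: "homeomorphism D (p ` D) p q"
        using p S inS[of a] a unfolding spread_over_plane_def by (metis atLeast_iff subsetD)
      have inj: "u = v" if "u \<in> D" "v \<in> D" "p u = p v" for u v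
        using hom that unfolding homeomorphism_def by metis
      show ?thesis
        by (rule exI[of _ D], rule exI[of _ D]) (use D True inj pp in auto)
    next
      case False
      then obtain A B where "open A" "open B" "\<gamma> a \<in> A" "\<delta> a \<in> B" "A \<inter> B = {}"
        using hausdorff by metis
      with False show ?thesis
        by (intro exI[of _ A] exI[of _ B]) auto
    qed
    then obtain A B where A: "open A" "\<gamma> a \<in> A" and B: "open B" "\<delta> a \<in> B"
      and AB: "\<And>x. x \<ge> 0 \<Longrightarrow> \<gamma> x \<in> A \<Longrightarrow> \<delta> x \<in> B \<Longrightarrow> (\<gamma> a = \<delta> a) = (\<gamma> x = \<delta> x)"
      by metis
    show "\<exists>T. openin (top_of_set {0..}) T \<and> a \<in> T \<and> (\<forall>x\<in>T. (\<gamma> a = \<delta> a) = (\<gamma> x = \<delta> x))"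
    proof (intro exI[of _ "({0..} \<inter> \<gamma> -` A) \<inter> ({0..} \<inter> \<delta> -` B)"] conjI ballI)
      show "openin (top_of_set {0..}) (({0..} \<inter> \<gamma> -` A) \<inter> ({0..} \<inter> \<delta> -` B))"
        by (intro openin_Int continuous_openin_preimage_gen cont A B)
      show "(\<gamma> a = \<delta> a) = (\<gamma> x = \<delta> x)"
        if "x \<in> ({0..} \<inter> \<gamma> -` A) \<inter> ({0..} \<inter> \<delta> -` B)" for x
        by (rule AB) (use that in auto)
      show "a \<in> ({0..} \<inter> \<gamma> -` A) \<inter> ({0..} \<inter> \<delta> -` B)"
        using a A(2) B(2) by simp
    qed
  qed (use x in auto)
  with \<open>\<gamma> 0 = \<delta> 0\<close> show ?thesis by simp
qed

lemma horizontal_ray_shift: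
  assumes "horizontal_ray p s S \<xi> \<gamma>" "y \<ge> 0"
  shows "horizontal_ray p s S (\<gamma> y) (\<lambda>x. \<gamma> (y + x))"
proof -
  have "continuous_on {0..} \<gamma>"
    using assms(1) by (simp add: horizontal_ray_def)
  then have "continuous_on {0..} (\<lambda>x. \<gamma> (y + x))"
    by (rule continuous_on_compose2) (use assms(2) in \<open>auto intro!: continuous_intros\<close>)
  moreover have "\<gamma> x \<in> S" "p (\<gamma> x) = p \<xi> - of_real (s * x)" if "x \<ge> 0" for x
    using assms(1) that by (simp_all add: horizontal_ray_def)
  moreover from this have "p (\<gamma> (y + x)) = p (\<gamma> y) - of_real (s * x)" if "x \<ge> 0" for x
    using assms(2) that by (simp add: distrib_left)
  ultimately show ?thesis
    using assms(2) by (simp add: horizontal_ray_def)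
qed

subsection \<open>Power series, Laplace integrals and the half-strip\<close>

text \<open>Convergence at the one point \<open>R/2\<close> forces a positive radius of convergence,
  after which the coefficients of the formal power series are given by derivatives at 0.\<close>

lemma higher_deriv_powser:
  fixes a :: "nat \<Rightarrow> complex"
  assumes R: "0 < R" and f: "\<And>t. t \<in> ball 0 R \<Longrightarrow> (\<lambda>n. a n * t ^ n) sums f t"
  shows "(deriv ^^ n) f 0 = fact n * a n"
proof -
  have "norm (of_real (R/2) :: complex) \<le> conv_radius a"
    using f[of "of_real (R/2)"] R by (intro conv_radius_geI) (auto simp: sums_iff)
  moreover have "0 < ereal (norm (of_real (R/2) :: complex))"
    using R by simp
  ultimately have "0 < conv_radius a" by (rule less_le_trans[rotated])
  then have "0 < fps_conv_radius (Abs_fps a)"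
    by (simp add: fps_conv_radius_def)
  then have "a n = (deriv ^^ n) (eval_fps (Abs_fps a)) 0 / fact n"
    using fps_nth_conv_deriv[of "Abs_fps a" n] by simp
  also have "(deriv ^^ n) (eval_fps (Abs_fps a)) 0 = (deriv ^^ n) f 0"
  proof (rule higher_deriv_cong_ev)
    have "\<forall>\<^sub>F t in nhds 0. t \<in> ball (0::complex) R"
      using R by (intro eventually_nhds_in_open) auto
    then show "\<forall>\<^sub>F t in nhds 0. eval_fps (Abs_fps a) t = f t"
    proof eventually_elim
      case (elim t)
      show ?case using f[OF elim] by (simp add: eval_fps_def sums_iff)
    qed
  qed simp
  finally show ?thesis by simp
qed

text \<open>Watson's lemma with an explicit error: the boundary terms at 0 of \<open>N\<close>
  integrations by parts form the sum, and the integral that remains is bounded by that of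
  \<open>M N * exp (- (Re u - \<sigma>) t)\<close>.\<close>

lemma laplace_remainder:
  fixes g :: "complex \<Rightarrow> complex"
  assumes hol: "g holomorphic_on S" and S: "open S" "\<And>t. t \<ge> 0 \<Longrightarrow> of_real t \<in> S"
    and u: "Re u > \<sigma>" "u \<noteq> 0"
    and bound: "\<And>k t. k \<le> N \<Longrightarrow> t \<ge> 0 \<Longrightarrow> norm ((deriv ^^ k) g (of_real t)) \<le> M k * exp (\<sigma> * t)"
    and int: "((\<lambda>t. exp (- u * of_real t) * g (of_real t)) has_integral I) {0..}"
  shows "norm (I - (\<Sum>k<N. (deriv ^^ k) g 0 / u ^ Suc k)) \<le> M N / (Re u - \<sigma>) / norm u ^ N"
proof -
  \<comment> \<open>\<open>H\<close> collects the boundary terms of all \<open>N\<close>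
    integrations by parts. Its derivative telescopes to the integrand \<open>h\<close> minus the
    integrand \<open>q\<close> of the remaining integral, and \<open>- H 0\<close> is the sum in the
    claim.\<close>
  define H where "H = (\<lambda>z. - exp (- u * z) * (\<Sum>k<N. (deriv ^^ k) g z / u ^ Suc k))"
  define q where "q = (\<lambda>t. exp (- u * of_real t) * ((deriv ^^ N) g (of_real t) / u ^ N))"
  define h where "h = (\<lambda>t. exp (- u * of_real t) * g (of_real t))"
  define \<delta> where "\<delta> = Re u - \<sigma>"
  have \<delta>: "\<delta> > 0" using u(1) by (simp add: \<delta>_def)
  have "0 \<le> M N"
    using bound[of N 0] order_trans[OF norm_ge_zero] by fastforce
  have dH: "(H has_field_derivative exp (- u * z) * g z - exp (- u * z) * ((deriv ^^ N) g z / u ^ N)) (at z)"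
    if z: "z \<in> S" for z
  proof -
    have der: "((deriv ^^ k) g has_field_derivative (deriv ^^ Suc k) g z) (at z)" for k
      using holomorphic_derivI[OF holomorphic_higher_deriv[OF hol S(1)] S(1) z] by simp
    have "((\<lambda>z. \<Sum>k<N. (deriv ^^ k) g z / u ^ Suc k) has_field_derivative
        (\<Sum>k<N. (deriv ^^ Suc k) g z / u ^ Suc k)) (at z)"
      by (intro DERIV_sum DERIV_cdivide der)
    moreover have "((\<lambda>z. - exp (- u * z)) has_field_derivative u * exp (- u * z)) (at z)"
      by (auto intro!: derivative_eq_intros)
    ultimately have "(H has_field_derivative
        u * exp (- u * z) * (\<Sum>k<N. (deriv ^^ k) g z / u ^ Suc k)
        + (\<Sum>k<N. (deriv ^^ Suc k) g z / u ^ Suc k) * - exp (- u * z)) (at z)"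
      unfolding H_def by (rule DERIV_mult[rotated])
    also have "u * exp (- u * z) * (\<Sum>k<N. (deriv ^^ k) g z / u ^ Suc k)
        + (\<Sum>k<N. (deriv ^^ Suc k) g z / u ^ Suc k) * - exp (- u * z)
        = exp (- u * z) * (\<Sum>k<N. (deriv ^^ k) g z / u ^ k - (deriv ^^ Suc k) g z / u ^ Suc k)"
    proof -
      have "u * (\<Sum>k<N. (deriv ^^ k) g z / u ^ Suc k) = (\<Sum>k<N. (deriv ^^ k) g z / u ^ k)"
        using u(2) by (simp add: sum_distrib_left)
      then show ?thesis
        by (simp only: sum_subtractf right_diff_distrib mult.assoc mult.left_commute[of u] mult.commute[of _ "- exp _"]
            mult_minus_left add_uminus_conv_diff)
    qed
    also have "(\<Sum>k<N. (deriv ^^ k) g z / u ^ k - (deriv ^^ Suc k) g z / u ^ Suc k) =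
        g z - (deriv ^^ N) g z / u ^ N"
      using sum_lessThan_telescope'[of "\<lambda>k. (deriv ^^ k) g z / u ^ k" N] by simp
    finally show ?thesis by (simp add: right_diff_distrib)
  qed
  \<comment> \<open>The estimate is made on \<open>{0..b}\<close> with a bound free of
    \<open>b\<close>; letting \<open>b\<close> tend to infinity removes \<open>H b\<close>.\<close>
  have remainder: "norm (integral {0..b} h - (H (of_real b) - H 0)) \<le> M N / \<delta> / norm u ^ N"
    if b: "b \<ge> 0" for b
  proof -
    have diff: "((\<lambda>t. h t - q t) has_integral (H (of_real b) - H (of_real 0))) {0..b}"
      unfolding h_def q_def
      by (intro fundamental_theorem_of_calculus[OF b] has_vector_derivative_real_field dH S(2)) auto
    have "(h has_integral integral {0..b} h) {0..b}"
    proof (intro integrable_integral integrable_continuous_real)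
      have "continuous_on {0..b} (\<lambda>t. g (of_real t))"
        by (rule continuous_on_compose2[OF holomorphic_on_imp_continuous_on[OF hol]])
          (auto intro!: continuous_intros S(2))
      then show "continuous_on {0..b} h"
        unfolding h_def by (intro continuous_intros)
    qed
    from has_integral_diff[OF this diff]
    have q: "(q has_integral (integral {0..b} h - (H (of_real b) - H 0))) {0..b}"
      by simp
    have FTC: "((\<lambda>t. M N / norm u ^ N * exp (- \<delta> * t)) has_integral
        (- (M N / norm u ^ N / \<delta>) * exp (- \<delta> * b) - - (M N / norm u ^ N / \<delta>) * exp (- \<delta> * 0))) {0..b}"
    proof (rule fundamental_theorem_of_calculus[OF b])
      fix t assume "t \<in> {0..b}"
      have "((\<lambda>t. - (M N / norm u ^ N / \<delta>) * exp (- \<delta> * t)) has_real_derivative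
          - (M N / norm u ^ N / \<delta>) * (exp (- \<delta> * t) * - \<delta>)) (at t within {0..b})"
        by (intro DERIV_cmult DERIV_chain2[OF DERIV_exp] DERIV_cmult_Id)
      then show "((\<lambda>t. - (M N / norm u ^ N / \<delta>) * exp (- \<delta> * t)) has_vector_derivative
          M N / norm u ^ N * exp (- \<delta> * t)) (at t within {0..b})"
        using \<delta> by (simp add: mult_ac flip: has_real_derivative_iff_has_vector_derivative)
    qed
    have "norm (integral {0..b} q) \<le> integral {0..b} (\<lambda>t. M N / norm u ^ N * exp (- \<delta> * t))"
    proof (rule integral_norm_bound_integral)
      fix t assume t: "t \<in> {0..b}"
      have "norm (q t) = exp (- Re u * t) * (norm ((deriv ^^ N) g (of_real t)) / norm u ^ N)"
        by (simp add: q_def norm_mult norm_divide norm_power)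
      also have "\<dots> \<le> exp (- Re u * t) * (M N * exp (\<sigma> * t) / norm u ^ N)"
        using t bound[of N t] by (intro mult_left_mono divide_right_mono) auto
      also have "\<dots> = M N / norm u ^ N * exp (- \<delta> * t)"
        by (simp add: \<delta>_def exp_diff exp_minus field_simps flip: exp_add)
      finally show "norm (q t) \<le> M N / norm u ^ N * exp (- \<delta> * t)" .
    qed (use q FTC in blast)+
    also have "\<dots> = M N / norm u ^ N / \<delta> * (1 - exp (- \<delta> * b))"
      unfolding integral_unique[OF FTC] by (simp add: right_diff_distrib)
    also have "\<dots> \<le> M N / norm u ^ N / \<delta> * 1"
      using \<open>0 \<le> M N\<close> \<delta> by (intro mult_left_mono) auto
    finally show ?thesis
      by (simp add: integral_unique[OF q] field_simps)
  qed
  have "((\<lambda>b. H (of_real b)) \<longlongrightarrow> 0) at_top"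
  proof (rule Lim_null_comparison)
    show "\<forall>\<^sub>F b in at_top. norm (H (of_real b)) \<le> exp (- \<delta> * b) * (\<Sum>k<N. M k / norm u ^ Suc k)"
      using eventually_ge_at_top[of 0]
    proof eventually_elim
      case (elim b)
      have "norm (H (of_real b)) = exp (- Re u * b) * norm (\<Sum>k<N. (deriv ^^ k) g (of_real b) / u ^ Suc k)"
        by (simp add: H_def norm_mult)
      also have "\<dots> \<le> exp (- Re u * b) * (\<Sum>k<N. M k * exp (\<sigma> * b) / norm u ^ Suc k)"
        by (intro mult_left_mono sum_norm_le)
          (use bound elim in \<open>auto simp: norm_divide norm_mult norm_power intro!: divide_right_mono\<close>)
      also have "\<dots> = exp (- Re u * b + \<sigma> * b) * (\<Sum>k<N. M k / norm u ^ Suc k)"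
        unfolding exp_add sum_distrib_left by (simp add: mult_ac)
      also have "- Re u * b + \<sigma> * b = - \<delta> * b"
        by (simp add: \<delta>_def algebra_simps)
      finally show ?case .
    qed
    have "((\<lambda>b. exp (- \<delta> * b)) \<longlongrightarrow> 0) at_top"
      using \<delta> by (intro filterlim_compose[OF exp_at_bot] filterlim_tendsto_neg_mult_at_bot[OF tendsto_const] filterlim_ident) auto
    then show "((\<lambda>b. exp (- \<delta> * b) * (\<Sum>k<N. M k / norm u ^ Suc k)) \<longlongrightarrow> 0) at_top"
      by (rule tendsto_mult_left_zero)
  qed
  then have "((\<lambda>b. norm (integral {0..b} h - (H (of_real b) - H 0))) \<longlongrightarrow> norm (I - (0 - H 0))) at_top"
    using int by (intro tendsto_norm tendsto_diff tendsto_const integral_tendsto_at_top) (simp add: h_def)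
  moreover have "\<forall>\<^sub>F b in at_top. norm (integral {0..b} h - (H (of_real b) - H 0)) \<le> M N / \<delta> / norm u ^ N"
    using eventually_ge_at_top[of 0] by eventually_elim (rule remainder)
  ultimately have "norm (I - (0 - H 0)) \<le> M N / \<delta> / norm u ^ N"
    by (rule tendsto_upperbound) simp
  moreover have "I - (0 - H 0) = I - (\<Sum>k<N. (deriv ^^ k) g 0 / u ^ Suc k)"
    by (simp add: H_def)
  ultimately show ?thesis by (simp add: \<delta>_def)
qed

section \<open>Geometry of the half-strip with rounded end\<close>

lemma open_U_region: "open (U_region r)"
proof -
  have "{t. Re t > 0 \<and> \<bar>Im t\<bar> < r} = {t. Re t > 0} \<inter> {t. \<bar>Im t\<bar> < r}" by auto
  moreover have "open {t::complex. Re t > 0}" "open {t::complex. \<bar>Im t\<bar> < r}"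
    by (intro open_Collect_less continuous_intros)+
  ultimately show ?thesis
    unfolding U_region_def by (simp add: open_Int open_Un)
qed

lemma connected_U_region:
  assumes "0 < r"
  shows "connected (U_region r)"
  unfolding U_region_def
proof (rule connected_Un)
  have "{t. Re t > 0 \<and> \<bar>Im t\<bar> < r} = {t. Re t > 0} \<inter> ({t. Im t < r} \<inter> {t. Im t > - r})" by auto
  then show "connected {t. Re t > 0 \<and> \<bar>Im t\<bar> < r}"
    by (simp add: convex_connected convex_Int convex_halfspace_Re_gt convex_halfspace_Im_lt
        convex_halfspace_Im_gt)
  have "of_real (r/2) \<in> {t. Re t > 0 \<and> \<bar>Im t\<bar> < r} \<inter> ball 0 r"
    using assms by simp
  then show "{t. Re t > 0 \<and> \<bar>Im t\<bar> < r} \<inter> ball 0 r \<noteq> {}"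
    by blast
qed simp

lemma U_region_mono: "r \<le> r' \<Longrightarrow> U_region r \<subseteq> U_region r'"
  by (auto simp: U_region_def)

text \<open>The growth hypothesis is available only on the half-strips with \<open>r < d\<close>;
  these exhaust the large one. The witness is the midpoint between \<open>d\<close> and half of
  \<open>\<bar>Im t\<bar>\<close> or of \<open>norm t\<close>.\<close>

lemma U_region_shrink:
  assumes "t \<in> U_region (2 * d)" "0 < d"
  obtains r where "0 < r" "r < d" "t \<in> U_region (2 * r)"
proof (cases "Re t > 0 \<and> \<bar>Im t\<bar> < 2 * d")
  case True
  then have "t \<in> U_region (2 * ((\<bar>Im t\<bar> / 2 + d) / 2))"
    by (simp add: U_region_def field_simps)
  then show thesis
    by (rule that[rotated 2]) (use True assms(2) in auto)
next
  case False
  then have "norm t < 2 * d" using assms(1) by (auto simp: U_region_def)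
  moreover from this have "t \<in> U_region (2 * ((norm t / 2 + d) / 2))"
    by (simp add: U_region_def)
  ultimately show thesis
    using assms(2) by (intro that[of "(norm t / 2 + d) / 2"]) (auto intro: add_nonneg_pos)
qed

text \<open>A point of the disc that moves to the right first approaches the imaginary axis, so its
  modulus does not grow; once across the axis it is in the strip. Both the characteristics and the
  Cauchy discs stay in the domain of \<open>F\<close> for this reason.\<close>

lemma U_region_add:
  assumes "norm T < r" "0 \<le> \<tau>"
  shows "T + of_real \<tau> \<in> U_region r"
proof (cases "Re T + \<tau> > 0")
  case True
  then show ?thesis
    using assms abs_Im_le_cmod[of T] by (simp add: U_region_def)
next
  case False
  then have "(Re T + \<tau>)\<^sup>2 \<le> (Re T)\<^sup>2"
    using assms(2) by (intro abs_le_square_iff[THEN iffD1]) auto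
  then have "norm (T + of_real \<tau>) \<le> norm T"
    by (simp add: cmod_def)
  then show ?thesis using assms(1) by (simp add: U_region_def)
qed

section \<open>A decay majorant on the half-line\<close>

lemma has_integral_powr_shift:
  assumes "0 < \<rho>"
  shows "((\<lambda>x::real. (1 + x) powr (- (1 + \<rho>))) has_integral 1 / \<rho>) {0..}"
proof (rule has_integral_to_inf)
  have FTC: "((\<lambda>x. (1 + x) powr (- (1 + \<rho>))) has_integral
      (- ((1 + y) powr (- \<rho>)) / \<rho> - - ((1 + 0) powr (- \<rho>)) / \<rho>)) {0..y}" if "0 \<le> y" for y :: real
    using that assms
    by (intro fundamental_theorem_of_calculus)
      (auto intro!: derivative_eq_intros simp flip: has_real_derivative_iff_has_vector_derivative
        simp: field_simps minus_diff_commute)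
  show "(\<lambda>x::real. (1 + x) powr (- (1 + \<rho>))) integrable_on {0..y}" for y
    using FTC[of y] by (cases "0 \<le> y") (auto simp: has_integral_iff)
  have ev: "\<forall>\<^sub>F y in at_top. 1 / \<rho> - (1 + y) powr (- \<rho>) / \<rho> =
      integral {0..y} (\<lambda>x. (1 + x) powr (- (1 + \<rho>)))"
    using eventually_ge_at_top[of 0]
  proof eventually_elim
    case (elim y)
    show ?case using integral_unique[OF FTC[OF elim]] by simp
  qed
  have "((\<lambda>y::real. (1 + y) powr (- \<rho>)) \<longlongrightarrow> 0) at_top"
    using assms by (intro tendsto_neg_powr filterlim_tendsto_add_at_top[OF tendsto_const] filterlim_ident) auto
  then have "((\<lambda>y::real. 1 / \<rho> - (1 + y) powr (- \<rho>) / \<rho>) \<longlongrightarrow> 1 / \<rho> - 0 / \<rho>) at_top"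
    using assms by (intro tendsto_intros) auto
  from Lim_transform_eventually[OF this ev]
  show "((\<lambda>y. integral {0..y} (\<lambda>x. (1 + x) powr (- (1 + \<rho>)))) \<longlongrightarrow> 1 / \<rho>) at_top"
    by simp
qed simp

text \<open>Converts decay in the modulus \<open>y\<close> of a point into decay in the ray
  parameter \<open>x\<close>. The number \<open>m\<close> bounds how far the two can differ, and
  \<open>1 + x \<le> (1 + m) (1 + y)\<close>.\<close>

lemma inverse_one_plus_powr_le:
  fixes m x a :: real
  assumes m: "0 \<le> m" and x: "0 \<le> x" and a: "0 < a" and y: "x - m \<le> y" "0 \<le> y"
  shows "1 / (1 + y powr a) \<le> (2 * (1 + m)) powr a * (1 + x) powr (- a)"
proof -
  have "1 + x \<le> (1 + m) * (1 + y)"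
    using y(1) mult_nonneg_nonneg[OF m y(2)] unfolding distrib_left distrib_right by linarith
  also have "\<dots> \<le> (1 + m) * (2 * max 1 y)"
    using m by (intro mult_left_mono) auto
  also have "\<dots> = 2 * (1 + m) * max 1 y"
    by simp
  finally have "(1 + x) powr a \<le> (2 * (1 + m) * max 1 y) powr a"
    using x a by (intro powr_mono2) auto
  also have "\<dots> = (2 * (1 + m)) powr a * max 1 y powr a"
    by (rule powr_mult)
  also have "max 1 y powr a \<le> 1 + y powr a"
    by (simp add: max_def)
  finally have "(1 + x) powr a \<le> (2 * (1 + m)) powr a * (1 + y powr a)"
    by (simp add: mult_left_mono)
  moreover have "0 < (1 + x) powr a" "0 < 1 + y powr a"
    using x by (auto intro: add_pos_nonneg)
  ultimately show ?thesis
    by (simp add: powr_minus field_simps)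
qed

subsection \<open>The equation satisfied by the Borel transform\<close>

text \<open>All estimates of \<open>F\<close> are made from its regularity, its expansion at 0 and
  its growth; \<open>\<eta>\<close> enters as the value of the Laplace integral in the final
  estimate.\<close>

locale borel_setting =
  fixes p :: "'a::t2_space \<Rightarrow> complex"
    and G \<Delta> \<Gamma> :: "'a set" and \<phi> \<psi> :: "'a \<Rightarrow> complex" and F :: "complex \<Rightarrow> 'a \<Rightarrow> complex"
    and s \<rho> d :: real
  assumes s: "s = 1 \<or> s = -1"
    and spread: "spread_over_plane p G"
    and holo: "surface_holomorphic_on p \<phi> G" "surface_holomorphic_on p \<psi> G"
    and Delta: "is_domain \<Delta>" "\<Delta> \<subseteq> G"
    and cond: "condC1 p \<Delta> \<phi> \<psi> \<rho> \<or> condC2 p \<Delta> \<phi> \<psi> \<rho>"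
    and d: "d > 0" and adm: "admissible_subdomain p \<Delta> s d \<Gamma>"
    and F_joint: "jointly_holomorphic_on p F (U_region (2 * d)) \<Gamma>"
    and F_sums: "\<And>t \<xi>. t \<in> ball 0 (2 * d) \<Longrightarrow> \<xi> \<in> \<Gamma> \<Longrightarrow>
        (\<lambda>n. A_coeff p s \<Gamma> \<phi> \<psi> (Suc n) \<xi> / fact n * t ^ n) sums F t \<xi>"
    and F_growth: "\<And>\<sigma> r. \<sigma> > 0 \<Longrightarrow> 0 < r \<Longrightarrow> r < d \<Longrightarrow> \<exists>K>0. \<forall>t\<in>U_region (2 * r). \<forall>\<xi>\<in>\<Gamma>.
        cmod (F t \<xi>) \<le> K * exp (\<sigma> * Re t) / weight p s \<rho> \<xi>"
begin

abbreviation A :: "nat \<Rightarrow> 'a \<Rightarrow> complex" where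
  "A \<equiv> A_coeff p s \<Gamma> \<phi> \<psi>"

abbreviation ray :: "'a \<Rightarrow> real \<Rightarrow> 'a" where
  "ray \<equiv> the_ray p s \<Gamma>"

text \<open>Inserting the form of \<open>W\<close> into the differential equation leaves a
  second-order equation for \<open>1 + \<eta>\<close> with zeroth-order coefficient
  \<open>\<phi>^2/4 + s \<phi>'/2 - \<psi>\<close>. Integrating it once, and the term
  \<open>s \<phi> \<eta>'\<close> by parts, replaces \<open>s \<phi>'/2\<close> by
  \<open>- s \<phi>'/2\<close>.\<close>

definition f :: "'a \<Rightarrow> complex" where
  "f t = 1/4 * (\<phi> t)\<^sup>2 - of_real s * (1/2) * coord_deriv p \<phi> t - \<psi> t"

lemma s_square: "s * s = 1" and abs_s: "\<bar>s\<bar> = 1"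
  using s by auto

lemma rho_pos: "0 < \<rho>"
  using cond by (auto simp: condC1_def condC2_def)

lemma Gamma: "open \<Gamma>" "\<Gamma> \<subseteq> \<Delta>" "\<Gamma> \<subseteq> G"
  using adm Delta by (auto simp: admissible_subdomain_def is_domain_def)

lemma weight_ge_1: "1 \<le> weight p s \<rho> \<xi>"
  by (simp add: weight_def)

lemma weight_pos: "0 < weight p s \<rho> \<xi>"
  using weight_ge_1[of \<xi>] by simp

lemma ray: 
  assumes "\<xi> \<in> \<Gamma>"
  shows "horizontal_ray p s \<Gamma> \<xi> (ray \<xi>)"
proof -
  have "\<exists>\<gamma>. horizontal_ray p s \<Gamma> \<xi> \<gamma>"
    using adm assms by (simp add: admissible_subdomain_def)
  then show ?thesis
    unfolding the_ray_def by (rule someI_ex)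
qed

lemma rayD:
  assumes "\<xi> \<in> \<Gamma>"
  shows "continuous_on {0..} (ray \<xi>)" "ray \<xi> 0 = \<xi>" "x \<ge> 0 \<Longrightarrow> ray \<xi> x \<in> \<Gamma>"
    "x \<ge> 0 \<Longrightarrow> p (ray \<xi> x) = p \<xi> - of_real (s * x)"
  using ray[OF assms] by (auto simp: horizontal_ray_def)

text \<open>\<open>the_ray\<close> is an arbitrary choice at every starting point; uniqueness of
  lifts makes the choices consistent, so the rays obey a semigroup law.\<close>

lemma ray_ray:
  assumes "\<xi> \<in> \<Gamma>" "x \<ge> 0" "y \<ge> 0"
  shows "ray (ray \<xi> y) x = ray \<xi> (y + x)"
  using horizontal_ray_unique[OF spread Gamma(3) ray[OF rayD(3)[OF assms(1,3)]]
      horizontal_ray_shift[OF ray[OF assms(1)] assms(3)] assms(2)] .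

text \<open>As \<open>s = 1\<close> or \<open>s = -1\<close>, the weight is an increasing function
  of \<open>- s * Re (p \<xi>)\<close>, which grows along the ray. Hence a bound at a point further
  out may be divided by the weight at the starting point.\<close>

lemma weight_ray:
  assumes "\<xi> \<in> \<Gamma>" "x \<ge> 0"
  shows "weight p s \<rho> \<xi> \<le> weight p s \<rho> (ray \<xi> x)"
proof -
  define g where "g = (\<lambda>y::real. sgn y * \<bar>y\<bar> powr \<rho>)"
  have g: "g y \<le> g y'" if "y \<le> y'" for y y'
  proof (cases "0 < y'")
    case True
    then show ?thesis
      using that rho_pos
      by (cases "0 < y") (auto simp: g_def sgn_if intro: powr_mono2 order_trans[of _ 0])
  next
    case False
    then have "\<bar>y'\<bar> powr \<rho> \<le> \<bar>y\<bar> powr \<rho>"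
      using that rho_pos by (intro powr_mono2) auto
    then show ?thesis
      using that False rho_pos by (auto simp: g_def sgn_if)
  qed
  have w: "weight p s \<rho> \<zeta> = max 1 (g (- s * Re (p \<zeta>)))" for \<zeta>
    using s by (auto simp: weight_def g_def sgn_if)
  have "- s * Re (p (ray \<xi> x)) = - s * Re (p \<xi>) + x"
    using rayD(4)[OF assms] s by auto
  then have "g (- s * Re (p \<xi>)) \<le> g (- s * Re (p (ray \<xi> x)))"
    using assms(2) by (intro g) simp
  then show ?thesis
    unfolding w by simp
qed

lemma continuous_on_ray:
  assumes "\<xi> \<in> \<Gamma>" "continuous_on \<Gamma> g"
  shows "continuous_on {0..} (\<lambda>x. g (ray \<xi> x))"
  by (rule continuous_on_compose2[OF assms(2) rayD(1)[OF assms(1)]]) (use rayD(3)[OF assms(1)] in auto)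

lemma holo_Gamma: "surface_holomorphic_on p \<phi> \<Gamma>" "surface_holomorphic_on p \<psi> \<Gamma>"
  using holo Gamma(3) by (auto simp: surface_holomorphic_on_def)

lemma continuous_on_coefficients:
  "continuous_on \<Gamma> \<phi>" "continuous_on \<Gamma> (coord_deriv p \<phi>)" "continuous_on \<Gamma> \<psi>" "continuous_on \<Gamma> f"
proof -
  show *: "continuous_on \<Gamma> \<phi>" "continuous_on \<Gamma> (coord_deriv p \<phi>)" "continuous_on \<Gamma> \<psi>"
    by (intro surface_holomorphic_on_continuous[OF spread Gamma(1,3)] holo_Gamma)+
  show "continuous_on \<Gamma> f"
    unfolding f_def by (intro continuous_intros *)
qed

lemma integrable_on_ray:
  fixes g :: "real \<Rightarrow> 'b::euclidean_space"
  assumes "continuous_on {0..} g" and "\<And>x. x \<ge> 0 \<Longrightarrow> norm (g x) \<le> M * (1 + x) powr (- (1 + \<rho>))"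
  shows "g integrable_on {0..}"
proof (rule measurable_bounded_by_integrable_imp_integrable)
  show "g \<in> borel_measurable (lebesgue_on {0..})"
    by (rule continuous_imp_measurable_on_sets_lebesgue[OF assms(1)]) simp
  show "(\<lambda>x. M * (1 + x) powr (- (1 + \<rho>))) integrable_on {0..}"
    using has_integral_powr_shift[OF rho_pos] by (intro integrable_on_mult_right) blast
qed (use assms(2) in auto)

text \<open>Condition (C1) says nothing about the derivative of \<open>\<phi>\<close>. The disc of
  radius \<open>d\<close> that an admissible subdomain guarantees inside \<open>\<Delta>\<close>
  leaves room for Cauchy's inequality, applied on a circle of radius \<open>d/2\<close>.\<close>

lemma coord_deriv_le:
  assumes "\<xi> \<in> \<Gamma>" and "\<And>\<zeta>. \<zeta> \<in> \<Delta> \<Longrightarrow> dist (p \<zeta>) (p \<xi>) < d \<Longrightarrow> norm (\<phi> \<zeta>) \<le> B"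
  shows "norm (coord_deriv p \<phi> \<xi>) \<le> 2 / d * B"
proof -
  obtain D q where D: "\<xi> \<in> D" "D \<subseteq> \<Delta>" "open D" "homeomorphism D (ball (p \<xi>) d) p q"
    using adm assms(1) unfolding admissible_subdomain_def by meson
  then have ch: "local_chart p \<Delta> (p \<xi>) d q"
    using d by (intro local_chart_homeomorphism)
  have q: "q (p \<xi>) = \<xi>"
    using D by (simp add: homeomorphism_def)
  have c: "p \<xi> \<in> ball (p \<xi>) d" using d by simp
  have "surface_holomorphic_on p \<phi> \<Delta>"
    using holo Delta(2) by (auto simp: surface_holomorphic_on_def)
  then have hol: "(\<lambda>w. \<phi> (q w)) holomorphic_on ball (p \<xi>) d"
    by (rule surface_holomorphic_chart[OF ch])
  have "norm ((deriv ^^ 1) (\<lambda>w. \<phi> (q w)) (p \<xi>)) \<le> fact 1 * B / (d / 2) ^ 1"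
  proof (rule norm_deriv_le[OF hol])
    show "norm (\<phi> (q x)) \<le> B" if "x \<in> ball (p \<xi>) d" for x
      using that local_chartD(5,6)[OF ch that] by (intro assms(2)) (auto simp: dist_commute)
  qed (use d in auto)
  moreover have "coord_deriv p \<phi> (q (p \<xi>)) = deriv (\<lambda>w. \<phi> (q w)) (p \<xi>)"
    by (intro coord_deriv_chart[OF ch c] holomorphic_derivI[OF hol] open_ball c)
  ultimately show ?thesis
    by (simp add: q field_simps)
qed

text \<open>Both conditions lead to one integrable majorant for \<open>\<phi>^2\<close>,
  \<open>\<phi>'\<close> and \<open>\<psi>\<close> along the ray; \<open>\<phi>\<close> itself is
  left out, since (C2) does not make it integrable in general.\<close>

lemma coefficients_bound:
  assumes \<xi>: "\<xi> \<in> \<Gamma>"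
  obtains M where "M \<ge> 0" and "\<And>x. x \<ge> 0 \<Longrightarrow> (norm (\<phi> (ray \<xi> x)))\<^sup>2 \<le> M * (1 + x) powr (- (1 + \<rho>))"
    and "\<And>x. x \<ge> 0 \<Longrightarrow> norm (coord_deriv p \<phi> (ray \<xi> x)) \<le> M * (1 + x) powr (- (1 + \<rho>))"
    and "\<And>x. x \<ge> 0 \<Longrightarrow> norm (\<psi> (ray \<xi> x)) \<le> M * (1 + x) powr (- (1 + \<rho>))"
proof -
  \<comment> \<open>Besides the starting point, \<open>m\<close> absorbs the radius
    \<open>d\<close>, so that \<open>far\<close> also covers the points of the disc used for
    Cauchy's inequality.\<close>
  define m where "m = norm (p \<xi>) + d"
  define E where "E = (\<lambda>a. (2 * (1 + m)) powr a)"
  have far: "c / (1 + norm (p \<zeta>) powr a) \<le> (c * E a) * (1 + x) powr (- a)"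
    if "x \<ge> 0" "dist (p \<zeta>) (p (ray \<xi> x)) \<le> d" "0 < a" "0 < c" for x a c \<zeta>
  proof -
    have "x = norm (of_real (s * x) :: complex)"
      using that(1) abs_s by (simp add: norm_mult)
    also have "of_real (s * x) = (p \<xi> - p \<zeta>) + (p \<zeta> - p (ray \<xi> x))"
      using rayD(4)[OF \<xi> that(1)] by simp
    also have "norm \<dots> \<le> norm (p \<xi>) + norm (p \<zeta>) + d"
      using that(2) norm_triangle_ineq[of "p \<xi> - p \<zeta>" "p \<zeta> - p (ray \<xi> x)"]
        norm_triangle_ineq4[of "p \<xi>" "p \<zeta>"] by (simp add: dist_norm)
    finally have "x - m \<le> norm (p \<zeta>)" by (simp add: m_def)
    then have "1 / (1 + norm (p \<zeta>) powr a) \<le> E a * (1 + x) powr (- a)"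
      unfolding E_def using that d by (intro inverse_one_plus_powr_le) (auto simp: m_def)
    then show ?thesis
      using that(4) mult_left_mono[of _ _ c] by fastforce
  qed
  \<comment> \<open>Used with \<open>a = 1 + \<rho>\<close> under (C1) and
    \<open>a = 1/2 + \<rho>\<close> under (C2); squaring doubles the exponent, which then is at
    least \<open>1 + \<rho>\<close>.\<close>
  have square: "y\<^sup>2 \<le> B\<^sup>2 * (1 + x) powr (- (1 + \<rho>))"
    if "0 \<le> y" "y \<le> B * (1 + x) powr (- a)" "1 + \<rho> \<le> 2 * a" "x \<ge> 0" for y B a x :: real
  proof -
    have "y\<^sup>2 \<le> (B * (1 + x) powr (- a))\<^sup>2"
      using that by (intro power_mono)
    also have "\<dots> = B\<^sup>2 * (1 + x) powr (- (2 * a))"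
      by (simp add: power_mult_distrib power2_eq_square flip: powr_add)
    also have "\<dots> \<le> B\<^sup>2 * (1 + x) powr (- (1 + \<rho>))"
      using that by (intro mult_left_mono powr_mono) auto
    finally show ?thesis .
  qed
  have "\<exists>M1 M2 M3. \<forall>x\<ge>0. (norm (\<phi> (ray \<xi> x)))\<^sup>2 \<le> M1 * (1 + x) powr (- (1 + \<rho>)) \<and>
      norm (coord_deriv p \<phi> (ray \<xi> x)) \<le> M2 * (1 + x) powr (- (1 + \<rho>)) \<and>
      norm (\<psi> (ray \<xi> x)) \<le> M3 * (1 + x) powr (- (1 + \<rho>))"
    using cond
  proof
    assume "condC1 p \<Delta> \<phi> \<psi> \<rho>"
    then obtain c where c: "c > 0"
      "\<And>\<zeta>. \<zeta> \<in> \<Delta> \<Longrightarrow> norm (\<phi> \<zeta>) \<le> c / (1 + norm (p \<zeta>) powr (1 + \<rho>))"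
      "\<And>\<zeta>. \<zeta> \<in> \<Delta> \<Longrightarrow> norm (\<psi> \<zeta>) \<le> c / (1 + norm (p \<zeta>) powr (1 + \<rho>))"
      unfolding condC1_def by blast
    define B where "B = c * E (1 + \<rho>)"
    show ?thesis
    proof (intro exI allI impI conjI)
      fix x :: real assume x: "x \<ge> 0"
      have in\<Delta>: "ray \<xi> x \<in> \<Delta>" "ray \<xi> x \<in> \<Gamma>" using rayD(3)[OF \<xi> x] Gamma(2) by auto
      have near: "norm (\<phi> \<zeta>) \<le> B * (1 + x) powr (- (1 + \<rho>))"
        if "\<zeta> \<in> \<Delta>" "dist (p \<zeta>) (p (ray \<xi> x)) \<le> d" for \<zeta>
        unfolding B_def using that rho_pos c(1) x by (intro order_trans[OF c(2)] far) auto
      show "(norm (\<phi> (ray \<xi> x)))\<^sup>2 \<le> B\<^sup>2 * (1 + x) powr (- (1 + \<rho>))"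
        using near[OF in\<Delta>(1)] d x rho_pos by (intro square[of _ _ _ "1 + \<rho>"]) auto
      have "norm (coord_deriv p \<phi> (ray \<xi> x)) \<le> 2 / d * (B * (1 + x) powr (- (1 + \<rho>)))"
        using in\<Delta>(2) near by (intro coord_deriv_le) auto
      then show "norm (coord_deriv p \<phi> (ray \<xi> x)) \<le> (2 / d * B) * (1 + x) powr (- (1 + \<rho>))"
        by simp
      show "norm (\<psi> (ray \<xi> x)) \<le> B * (1 + x) powr (- (1 + \<rho>))"
        unfolding B_def using in\<Delta> rho_pos c(1) x d by (intro order_trans[OF c(3)] far) auto
    qed
  next
    assume "condC2 p \<Delta> \<phi> \<psi> \<rho>"
    then obtain c where c: "c > 0"
      "\<And>\<zeta>. \<zeta> \<in> \<Delta> \<Longrightarrow> norm (\<phi> \<zeta>) \<le> c / (1 + norm (p \<zeta>) powr (1/2 + \<rho>))"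
      "\<And>\<zeta>. \<zeta> \<in> \<Delta> \<Longrightarrow> norm (coord_deriv p \<phi> \<zeta>) \<le> c / (1 + norm (p \<zeta>) powr (1 + \<rho>))"
      "\<And>\<zeta>. \<zeta> \<in> \<Delta> \<Longrightarrow> norm (\<psi> \<zeta>) \<le> c / (1 + norm (p \<zeta>) powr (1 + \<rho>))"
      unfolding condC2_def by blast
    show ?thesis
    proof (intro exI allI impI conjI)
      fix x :: real assume x: "x \<ge> 0"
      have in\<Delta>: "ray \<xi> x \<in> \<Delta>" using rayD(3)[OF \<xi> x] Gamma(2) by auto
      have "norm (\<phi> (ray \<xi> x)) \<le> (c * E (1/2 + \<rho>)) * (1 + x) powr (- (1/2 + \<rho>))"
        using in\<Delta> rho_pos c(1) x d by (intro order_trans[OF c(2)] far) auto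
      then show "(norm (\<phi> (ray \<xi> x)))\<^sup>2 \<le> (c * E (1/2 + \<rho>))\<^sup>2 * (1 + x) powr (- (1 + \<rho>))"
        using x rho_pos by (intro square[of _ _ _ "1/2 + \<rho>"]) auto
      show "norm (coord_deriv p \<phi> (ray \<xi> x)) \<le> (c * E (1 + \<rho>)) * (1 + x) powr (- (1 + \<rho>))"
        using in\<Delta> rho_pos c(1) x d by (intro order_trans[OF c(3)] far) auto
      show "norm (\<psi> (ray \<xi> x)) \<le> (c * E (1 + \<rho>)) * (1 + x) powr (- (1 + \<rho>))"
        using in\<Delta> rho_pos c(1) x d by (intro order_trans[OF c(4)] far) auto
    qed
  qed
  then obtain M1 M2 M3 where M: "\<And>x. x \<ge> 0 \<Longrightarrow> (norm (\<phi> (ray \<xi> x)))\<^sup>2 \<le> M1 * (1 + x) powr (- (1 + \<rho>))"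
    "\<And>x. x \<ge> 0 \<Longrightarrow> norm (coord_deriv p \<phi> (ray \<xi> x)) \<le> M2 * (1 + x) powr (- (1 + \<rho>))"
    "\<And>x. x \<ge> 0 \<Longrightarrow> norm (\<psi> (ray \<xi> x)) \<le> M3 * (1 + x) powr (- (1 + \<rho>))"
    by blast
  have weaken: "N * (1 + x) powr (- (1 + \<rho>)) \<le> max 0 (max M1 (max M2 M3)) * (1 + x) powr (- (1 + \<rho>))"
    if "N \<in> {M1, M2, M3}" for N x
    using that by (intro mult_right_mono) auto
  show thesis
    by (rule that[of "max 0 (max M1 (max M2 M3))"]; (rule order_trans[OF M(1) weaken] order_trans[OF M(2) weaken] order_trans[OF M(3) weaken])?; simp)
qed

section \<open>Regularity of the Borel transform in both variables\<close>

abbreviation U :: "complex set" where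
  "U \<equiv> U_region (2 * d)"

lemma open_U: "open U" and zero_in_U: "0 \<in> U"
  using open_U_region d by (auto simp: U_region_def)

lemma chart_at:
  assumes "\<xi> \<in> \<Gamma>"
  obtains r q where "local_chart p \<Gamma> (p \<xi>) r q" "q (p \<xi>) = \<xi>" "p \<xi> \<in> ball (p \<xi>) r"
  using ex_local_chart[OF spread Gamma(1,3) assms] local_chartD(1) by (metis centre_in_ball)

lemma F_holomorphic:
  assumes "\<xi> \<in> \<Gamma>"
  shows "(\<lambda>t. F t \<xi>) holomorphic_on U"
proof -
  obtain r q where ch: "local_chart p \<Gamma> (p \<xi>) r q" "q (p \<xi>) = \<xi>" "p \<xi> \<in> ball (p \<xi>) r"
    using chart_at[OF assms] .
  have "(\<lambda>t. F t \<xi>) field_differentiable at t" if "t \<in> U" for t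
    using jointly_holomorphic_chart(2)[OF ch(1) F_joint that ch(3)] ch(2) by simp
  then show ?thesis
    by (simp add: holomorphic_on_def field_differentiable_at_within)
qed

lemma F_higher_deriv_0:
  assumes "\<xi> \<in> \<Gamma>"
  shows "(deriv ^^ n) (\<lambda>t. F t \<xi>) 0 = A (Suc n) \<xi>"
proof -
  have "(deriv ^^ n) (\<lambda>t. F t \<xi>) 0 = fact n * (A (Suc n) \<xi> / fact n)"
    by (rule higher_deriv_powser[OF _ F_sums[OF _ assms]]) (use d in auto)
  then show ?thesis by simp
qed

lemma F_surface_holomorphic:
  assumes "t \<in> U"
  shows "surface_holomorphic_on p (F t) \<Gamma>"
  unfolding surface_holomorphic_on_def
proof
  fix \<xi> assume "\<xi> \<in> \<Gamma>"
  then obtain r q where ch: "local_chart p \<Gamma> (p \<xi>) r q" "q (p \<xi>) = \<xi>" "p \<xi> \<in> ball (p \<xi>) r"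
    by (rule chart_at)
  show "\<exists>f'. has_coord_deriv p (F t) f' \<xi>"
    using jointly_holomorphic_chart(3)[OF ch(1) F_joint assms ch(3)]
      has_coord_deriv_chart[OF ch(1,3), of "F t"] ch(2) unfolding field_differentiable_def by simp
qed

lemma F_continuous: "t \<in> U \<Longrightarrow> continuous_on \<Gamma> (F t)"
  using surface_holomorphic_on_continuous(1)[OF spread Gamma(1,3) F_surface_holomorphic] .

text \<open>The second part says that the expansion of \<open>F\<close> may be differentiated
  termwise in the surface variable. Read in a chart it is \<open>higher_deriv_mixed\<close>, which
  also shows that the coefficient is differentiable, so that \<open>coord_deriv\<close> of it is a
  true derivative.\<close>

lemma F_coord_deriv:
  assumes "\<xi> \<in> \<Gamma>"
  shows "(\<lambda>t. coord_deriv p (F t) \<xi>) holomorphic_on U"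
    and "(deriv ^^ n) (\<lambda>t. coord_deriv p (F t) \<xi>) 0 = coord_deriv p (A (Suc n)) \<xi>"
proof -
  obtain r q where ch: "local_chart p \<Gamma> (p \<xi>) r q" "q (p \<xi>) = \<xi>" "p \<xi> \<in> ball (p \<xi>) r"
    using chart_at[OF assms] .
  define g where "g = (\<lambda>t w. F t (q w))"
  have q: "q w \<in> \<Gamma>" if "w \<in> ball (p \<xi>) r" for w
    using local_chartD(5)[OF ch(1) that] .
  have cont: "continuous_on (U \<times> ball (p \<xi>) r) (\<lambda>(t, w). g t w)"
  proof -
    have "isCont (\<lambda>x. F (fst x) (q (snd x))) (t, w)" if "t \<in> U" "w \<in> ball (p \<xi>) r" for t w
      using jointly_holomorphic_chart(1)[OF ch(1) F_joint that] by (rule has_derivative_continuous)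
    then show ?thesis
      by (auto simp: g_def case_prod_unfold intro!: continuous_at_imp_continuous_on)
  qed
  have hol1: "(\<lambda>t. g t w) holomorphic_on U" if "w \<in> ball (p \<xi>) r" for w
    unfolding g_def using q[OF that] by (rule F_holomorphic)
  have hol2: "g t holomorphic_on ball (p \<xi>) r" if "t \<in> U" for t
    unfolding g_def using surface_holomorphic_chart[OF ch(1) F_surface_holomorphic[OF that]] .
  have cd: "deriv (g t) (p \<xi>) = coord_deriv p (F t) \<xi>" if "t \<in> U" for t
    using coord_deriv_chart[OF ch(1,3) holomorphic_derivI[OF hol2[OF that, unfolded g_def] open_ball ch(3)]]
      ch(2) by (simp add: g_def)
  have mixed: "(\<lambda>t. deriv (g t) (p \<xi>)) holomorphic_on U"
    "((\<lambda>w. (deriv ^^ n) (\<lambda>t. g t w) 0) has_field_derivative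
        (deriv ^^ n) (\<lambda>t. deriv (g t) (p \<xi>)) 0) (at (p \<xi>))"
    by (rule higher_deriv_mixed[OF open_U local_chartD(1)[OF ch(1)] cont]; (rule hol1 hol2 zero_in_U)?; assumption?)+
  show hol: "(\<lambda>t. coord_deriv p (F t) \<xi>) holomorphic_on U"
    by (rule holomorphic_transform[OF mixed(1)]) (rule cd)
  have "((\<lambda>w. A (Suc n) (q w)) has_field_derivative (deriv ^^ n) (\<lambda>t. deriv (g t) (p \<xi>)) 0) (at (p \<xi>))"
  proof (rule DERIV_cong_ev[THEN iffD1, OF refl _ refl mixed(2)])
    have "\<forall>\<^sub>F w in nhds (p \<xi>). w \<in> ball (p \<xi>) r"
      using ch(3) by (intro eventually_nhds_in_open) auto
    then show "\<forall>\<^sub>F w in nhds (p \<xi>). (deriv ^^ n) (\<lambda>t. g t w) 0 = A (Suc n) (q w)"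
      by eventually_elim (simp only: g_def F_higher_deriv_0 q)
  qed
  then have "coord_deriv p (A (Suc n)) (q (p \<xi>)) = (deriv ^^ n) (\<lambda>t. deriv (g t) (p \<xi>)) 0"
    by (rule coord_deriv_chart[OF ch(1,3)])
  also have "\<dots> = (deriv ^^ n) (\<lambda>t. coord_deriv p (F t) \<xi>) 0"
    by (rule higher_deriv_transform_within_open[OF mixed(1) hol open_U zero_in_U]) (rule cd)
  finally show "(deriv ^^ n) (\<lambda>t. coord_deriv p (F t) \<xi>) 0 = coord_deriv p (A (Suc n)) \<xi>"
    using ch(2) by simp
qed

text \<open>The bound is local in \<open>t\<close> but uniform over \<open>\<Gamma>\<close>, as
  needed to dominate the integrand of \<open>J\<close> along an entire ray.\<close>

lemma F_locally_bounded:
  assumes "t \<in> U"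
  obtains r B where "r > 0" "ball t r \<subseteq> U" "B \<ge> 0" "\<And>t' \<xi>. t' \<in> ball t r \<Longrightarrow> \<xi> \<in> \<Gamma> \<Longrightarrow> norm (F t' \<xi>) \<le> B"
proof -
  obtain r where r: "0 < r" "r < d" "t \<in> U_region (2 * r)"
    using U_region_shrink[OF assms d] .
  obtain e where e: "e > 0" "ball t e \<subseteq> U_region (2 * r)"
    using r(3) open_U_region[of "2 * r"] unfolding open_contains_ball by blast
  have "\<exists>K>0. \<forall>t\<in>U_region (2 * r). \<forall>\<xi>\<in>\<Gamma>. norm (F t \<xi>) \<le> K * exp (1 * Re t) / weight p s \<rho> \<xi>"
    by (rule F_growth) (use r in auto)
  then obtain K where K: "K > 0"
    "\<And>t \<xi>. t \<in> U_region (2 * r) \<Longrightarrow> \<xi> \<in> \<Gamma> \<Longrightarrow> norm (F t \<xi>) \<le> K * exp (1 * Re t) / weight p s \<rho> \<xi>"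
    by blast
  have "norm (F t' \<xi>) \<le> K * exp (norm t + e)" if t': "t' \<in> ball t e" and \<xi>: "\<xi> \<in> \<Gamma>" for t' \<xi>
  proof -
    have "norm (F t' \<xi>) \<le> K * exp (Re t') / weight p s \<rho> \<xi>"
      using K(2)[of t' \<xi>] t' \<xi> e(2) by auto
    also have "\<dots> \<le> K * exp (Re t') / 1"
      using K(1) weight_ge_1 by (intro divide_left_mono) (auto simp: weight_pos)
    also have "Re t' \<le> norm t + e"
      using t' complex_Re_le_cmod[of t'] norm_triangle_ineq3[of t' t]
      by (simp add: dist_norm norm_minus_commute)
    finally show ?thesis using K(1) by simp
  qed
  moreover have "ball t e \<subseteq> U"
    using e(2) U_region_mono[of "2 * r" "2 * d"] r by auto
  ultimately show thesis
    using e(1) K(1) by (intro that[of e "K * exp (norm t + e)"]) auto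
qed

lemma f_bound:
  assumes "\<xi> \<in> \<Gamma>"
  obtains M where "\<And>x. x \<ge> 0 \<Longrightarrow> norm (f (ray \<xi> x)) \<le> M * (1 + x) powr (- (1 + \<rho>))"
proof -
  obtain M where M: "\<And>x. x \<ge> 0 \<Longrightarrow> (norm (\<phi> (ray \<xi> x)))\<^sup>2 \<le> M * (1 + x) powr (- (1 + \<rho>))"
    "\<And>x. x \<ge> 0 \<Longrightarrow> norm (coord_deriv p \<phi> (ray \<xi> x)) \<le> M * (1 + x) powr (- (1 + \<rho>))"
    "\<And>x. x \<ge> 0 \<Longrightarrow> norm (\<psi> (ray \<xi> x)) \<le> M * (1 + x) powr (- (1 + \<rho>))"
    using coefficients_bound[OF assms] by metis
  \<comment> \<open>The constant is \<open>1/4 + 1/2 + 1\<close>, one summand for each term of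
    \<open>f\<close>.\<close>
  have "norm (f (ray \<xi> x)) \<le> (7/4 * M) * (1 + x) powr (- (1 + \<rho>))" if "x \<ge> 0" for x
  proof -
    have "norm (f \<zeta>) \<le> 1/4 * (norm (\<phi> \<zeta>))\<^sup>2 + 1/2 * norm (coord_deriv p \<phi> \<zeta>) + norm (\<psi> \<zeta>)" for \<zeta>
      unfolding f_def using norm_triangle_ineq4[of "1/4 * (\<phi> \<zeta>)\<^sup>2 - of_real s * (1/2) * coord_deriv p \<phi> \<zeta>" "\<psi> \<zeta>"]
        norm_triangle_ineq4[of "1/4 * (\<phi> \<zeta>)\<^sup>2" "of_real s * (1/2) * coord_deriv p \<phi> \<zeta>"] abs_s
      by (simp add: norm_mult norm_power norm_divide)
    from this[of "ray \<xi> x"] M[OF that] show ?thesis by linarith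
  qed
  then show thesis by (rule that)
qed

text \<open>The integral is with respect to the ray parameter, without the orientation sign of
  \<open>path_int\<close>; that sign cancels the one in front of the integral in the recursion, by
  \<open>s * s = 1\<close>.\<close>

definition J :: "complex \<Rightarrow> 'a \<Rightarrow> complex" where
  "J t \<xi> = integral {0..} (\<lambda>x. f (ray \<xi> x) * F t (ray \<xi> x))"

lemma J_integrable:
  assumes \<xi>: "\<xi> \<in> \<Gamma>" and t: "t \<in> U"
  shows "(\<lambda>x. f (ray \<xi> x) * F t (ray \<xi> x)) integrable_on {0..}"
proof -
  obtain M where M: "\<And>x. x \<ge> 0 \<Longrightarrow> norm (f (ray \<xi> x)) \<le> M * (1 + x) powr (- (1 + \<rho>))"
    using f_bound[OF \<xi>] by metis
  obtain r B where B: "r > 0" "B \<ge> 0" "\<And>t' \<xi>. t' \<in> ball t r \<Longrightarrow> \<xi> \<in> \<Gamma> \<Longrightarrow> norm (F t' \<xi>) \<le> B"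
    using F_locally_bounded[OF t] by metis
  show ?thesis
  proof (rule integrable_on_ray)
    show "continuous_on {0..} (\<lambda>x. f (ray \<xi> x) * F t (ray \<xi> x))"
      by (intro continuous_on_mult continuous_on_ray[OF \<xi>] continuous_on_coefficients F_continuous t)
    fix x :: real assume x: "x \<ge> 0"
    have "norm (f (ray \<xi> x)) * norm (F t (ray \<xi> x)) \<le> M * (1 + x) powr (- (1 + \<rho>)) * B"
      using M[OF x] B rayD(3)[OF \<xi> x] by (intro mult_mono order_trans[OF norm_ge_zero M[OF x]]) auto
    then show "norm (f (ray \<xi> x) * F t (ray \<xi> x)) \<le> (M * B) * (1 + x) powr (- (1 + \<rho>))"
      by (simp add: norm_mult mult_ac)
  qed
qed

lemma J_locally_dominated:
  assumes \<xi>: "\<xi> \<in> \<Gamma>"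
  shows "locally_dominated U {0..} (\<lambda>t x. f (ray \<xi> x) * F t (ray \<xi> x))"
  unfolding locally_dominated_def
proof
  fix t assume t: "t \<in> U"
  obtain M where M: "\<And>x. x \<ge> 0 \<Longrightarrow> norm (f (ray \<xi> x)) \<le> M * (1 + x) powr (- (1 + \<rho>))"
    using f_bound[OF \<xi>] by metis
  obtain r B where B: "r > 0" "ball t r \<subseteq> U" "B \<ge> 0"
    "\<And>t' \<xi>. t' \<in> ball t r \<Longrightarrow> \<xi> \<in> \<Gamma> \<Longrightarrow> norm (F t' \<xi>) \<le> B"
    using F_locally_bounded[OF t] by metis
  have "norm (f (ray \<xi> x) * F t' (ray \<xi> x)) \<le> M * (1 + x) powr (- (1 + \<rho>)) * B"
    if "t' \<in> ball t r" "x \<in> {0..}" for t' x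
    unfolding norm_mult using M[of x] B that rayD(3)[OF \<xi>, of x]
    by (intro mult_mono order_trans[OF norm_ge_zero M]) auto
  moreover have "(\<lambda>x. M * (1 + x) powr (- (1 + \<rho>)) * B) integrable_on {0..}"
    using has_integral_powr_shift[OF rho_pos]
    by (intro integrable_on_mult_right integrable_on_mult_left) blast
  ultimately show "\<exists>r>0. ball t r \<subseteq> U \<and> (\<exists>h. h integrable_on {0..} \<and>
      (\<forall>t'\<in>ball t r. \<forall>x\<in>{0..}. norm (f (ray \<xi> x) * F t' (ray \<xi> x)) \<le> h x))"
    using B(1,2) by (intro exI[of _ r] conjI exI[of _ "\<lambda>x. M * (1 + x) powr (- (1 + \<rho>)) * B"]) auto
qed

lemma J_holomorphic:
  assumes \<xi>: "\<xi> \<in> \<Gamma>"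
  shows "(\<lambda>t. J t \<xi>) holomorphic_on U"
    and "(deriv ^^ n) (\<lambda>t. J t \<xi>) 0 = integral {0..} (\<lambda>x. f (ray \<xi> x) * A (Suc n) (ray \<xi> x))"
proof -
  have hol: "(\<lambda>t. f (ray \<xi> x) * F t (ray \<xi> x)) holomorphic_on U" if "x \<in> {0..}" for x
    using rayD(3)[OF \<xi>, of x] that by (intro holomorphic_intros F_holomorphic) auto
  show "(\<lambda>t. J t \<xi>) holomorphic_on U"
    unfolding J_def
    by (rule holomorphic_param_integral[OF open_U hol J_integrable[OF \<xi>] J_locally_dominated[OF \<xi>]])
  have "(deriv ^^ n) (\<lambda>t. J t \<xi>) 0 =
      integral {0..} (\<lambda>x. (deriv ^^ n) (\<lambda>t. f (ray \<xi> x) * F t (ray \<xi> x)) 0)"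
    unfolding J_def by (rule higher_deriv_param_integral[OF open_U zero_in_U hol
          J_integrable[OF \<xi>] J_locally_dominated[OF \<xi>]])
  also have "\<dots> = integral {0..} (\<lambda>x. f (ray \<xi> x) * A (Suc n) (ray \<xi> x))"
  proof (rule integral_cong)
    fix x :: real assume "x \<in> {0..}"
    then have "ray \<xi> x \<in> \<Gamma>" using rayD(3)[OF \<xi>] by simp
    then show "(deriv ^^ n) (\<lambda>t. f (ray \<xi> x) * F t (ray \<xi> x)) 0 = f (ray \<xi> x) * A (Suc n) (ray \<xi> x)"
      by (simp only: higher_deriv_cmult[OF F_holomorphic zero_in_U open_U] F_higher_deriv_0)
  qed
  finally show "(deriv ^^ n) (\<lambda>t. J t \<xi>) 0 = integral {0..} (\<lambda>x. f (ray \<xi> x) * A (Suc n) (ray \<xi> x))" .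
qed

lemma A_recursion:
  "A (Suc n) \<xi> + of_real s * (1/2) * coord_deriv p (A n) \<xi> + 1/2 * \<phi> \<xi> * A n \<xi>
    + 1/2 * integral {0..} (\<lambda>x. f (ray \<xi> x) * A n (ray \<xi> x)) = 0"
proof -
  have ss: "of_real s * (of_real s * z) = z" for z :: complex
    using s_square by (simp flip: mult.assoc of_real_mult)
  show ?thesis
    by (simp add: path_int_def f_def ss)
qed

lemma borel_equation:
  assumes \<xi>: "\<xi> \<in> \<Gamma>" and t: "t \<in> U"
  shows "deriv (\<lambda>t. F t \<xi>) t + of_real s * (1/2) * coord_deriv p (F t) \<xi> + 1/2 * \<phi> \<xi> * F t \<xi>
    + 1/2 * J t \<xi> = 0"
proof (rule holomorphic_fun_eq_0_on_connected[where z = 0, OF _ open_U connected_U_region _ zero_in_U t])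
  note hol = F_holomorphic[OF \<xi>] holomorphic_deriv[OF F_holomorphic[OF \<xi>] open_U]
    F_coord_deriv(1)[OF \<xi>] J_holomorphic(1)[OF \<xi>]
  show "(\<lambda>t. deriv (\<lambda>t. F t \<xi>) t + of_real s * (1/2) * coord_deriv p (F t) \<xi> + 1/2 * \<phi> \<xi> * F t \<xi>
    + 1/2 * J t \<xi>) holomorphic_on U"
    by (intro holomorphic_intros hol)
  fix n
  note add = higher_deriv_add[OF _ _ open_U zero_in_U] and cmult = higher_deriv_cmult[OF _ zero_in_U open_U]
  have "(deriv ^^ n) (\<lambda>t. deriv (\<lambda>t. F t \<xi>) t + of_real s * (1/2) * coord_deriv p (F t) \<xi>
      + 1/2 * \<phi> \<xi> * F t \<xi> + 1/2 * J t \<xi>) 0 =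
    (deriv ^^ n) (deriv (\<lambda>t. F t \<xi>)) 0 + of_real s * (1/2) * (deriv ^^ n) (\<lambda>t. coord_deriv p (F t) \<xi>) 0
      + 1/2 * \<phi> \<xi> * (deriv ^^ n) (\<lambda>t. F t \<xi>) 0 + 1/2 * (deriv ^^ n) (\<lambda>t. J t \<xi>) 0"
    by (subst add cmult, (intro holomorphic_intros hol)+)+ simp
  \<comment> \<open>As the expansion of \<open>F\<close> starts with \<open>A 1\<close>, the four
    derivatives are the four terms of \<open>A_recursion\<close> at index
    \<open>Suc n\<close>.\<close>
  also have "(deriv ^^ n) (deriv (\<lambda>t. F t \<xi>)) 0 = (deriv ^^ Suc n) (\<lambda>t. F t \<xi>) 0"
    by (simp only: funpow_Suc_right o_apply)
  finally show "(deriv ^^ n) (\<lambda>t. deriv (\<lambda>t. F t \<xi>) t + of_real s * (1/2) * coord_deriv p (F t) \<xi>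
      + 1/2 * \<phi> \<xi> * F t \<xi> + 1/2 * J t \<xi>) 0 = 0"
    by (simp only: F_higher_deriv_0[OF \<xi>] F_coord_deriv(2)[OF \<xi>] J_holomorphic(2)[OF \<xi>] A_recursion)
qed (use d in simp)

subsection \<open>Growth along characteristics\<close>

text \<open>The density of \<open>V_bound\<close> along the ray, with the factor in
  \<open>\<sigma>\<close> included, so that \<open>V\<close> decreases along rays exactly at this
  rate.\<close>

definition rate :: "real \<Rightarrow> 'a \<Rightarrow> real" where
  "rate \<sigma> \<zeta> = (if \<exists>z\<in>G. \<phi> z \<noteq> 0
     then 6 / \<sigma> * (1/4 * cmod ((\<phi> \<zeta>)\<^sup>2) + cmod (1/2 * coord_deriv p \<phi> \<zeta> + of_real s * \<psi> \<zeta>))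
     else 1 / \<sigma> * cmod (\<psi> \<zeta>))"

definition V :: "real \<Rightarrow> 'a \<Rightarrow> real" where
  "V \<sigma> \<xi> = integral {0..} (\<lambda>x. rate \<sigma> (ray \<xi> x))"

lemma V_bound_eq: "V_bound p s G \<Gamma> \<phi> \<psi> \<sigma> \<xi> = V \<sigma> \<xi>"
  by (cases "\<exists>z\<in>G. \<phi> z \<noteq> 0")
    (simp_all only: V_bound_def V_def rate_def path_abs_int_def if_True if_False integral_mult_right)

lemma rate_nonneg: "0 < \<sigma> \<Longrightarrow> 0 \<le> rate \<sigma> \<zeta>"
  by (auto simp: rate_def)

text \<open>
  The right-hand side \<open>\<sigma> + rate/2\<close> is the logarithmic derivative of \<open>e\<^bsup>\<sigma> \<tau> + V\<^esup>\<close> along the characteristics;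
  the constant \<open>6\<close> in \<open>V_bound\<close> is large enough for \<open>\<kappa> = \<sigma>/6\<close>.
\<close>

lemma rate_estimates:
  assumes \<sigma>: "0 < \<sigma>"
  obtains \<kappa> where "0 < \<kappa>" "\<And>\<zeta>. \<zeta> \<in> \<Gamma> \<Longrightarrow> norm (f \<zeta>) \<le> \<kappa> * rate \<sigma> \<zeta>"
    "\<And>\<zeta>. \<zeta> \<in> \<Gamma> \<Longrightarrow> norm (\<phi> \<zeta>) + \<kappa> \<le> \<sigma> + rate \<sigma> \<zeta> / 2"
proof (cases "\<exists>z\<in>G. \<phi> z \<noteq> 0")
  case True
  define a where "a = (\<lambda>\<zeta>. 1/4 * cmod ((\<phi> \<zeta>)\<^sup>2) + cmod (1/2 * coord_deriv p \<phi> \<zeta> + of_real s * \<psi> \<zeta>))"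
  have rate: "rate \<sigma> \<zeta> = 6 / \<sigma> * a \<zeta>" for \<zeta>
    using True by (simp add: rate_def a_def)
  have "norm (f \<zeta>) \<le> \<sigma> / 6 * rate \<sigma> \<zeta>" for \<zeta>
  proof -
    have "of_real s * (of_real s * z) = z" for z :: complex
      using s_square by (simp flip: mult.assoc of_real_mult)
    then have "f \<zeta> = 1/4 * (\<phi> \<zeta>)\<^sup>2 - of_real s * (1/2 * coord_deriv p \<phi> \<zeta> + of_real s * \<psi> \<zeta>)"
      by (simp add: f_def distrib_left)
    then have "norm (f \<zeta>) \<le> a \<zeta>"
      using norm_triangle_ineq4[of "1/4 * (\<phi> \<zeta>)\<^sup>2" "of_real s * (1/2 * coord_deriv p \<phi> \<zeta> + of_real s * \<psi> \<zeta>)"]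
        abs_s by (simp add: a_def norm_mult norm_divide)
    then show ?thesis using \<sigma> by (simp add: rate)
  qed
  moreover have "norm (\<phi> \<zeta>) + \<sigma> / 6 \<le> \<sigma> + rate \<sigma> \<zeta> / 2" for \<zeta>
  proof -
    define y where "y = norm (\<phi> \<zeta>)"
    \<comment> \<open>Divided by \<open>12 * \<sigma>\<close>, this reads
      \<open>y + \<sigma>/6 \<le> \<sigma> + 3 y^2 / (4 \<sigma>)\<close>, and the last term is the
      share of \<open>\<phi>^2\<close> in \<open>rate / 2\<close>.\<close>
    have "0 \<le> (3 * y - 2 * \<sigma>)\<^sup>2 + 6 * \<sigma>\<^sup>2" by simp
    then have "12 * y * \<sigma> \<le> 10 * \<sigma>\<^sup>2 + 9 * y\<^sup>2"
      by (simp add: power2_eq_square algebra_simps)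
    then have "y + \<sigma> / 6 \<le> \<sigma> + 3 / \<sigma> * (1/4 * y\<^sup>2)"
      using \<sigma> by (simp add: field_simps power2_eq_square)
    also have "\<dots> \<le> \<sigma> + 3 / \<sigma> * a \<zeta>"
      using \<sigma> by (intro add_left_mono mult_left_mono) (simp_all add: a_def y_def norm_power)
    finally show ?thesis by (simp add: y_def rate)
  qed
  ultimately show thesis
    using \<sigma> by (intro that[of "\<sigma> / 6"]) auto
next
  case False
  \<comment> \<open>With \<open>\<phi>\<close> zero on \<open>G\<close> there is no
    \<open>\<phi>\<close> term to pay for, and the whole of \<open>\<sigma>\<close> can serve as
    \<open>\<kappa>\<close>; hence \<open>1 / \<sigma>\<close> in place of
    \<open>6 / \<sigma>\<close>.\<close>
  have rate: "rate \<sigma> \<zeta> = 1 / \<sigma> * norm (\<psi> \<zeta>)" for \<zeta>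
    unfolding rate_def using False by (rule if_not_P)
  have \<phi>: "\<phi> \<zeta> = 0" if "\<zeta> \<in> \<Gamma>" for \<zeta>
    using False that Gamma(3) by blast
  have "norm (f \<zeta>) \<le> \<sigma> * rate \<sigma> \<zeta>" if "\<zeta> \<in> \<Gamma>" for \<zeta>
  proof -
    obtain r q where ch: "local_chart p \<Gamma> (p \<zeta>) r q" "q (p \<zeta>) = \<zeta>" "p \<zeta> \<in> ball (p \<zeta>) r"
      using chart_at[OF \<open>\<zeta> \<in> \<Gamma>\<close>] .
    have "((\<lambda>w. \<phi> (q w)) has_field_derivative 0) (at (p \<zeta>))"
    proof (rule DERIV_cong_ev[THEN iffD1, OF refl _ refl])
      have "\<forall>\<^sub>F w in nhds (p \<zeta>). w \<in> ball (p \<zeta>) r"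
        using ch(3) by (intro eventually_nhds_in_open) auto
      then show "\<forall>\<^sub>F w in nhds (p \<zeta>). 0 = \<phi> (q w)"
        by eventually_elim (use local_chartD(5)[OF ch(1)] \<phi> in simp)
    qed simp
    then have "coord_deriv p \<phi> \<zeta> = 0"
      using coord_deriv_chart[OF ch(1,3)] ch(2) by metis
    then show ?thesis
      using \<sigma> \<phi>[OF that] by (simp add: f_def rate)
  qed
  moreover have "norm (\<phi> \<zeta>) + \<sigma> \<le> \<sigma> + rate \<sigma> \<zeta> / 2" if "\<zeta> \<in> \<Gamma>" for \<zeta>
    using \<phi>[OF that] rate_nonneg[OF \<sigma>, of \<zeta>] by simp
  ultimately show thesis
    using \<sigma> by (intro that[of \<sigma>]) auto
qed

lemma rate_continuous:
  assumes "\<xi> \<in> \<Gamma>" and \<sigma>: "0 < \<sigma>"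
  shows "continuous_on {0..} (\<lambda>x. rate \<sigma> (ray \<xi> x))"
proof -
  have "continuous_on \<Gamma> (rate \<sigma>)"
    unfolding rate_def
    using \<sigma> by (cases "\<exists>z\<in>G. \<phi> z \<noteq> 0") (auto intro!: continuous_intros continuous_on_coefficients)
  with assms(1) show ?thesis by (rule continuous_on_ray)
qed

lemma rate_integrable:
  assumes \<xi>: "\<xi> \<in> \<Gamma>" and \<sigma>: "0 < \<sigma>"
  shows "(\<lambda>x. rate \<sigma> (ray \<xi> x)) integrable_on {0..}"
proof -
  obtain M where M: "M \<ge> 0" "\<And>x. x \<ge> 0 \<Longrightarrow> (norm (\<phi> (ray \<xi> x)))\<^sup>2 \<le> M * (1 + x) powr (- (1 + \<rho>))"
    "\<And>x. x \<ge> 0 \<Longrightarrow> norm (coord_deriv p \<phi> (ray \<xi> x)) \<le> M * (1 + x) powr (- (1 + \<rho>))"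
    "\<And>x. x \<ge> 0 \<Longrightarrow> norm (\<psi> (ray \<xi> x)) \<le> M * (1 + x) powr (- (1 + \<rho>))"
    using coefficients_bound[OF \<xi>] by metis
  show ?thesis
  proof (rule integrable_on_ray[OF rate_continuous[OF \<xi> \<sigma>]])
    fix x :: real assume x: "x \<ge> 0"
    define \<zeta> where "\<zeta> = ray \<xi> x"
    define E where "E = M * (1 + x) powr (- (1 + \<rho>))"
    have E: "(norm (\<phi> \<zeta>))\<^sup>2 \<le> E" "norm (coord_deriv p \<phi> \<zeta>) \<le> E" "norm (\<psi> \<zeta>) \<le> E" "0 \<le> E"
      using M x by (simp_all add: \<zeta>_def E_def)
    have "1/4 * cmod ((\<phi> \<zeta>)\<^sup>2) + cmod (1/2 * coord_deriv p \<phi> \<zeta> + of_real s * \<psi> \<zeta>) \<le> 2 * E"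
      using norm_triangle_ineq[of "1/2 * coord_deriv p \<phi> \<zeta>" "of_real s * \<psi> \<zeta>"] E abs_s
      by (simp add: norm_mult norm_power norm_divide)
    then have "6 / \<sigma> * (1/4 * cmod ((\<phi> \<zeta>)\<^sup>2) + cmod (1/2 * coord_deriv p \<phi> \<zeta> + of_real s * \<psi> \<zeta>))
        \<le> 6 / \<sigma> * (2 * E)"
      using \<sigma> by (intro mult_left_mono) auto
    moreover have "1 / \<sigma> * cmod (\<psi> \<zeta>) \<le> 6 / \<sigma> * (2 * E)"
      using \<sigma> E by (simp add: field_simps)
    ultimately have "rate \<sigma> \<zeta> \<le> 6 / \<sigma> * (2 * E)"
      by (auto simp: rate_def)
    then show "norm (rate \<sigma> (ray \<xi> x)) \<le> (12 / \<sigma> * M) * (1 + x) powr (- (1 + \<rho>))"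
      using rate_nonneg[OF \<sigma>] by (simp add: \<zeta>_def E_def mult_ac)
  qed
qed

lemma V_nonneg:
  assumes "\<xi> \<in> \<Gamma>" "0 < \<sigma>"
  shows "0 \<le> V \<sigma> \<xi>"
  unfolding V_def using rate_integrable[OF assms] rate_nonneg[OF assms(2)] by (intro integral_nonneg) auto

text \<open>By the semigroup law of rays, \<open>V\<close> at a point of the ray is the tail of the
  integral that defines \<open>V \<sigma> \<xi>\<close>. Truncated integrals are compared and the
  truncation is sent to infinity.\<close>

lemma V_ray:
  assumes \<xi>: "\<xi> \<in> \<Gamma>" and \<sigma>: "0 < \<sigma>" and y: "0 \<le> y"
  shows "V \<sigma> (ray \<xi> y) = V \<sigma> \<xi> - integral {0..y} (\<lambda>x. rate \<sigma> (ray \<xi> x))"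
proof -
  define g where "g = (\<lambda>x. rate \<sigma> (ray \<xi> x))"
  have g: "g integrable_on {0..c}" for c
    unfolding g_def by (intro integrable_continuous_real continuous_on_subset[OF rate_continuous[OF \<xi> \<sigma>]]) auto
  have L1: "((\<lambda>c. integral {0..y + c} g - integral {0..y} g) \<longlongrightarrow> V \<sigma> \<xi> - integral {0..y} g) at_top"
  proof (intro tendsto_diff tendsto_const)
    have "((\<lambda>c. integral {0..c} g) \<longlongrightarrow> V \<sigma> \<xi>) at_top"
      unfolding V_def g_def using rate_integrable[OF \<xi> \<sigma>] by (intro integral_tendsto_at_top) blast
    moreover have "filterlim (\<lambda>c. y + c) at_top at_top"
      by (intro filterlim_tendsto_add_at_top[OF tendsto_const] filterlim_ident)
    ultimately show "((\<lambda>c. integral {0..y + c} g) \<longlongrightarrow> V \<sigma> \<xi>) at_top"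
      by (rule filterlim_compose)
  qed
  have L2: "((\<lambda>c. integral {0..c} (\<lambda>x. rate \<sigma> (ray (ray \<xi> y) x))) \<longlongrightarrow> V \<sigma> (ray \<xi> y)) at_top"
    unfolding V_def using rate_integrable[OF rayD(3)[OF \<xi> y] \<sigma>] by (intro integral_tendsto_at_top) blast
  have ev: "\<forall>\<^sub>F c in at_top. integral {0..c} (\<lambda>x. rate \<sigma> (ray (ray \<xi> y) x)) =
      integral {0..y + c} g - integral {0..y} g"
    using eventually_ge_at_top[of 0]
  proof eventually_elim
    case (elim c)
    have "integral {0..c} (\<lambda>x. rate \<sigma> (ray (ray \<xi> y) x)) = integral {0..c} (g \<circ> (+) y)"
      by (intro integral_cong) (simp add: g_def ray_ray[OF \<xi> _ y])
    also have "\<dots> = integral {y..y + c} g"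
      by (simp add: integral_shift_Icc_real add.commute)
    also have "\<dots> = integral {0..y + c} g - integral {0..y} g"
      using Henstock_Kurzweil_Integration.integral_combine[of 0 y "y + c" g] g y elim by simp
    finally show ?case .
  qed
  show ?thesis
    using tendsto_unique[OF _ Lim_transform_eventually[OF L2 ev] L1] by (simp add: g_def)
qed

lemma V_ray_derivative:
  assumes \<xi>: "\<xi> \<in> \<Gamma>" and \<sigma>: "0 < \<sigma>" and y: "y \<in> {0..c}"
  shows "((\<lambda>y. V \<sigma> (ray \<xi> y)) has_real_derivative - rate \<sigma> (ray \<xi> y)) (at y within {0..c})"
proof -
  have "continuous_on {0..c} (\<lambda>x. rate \<sigma> (ray \<xi> x))"
    by (rule continuous_on_subset[OF rate_continuous[OF \<xi> \<sigma>]]) auto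
  from integral_has_real_derivative[OF this y]
  have "((\<lambda>y. V \<sigma> \<xi> - integral {0..y} (\<lambda>x. rate \<sigma> (ray \<xi> x))) has_real_derivative
      0 - rate \<sigma> (ray \<xi> y)) (at y within {0..c})"
    by (intro DERIV_diff DERIV_const)
  then show ?thesis
    unfolding has_field_derivative_def
    by (rule has_derivative_transform[rotated 2, OF has_derivative_eq_rhs]) (use V_ray[OF \<xi> \<sigma>] y in auto)
qed

text \<open>Uniform in \<open>\<tau>\<close> and \<open>\<zeta>\<close> because improving the bound
  at one point uses it along the characteristic and, through \<open>J\<close>, on the rays that
  start there. \<open>T\<close> stays fixed throughout.\<close>

definition growth_bound :: "complex \<Rightarrow> real \<Rightarrow> real \<Rightarrow> bool" where
  "growth_bound T \<sigma> Q \<longleftrightarrow> (\<forall>\<tau>\<ge>0. \<forall>\<zeta>\<in>\<Gamma>.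
     norm (F (T + of_real \<tau>) \<zeta>) \<le> Q * exp (\<sigma> * \<tau> + V \<sigma> \<zeta>) / weight p s \<rho> \<zeta>)"

text \<open>The integral of \<open>rate * exp V\<close> along a ray telescopes to at most
  \<open>exp V\<close> at its starting point. The integral term therefore obeys the same bound as
  \<open>F\<close>, with the factor \<open>\<kappa>\<close>.\<close>

lemma J_bound:
  assumes \<sigma>: "0 < \<sigma>" and T: "norm T < 2 * d" and Q: "0 \<le> Q" and gb: "growth_bound T \<sigma> Q"
    and \<kappa>: "0 < \<kappa>" "\<And>\<zeta>. \<zeta> \<in> \<Gamma> \<Longrightarrow> norm (f \<zeta>) \<le> \<kappa> * rate \<sigma> \<zeta>" and \<zeta>: "\<zeta> \<in> \<Gamma>" and \<tau>: "0 \<le> \<tau>"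
  shows "norm (J (T + of_real \<tau>) \<zeta>) \<le> \<kappa> * (Q * exp (\<sigma> * \<tau> + V \<sigma> \<zeta>) / weight p s \<rho> \<zeta>)"
  unfolding J_def
proof (rule norm_integral_atLeast_le)
  have U: "T + of_real \<tau> \<in> U"
    using U_region_add[OF T \<tau>] .
  show int: "(\<lambda>x. f (ray \<zeta> x) * F (T + of_real \<tau>) (ray \<zeta> x)) integrable_on {0..}"
    by (rule J_integrable[OF \<zeta> U])
  define N where "N = \<kappa> * Q * exp (\<sigma> * \<tau>) / weight p s \<rho> \<zeta>"
  have N: "0 \<le> N"
    using \<kappa> Q weight_pos[of \<zeta>] by (simp add: N_def)
  fix c :: real assume c: "0 \<le> c"
  have FTC: "((\<lambda>x. N * (rate \<sigma> (ray \<zeta> x) * exp (V \<sigma> (ray \<zeta> x)))) has_integral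
      (- N * exp (V \<sigma> (ray \<zeta> c)) - - N * exp (V \<sigma> (ray \<zeta> 0)))) {0..c}"
  proof (rule fundamental_theorem_of_calculus[OF c])
    fix x assume x: "x \<in> {0..c}"
    have "((\<lambda>x. - N * exp (V \<sigma> (ray \<zeta> x))) has_real_derivative
        - N * (exp (V \<sigma> (ray \<zeta> x)) * (- rate \<sigma> (ray \<zeta> x)))) (at x within {0..c})"
      by (intro DERIV_cmult DERIV_chain2[OF DERIV_exp] V_ray_derivative[OF \<zeta> \<sigma> x])
    then show "((\<lambda>x. - N * exp (V \<sigma> (ray \<zeta> x))) has_vector_derivative
        N * (rate \<sigma> (ray \<zeta> x) * exp (V \<sigma> (ray \<zeta> x)))) (at x within {0..c})"
      by (simp add: mult_ac flip: has_real_derivative_iff_has_vector_derivative)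
  qed
  have "norm (integral {0..c} (\<lambda>x. f (ray \<zeta> x) * F (T + of_real \<tau>) (ray \<zeta> x)))
      \<le> integral {0..c} (\<lambda>x. N * (rate \<sigma> (ray \<zeta> x) * exp (V \<sigma> (ray \<zeta> x))))"
  proof (rule integral_norm_bound_integral)
    show "(\<lambda>x. f (ray \<zeta> x) * F (T + of_real \<tau>) (ray \<zeta> x)) integrable_on {0..c}"
      using int by (rule integrable_on_subinterval) auto
    fix x assume "x \<in> {0..c}"
    then have x: "x \<ge> 0" and ray_in: "ray \<zeta> x \<in> \<Gamma>" using rayD(3)[OF \<zeta>] by auto
    have "norm (F (T + of_real \<tau>) (ray \<zeta> x)) \<le>
        Q * exp (\<sigma> * \<tau> + V \<sigma> (ray \<zeta> x)) / weight p s \<rho> (ray \<zeta> x)"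
      using gb \<tau> ray_in unfolding growth_bound_def by blast
    also have "\<dots> \<le> Q * exp (\<sigma> * \<tau> + V \<sigma> (ray \<zeta> x)) / weight p s \<rho> \<zeta>"
      using weight_ray[OF \<zeta> x] Q by (intro divide_left_mono) (auto simp: weight_pos)
    finally have "norm (f (ray \<zeta> x)) * norm (F (T + of_real \<tau>) (ray \<zeta> x)) \<le>
        (\<kappa> * rate \<sigma> (ray \<zeta> x)) * (Q * exp (\<sigma> * \<tau> + V \<sigma> (ray \<zeta> x)) / weight p s \<rho> \<zeta>)"
      using \<kappa>(1) rate_nonneg[OF \<sigma>] by (intro mult_mono \<kappa>(2) ray_in) auto
    then show "norm (f (ray \<zeta> x) * F (T + of_real \<tau>) (ray \<zeta> x)) \<le>
        N * (rate \<sigma> (ray \<zeta> x) * exp (V \<sigma> (ray \<zeta> x)))"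
      by (simp add: norm_mult N_def exp_add mult_ac)
  qed (use FTC in blast)
  also have "\<dots> \<le> N * exp (V \<sigma> \<zeta>)"
    using N integral_unique[OF FTC] rayD(2)[OF \<zeta>] by simp
  also have "\<dots> = \<kappa> * (Q * exp (\<sigma> * \<tau> + V \<sigma> \<zeta>) / weight p s \<rho> \<zeta>)"
    by (simp add: N_def exp_add)
  finally show "norm (integral {0..c} (\<lambda>x. f (ray \<zeta> x) * F (T + of_real \<tau>) (ray \<zeta> x)))
      \<le> \<kappa> * (Q * exp (\<sigma> * \<tau> + V \<sigma> \<zeta>) / weight p s \<rho> \<zeta>)" .
qed

text \<open>The vector field \<open>2 \<partial>\<^sub>t + s \<partial>\<^sub>\<xi>\<close> is tangent to the curves \<open>(T + \<tau>, \<xi> - s (t - \<tau>) / 2)\<close>.\<close>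

lemma characteristic_derivative:
  assumes \<xi>: "\<xi> \<in> \<Gamma>" and T: "norm T < 2 * d" and \<tau>: "\<tau> \<in> {0..t}"
  shows "((\<lambda>\<tau>. F (T + of_real \<tau>) (ray \<xi> ((t - \<tau>) / 2))) has_vector_derivative
      - (1/2 * \<phi> (ray \<xi> ((t - \<tau>) / 2)) * F (T + of_real \<tau>) (ray \<xi> ((t - \<tau>) / 2))
        + 1/2 * J (T + of_real \<tau>) (ray \<xi> ((t - \<tau>) / 2)))) (at \<tau> within {0..t})"
proof -
  define y where "y = (\<lambda>\<tau>. (t - \<tau>) / 2)"
  define \<zeta> where "\<zeta> = ray \<xi> (y \<tau>)"
  have y: "0 \<le> y \<tau>'" if "\<tau>' \<in> {0..t}" for \<tau>'
    using that by (simp add: y_def)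
  have \<zeta>: "\<zeta> \<in> \<Gamma>"
    unfolding \<zeta>_def using y[OF \<tau>] by (rule rayD(3)[OF \<xi>])
  have U: "T + of_real \<tau> \<in> U"
    using \<tau> by (intro U_region_add[OF T]) simp
  obtain r q where ch: "local_chart p \<Gamma> (p \<zeta>) r q" "q (p \<zeta>) = \<zeta>" "p \<zeta> \<in> ball (p \<zeta>) r"
    using chart_at[OF \<zeta>] .
  define a where "a = deriv (\<lambda>t. F t \<zeta>) (T + of_real \<tau>)"
  define b where "b = coord_deriv p (F (T + of_real \<tau>)) \<zeta>"
  define c where "c = (\<lambda>\<tau>'. (T + of_real \<tau>', p \<xi> - of_real (s * y \<tau>')))"
  have c\<tau>: "c \<tau> = (T + of_real \<tau>, p \<zeta>)"
    using rayD(4)[OF \<xi> y[OF \<tau>]] by (simp add: c_def \<zeta>_def)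
  have b: "deriv (\<lambda>w. F (T + of_real \<tau>) (q w)) (p \<zeta>) = b"
    using coord_deriv_chart[OF ch(1,3)]
      jointly_holomorphic_chart(3)[OF ch(1) F_joint U ch(3)] ch(2)
    unfolding b_def by (metis field_differentiable_derivI)
  have der: "((\<lambda>x. F (fst x) (q (snd x))) has_derivative (\<lambda>h. a * fst h + b * snd h)) (at (c \<tau>))"
    using jointly_holomorphic_chart(1)[OF ch(1) F_joint U ch(3)] by (simp add: c\<tau> a_def b ch(2))
  have "(c has_derivative (\<lambda>k. (of_real k, of_real (s * (k / 2))))) (at \<tau> within {0..t})"
    unfolding c_def y_def by (auto intro!: derivative_eq_intros simp: field_simps)
  from has_derivative_compose[OF this der]
  have "((\<lambda>\<tau>'. F (T + of_real \<tau>') (q (p \<xi> - of_real (s * y \<tau>')))) has_derivative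
      (\<lambda>k. a * of_real k + b * of_real (s * (k / 2)))) (at \<tau> within {0..t})"
    by (simp add: c_def)
  \<comment> \<open>Near \<open>\<tau>\<close> the ray stays inside the chart, where a point is
    recovered by \<open>q\<close> from its projection.\<close>
  moreover have "\<forall>\<^sub>F \<tau>' in at \<tau> within {0..t}. F (T + of_real \<tau>') (q (p \<xi> - of_real (s * y \<tau>'))) =
      F (T + of_real \<tau>') (ray \<xi> (y \<tau>'))"
  proof -
    have "continuous_on {0..t} (\<lambda>\<tau>'. ray \<xi> (y \<tau>'))"
      by (rule continuous_on_compose2[OF rayD(1)[OF \<xi>]]) (auto simp: y_def intro!: continuous_intros)
    then have "((\<lambda>\<tau>'. ray \<xi> (y \<tau>')) \<longlongrightarrow> \<zeta>) (at \<tau> within {0..t})"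
      using \<tau> by (simp add: continuous_on_def \<zeta>_def)
    moreover have "\<zeta> \<in> q ` ball (p \<zeta>) r"
      using imageI[OF ch(3), of q] ch(2) by simp
    ultimately have "\<forall>\<^sub>F \<tau>' in at \<tau> within {0..t}. ray \<xi> (y \<tau>') \<in> q ` ball (p \<zeta>) r"
      by (rule topological_tendstoD[OF _ local_chartD(2)[OF ch(1)]])
    moreover have "\<forall>\<^sub>F \<tau>' in at \<tau> within {0..t}. \<tau>' \<in> {0..t}"
      by (simp add: eventually_at_filter)
    ultimately show ?thesis
    proof eventually_elim
      case (elim \<tau>')
      then obtain w where w: "w \<in> ball (p \<zeta>) r" "ray \<xi> (y \<tau>') = q w" by blast
      have "p \<xi> - of_real (s * y \<tau>') = p (q w)"
        using rayD(4)[OF \<xi> y[OF elim(2)]] w(2) by simp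
      also have "\<dots> = w" by (rule local_chartD(6)[OF ch(1) w(1)])
      finally show ?case using w(2) by simp
    qed
  qed
  moreover have "F (T + of_real \<tau>) (q (p \<xi> - of_real (s * y \<tau>))) = F (T + of_real \<tau>) (ray \<xi> (y \<tau>))"
    using c\<tau> ch(2) by (simp add: c_def \<zeta>_def)
  ultimately have "((\<lambda>\<tau>'. F (T + of_real \<tau>') (ray \<xi> (y \<tau>'))) has_derivative
      (\<lambda>k. a * of_real k + b * of_real (s * (k / 2)))) (at \<tau> within {0..t})"
    using \<tau> by (rule has_derivative_transform_eventually)
  moreover have "a + of_real s * (1/2) * b = - (1/2 * \<phi> \<zeta> * F (T + of_real \<tau>) \<zeta> + 1/2 * J (T + of_real \<tau>) \<zeta>)"
    using borel_equation[OF \<zeta> U] unfolding a_def b_def by (simp only: eq_neg_iff_add_eq_0 add.assoc)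
  moreover have "(\<lambda>k. a * of_real k + b * of_real (s * (k / 2))) = (\<lambda>k. k *\<^sub>R (a + of_real s * (1/2) * b))"
    by (auto simp: scaleR_conv_of_real algebra_simps)
  ultimately show ?thesis
    by (simp add: has_vector_derivative_def y_def \<zeta>_def)
qed

text \<open>Mean value inequality along the characteristic: \<open>g\<close> is half of the assumed
  bound, the half being the coefficient of \<open>\<phi> F\<close> and of \<open>J\<close> in the
  equation. Its derivative dominates that of \<open>h\<close> by the choice of
  \<open>\<kappa>\<close>.\<close>

lemma growth_bound_contraction:
  assumes \<sigma>: "0 < \<sigma>" and T: "norm T < 2 * d" and Q: "0 \<le> Q" and gb: "growth_bound T \<sigma> Q"
    and C: "0 \<le> C" "\<And>\<zeta>. \<zeta> \<in> \<Gamma> \<Longrightarrow> norm (F T \<zeta>) \<le> C / weight p s \<rho> \<zeta>"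
  shows "growth_bound T \<sigma> (C + Q / 2)"
  unfolding growth_bound_def
proof (intro allI impI ballI)
  fix t \<xi> assume t: "(0::real) \<le> t" and \<xi>: "\<xi> \<in> \<Gamma>"
  define w where "w = weight p s \<rho> \<xi>"
  have w: "0 < w" by (simp add: w_def weight_pos)
  obtain \<kappa> where \<kappa>: "0 < \<kappa>" "\<And>\<zeta>. \<zeta> \<in> \<Gamma> \<Longrightarrow> norm (f \<zeta>) \<le> \<kappa> * rate \<sigma> \<zeta>"
    "\<And>\<zeta>. \<zeta> \<in> \<Gamma> \<Longrightarrow> norm (\<phi> \<zeta>) + \<kappa> \<le> \<sigma> + rate \<sigma> \<zeta> / 2"
    using rate_estimates[OF \<sigma>] by metis
  define h where "h = (\<lambda>\<tau>. F (T + of_real \<tau>) (ray \<xi> ((t - \<tau>) / 2)))"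
  define h' where "h' = (\<lambda>\<tau>. - (1/2 * \<phi> (ray \<xi> ((t - \<tau>) / 2)) * F (T + of_real \<tau>) (ray \<xi> ((t - \<tau>) / 2))
        + 1/2 * J (T + of_real \<tau>) (ray \<xi> ((t - \<tau>) / 2))))"
  define g where "g = (\<lambda>\<tau>. Q / (2 * w) * exp (\<sigma> * \<tau> + V \<sigma> (ray \<xi> ((t - \<tau>) / 2))))"
  define g' where "g' = (\<lambda>\<tau>. Q / (2 * w) * (exp (\<sigma> * \<tau> + V \<sigma> (ray \<xi> ((t - \<tau>) / 2))) *
      (\<sigma> + rate \<sigma> (ray \<xi> ((t - \<tau>) / 2)) / 2)))"
  have h': "(h has_vector_derivative h' \<tau>) (at \<tau> within {0..t})" if "\<tau> \<in> {0..t}" for \<tau>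
    unfolding h_def h'_def using \<xi> T that by (rule characteristic_derivative)
  have g': "(g has_real_derivative g' \<tau>) (at \<tau> within {0..t})" if \<tau>: "\<tau> \<in> {0..t}" for \<tau>
  proof -
    have "((\<lambda>\<tau>. (t - \<tau>) / 2) has_real_derivative - 1/2) (at \<tau> within {0..t})"
      by (auto intro!: derivative_eq_intros)
    \<comment> \<open>The ray parameter runs backwards at half speed, so \<open>V\<close> grows
      along the characteristic at rate \<open>rate / 2\<close>.\<close>
    moreover have "((\<lambda>y. V \<sigma> (ray \<xi> y)) has_real_derivative - rate \<sigma> (ray \<xi> ((t - \<tau>) / 2)))
        (at ((t - \<tau>) / 2) within (\<lambda>\<tau>. (t - \<tau>) / 2) ` {0..t})"
      by (rule DERIV_subset[OF V_ray_derivative[OF \<xi> \<sigma>, where c = "t / 2"]]) (use \<tau> in auto)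
    ultimately have "((\<lambda>y. V \<sigma> (ray \<xi> y)) \<circ> (\<lambda>\<tau>. (t - \<tau>) / 2) has_real_derivative
        - rate \<sigma> (ray \<xi> ((t - \<tau>) / 2)) * (- 1/2)) (at \<tau> within {0..t})"
      by (rule DERIV_image_chain[rotated])
    then have "((\<lambda>\<tau>. \<sigma> * \<tau> + V \<sigma> (ray \<xi> ((t - \<tau>) / 2))) has_real_derivative
        \<sigma> + rate \<sigma> (ray \<xi> ((t - \<tau>) / 2)) / 2) (at \<tau> within {0..t})"
      by (auto intro!: derivative_eq_intros simp: o_def)
    then show ?thesis
      unfolding g_def g'_def by (intro DERIV_cmult DERIV_chain2[OF DERIV_exp])
  qed
  have le: "norm (h' \<tau>) \<le> g' \<tau>" if \<tau>: "\<tau> \<in> {0..t}" for \<tau>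
  proof -
    define \<zeta> where "\<zeta> = ray \<xi> ((t - \<tau>) / 2)"
    have \<zeta>: "\<zeta> \<in> \<Gamma>" unfolding \<zeta>_def using \<tau> by (intro rayD(3)[OF \<xi>]) auto
    define R where "R = Q * exp (\<sigma> * \<tau> + V \<sigma> \<zeta>) / weight p s \<rho> \<zeta>"
    have F: "norm (F (T + of_real \<tau>) \<zeta>) \<le> R"
      using gb \<zeta> \<tau> unfolding growth_bound_def R_def by auto
    have J: "norm (J (T + of_real \<tau>) \<zeta>) \<le> \<kappa> * R"
      unfolding R_def using \<tau> by (intro J_bound[OF \<sigma> T Q gb \<kappa>(1,2) \<zeta>]) auto
    have "R \<le> Q * exp (\<sigma> * \<tau> + V \<sigma> \<zeta>) / w"
      unfolding R_def w_def \<zeta>_def using Q \<tau> weight_ray[OF \<xi>]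
      by (intro divide_left_mono) (auto simp: weight_pos)
    have "norm (h' \<tau>) \<le> norm (1/2 * \<phi> \<zeta> * F (T + of_real \<tau>) \<zeta>) + norm (1/2 * J (T + of_real \<tau>) \<zeta>)"
      unfolding h'_def \<zeta>_def norm_minus_cancel by (rule norm_triangle_ineq)
    also have "\<dots> \<le> 1/2 * norm (\<phi> \<zeta>) * R + 1/2 * (\<kappa> * R)"
      unfolding norm_mult using F J by (intro add_mono mult_mono) (auto simp: norm_divide)
    also have "\<dots> = 1/2 * (norm (\<phi> \<zeta>) + \<kappa>) * R"
      by (simp add: algebra_simps)
    also have "\<dots> \<le> 1/2 * (\<sigma> + rate \<sigma> \<zeta> / 2) * (Q * exp (\<sigma> * \<tau> + V \<sigma> \<zeta>) / w)"
      using \<open>R \<le> _\<close> \<kappa>(1) \<kappa>(3)[OF \<zeta>] \<sigma> rate_nonneg[OF \<sigma>, of \<zeta>] order_trans[OF norm_ge_zero F]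
      by (intro mult_mono) auto
    also have "\<dots> = g' \<tau>"
      using w by (simp add: g'_def \<zeta>_def field_simps)
    finally show ?thesis .
  qed
  have "norm (h t - h 0) \<le> g t - g 0"
  proof (cases "t = 0")
    case False
    show ?thesis
    proof (rule differentiable_bound_general)
      show "continuous_on {0..t} h"
        using h' by (rule continuous_on_vector_derivative)
      show "continuous_on {0..t} g"
        by (rule continuous_on_vector_derivative[of _ _ g'])
          (use g' in \<open>simp add: has_real_derivative_iff_has_vector_derivative\<close>)
      fix \<tau> assume \<tau>: "0 < \<tau>" "\<tau> < t"
      have "at \<tau> within {0..t} = at \<tau>"
        using \<tau> by (rule at_within_Icc_at)
      then show "(h has_vector_derivative h' \<tau>) (at \<tau>)" "(g has_vector_derivative g' \<tau>) (at \<tau>)"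
        using h'[of \<tau>] g'[of \<tau>] \<tau> by (auto simp: has_real_derivative_iff_has_vector_derivative)
      show "norm (h' \<tau>) \<le> g' \<tau>" using \<tau> by (intro le) auto
    qed (use t False in auto)
  qed simp
  moreover have "0 \<le> g 0"
    using Q w by (simp add: g_def)
  moreover have "norm (h t) \<le> norm (h 0) + norm (h t - h 0)"
    using norm_triangle_ineq[of "h 0" "h t - h 0"] by simp
  \<comment> \<open>The characteristic starts at the ray point with parameter \<open>t / 2\<close>,
    whose weight is at least \<open>w\<close>.\<close>
  moreover have "norm (h 0) \<le> C / w"
  proof -
    have "norm (h 0) \<le> C / weight p s \<rho> (ray \<xi> (t / 2))"
      unfolding h_def using t by (simp add: C(2) rayD(3)[OF \<xi>])
    also have "\<dots> \<le> C / w"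
      unfolding w_def using C(1) t weight_ray[OF \<xi>] by (intro divide_left_mono) (auto simp: weight_pos)
    finally show ?thesis .
  qed
  moreover have "C / w \<le> C / w * exp (\<sigma> * t + V \<sigma> \<xi>)"
    using mult_left_mono[of 1 "exp (\<sigma> * t + V \<sigma> \<xi>)" "C / w"] C(1) w t \<sigma> V_nonneg[OF \<xi> \<sigma>] by simp
  ultimately have "norm (h t) \<le> C / w * exp (\<sigma> * t + V \<sigma> \<xi>) + g t"
    by linarith
  also have "\<dots> = (C + Q / 2) * exp (\<sigma> * t + V \<sigma> \<xi>) / w"
    using w rayD(2)[OF \<xi>] by (simp add: g_def field_simps)
  finally show "norm (F (T + of_real t) \<xi>) \<le> (C + Q / 2) * exp (\<sigma> * t + V \<sigma> \<xi>) / weight p s \<rho> \<xi>"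
    using rayD(2)[OF \<xi>] by (simp add: h_def w_def)
qed

text \<open>The growth hypothesis is used on a half-strip with
  \<open>norm T < 2 * r < 2 * d\<close>. The factor \<open>exp (\<sigma> * norm T)\<close> turns
  growth in the real part of \<open>T + \<tau>\<close> into growth in \<open>\<tau>\<close>, and
  \<open>V\<close> may be added in the exponent since it is nonnegative.\<close>

lemma growth_bound_exists:
  assumes \<sigma>: "0 < \<sigma>" and T: "norm T < 2 * d"
  obtains Q where "0 \<le> Q" "growth_bound T \<sigma> Q"
proof -
  define r where "r = (norm T / 2 + d) / 2"
  have r: "0 < r" "r < d" "norm T < 2 * r"
    using T d by (auto simp: r_def intro: add_nonneg_pos)
  obtain K where K: "K > 0"
    "\<And>t \<xi>. t \<in> U_region (2 * r) \<Longrightarrow> \<xi> \<in> \<Gamma> \<Longrightarrow> norm (F t \<xi>) \<le> K * exp (\<sigma> * Re t) / weight p s \<rho> \<xi>"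
    using F_growth[OF \<sigma> r(1,2)] by blast
  have "growth_bound T \<sigma> (K * exp (\<sigma> * norm T))"
    unfolding growth_bound_def
  proof (intro allI impI ballI)
    fix \<tau> \<zeta> assume \<tau>: "(0::real) \<le> \<tau>" and \<zeta>: "\<zeta> \<in> \<Gamma>"
    have "norm (F (T + of_real \<tau>) \<zeta>) \<le> K * exp (\<sigma> * Re (T + of_real \<tau>)) / weight p s \<rho> \<zeta>"
      by (rule K(2)[OF U_region_add[OF r(3) \<tau>] \<zeta>])
    also have "\<dots> \<le> K * exp (\<sigma> * norm T + (\<sigma> * \<tau> + V \<sigma> \<zeta>)) / weight p s \<rho> \<zeta>"
    proof -
      have "\<sigma> * Re (T + of_real \<tau>) = \<sigma> * Re T + \<sigma> * \<tau>"
        by (simp add: distrib_left)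
      also have "\<sigma> * Re T \<le> \<sigma> * norm T"
        using \<sigma> by (intro mult_left_mono complex_Re_le_cmod) simp
      finally have "\<sigma> * Re (T + of_real \<tau>) \<le> \<sigma> * norm T + (\<sigma> * \<tau> + V \<sigma> \<zeta>)"
        using V_nonneg[OF \<zeta> \<sigma>] by linarith
      then show ?thesis
        using K(1) weight_pos[of \<zeta>] by (intro divide_right_mono mult_left_mono) auto
    qed
    finally show "norm (F (T + of_real \<tau>) \<zeta>) \<le>
        (K * exp (\<sigma> * norm T)) * exp (\<sigma> * \<tau> + V \<sigma> \<zeta>) / weight p s \<rho> \<zeta>"
      by (simp add: exp_add mult.assoc)
  qed
  with K(1) show thesis by (intro that) auto
qed

text \<open>Iterating the contraction from any finite \<open>Q\<close> gives the constants
  \<open>2 * C + Q / 2 ^ n\<close>, which tend to the fixed point \<open>2 * C\<close>.\<close>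

lemma growth_bound_initial:
  assumes \<sigma>: "0 < \<sigma>" and T: "norm T < 2 * d"
    and C: "0 \<le> C" "\<And>\<zeta>. \<zeta> \<in> \<Gamma> \<Longrightarrow> norm (F T \<zeta>) \<le> C / weight p s \<rho> \<zeta>"
  shows "growth_bound T \<sigma> (2 * C)"
proof -
  obtain Q where Q: "0 \<le> Q" "growth_bound T \<sigma> Q"
    using growth_bound_exists[OF \<sigma> T] .
  have iter: "growth_bound T \<sigma> (2 * C + Q / 2 ^ n)" for n
  proof (induction n)
    case 0
    show ?case
      unfolding growth_bound_def
    proof (intro allI impI ballI)
      fix \<tau> \<zeta> assume "(0::real) \<le> \<tau>" "\<zeta> \<in> \<Gamma>"
      then have "norm (F (T + of_real \<tau>) \<zeta>) \<le> Q * exp (\<sigma> * \<tau> + V \<sigma> \<zeta>) / weight p s \<rho> \<zeta>"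
        using Q(2) unfolding growth_bound_def by blast
      also have "\<dots> \<le> (2 * C + Q / 2 ^ 0) * exp (\<sigma> * \<tau> + V \<sigma> \<zeta>) / weight p s \<rho> \<zeta>"
        using C(1) weight_pos[of \<zeta>] by (intro divide_right_mono mult_right_mono) auto
      finally show "norm (F (T + of_real \<tau>) \<zeta>) \<le>
        (2 * C + Q / 2 ^ 0) * exp (\<sigma> * \<tau> + V \<sigma> \<zeta>) / weight p s \<rho> \<zeta>" .
    qed
  next
    case (Suc n)
    have "growth_bound T \<sigma> (C + (2 * C + Q / 2 ^ n) / 2)"
      using C Q(1) Suc by (intro growth_bound_contraction[OF \<sigma> T]) auto
    also have "C + (2 * C + Q / 2 ^ n) / 2 = 2 * C + Q / 2 ^ Suc n"
      by (simp add: field_simps)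
    finally show ?case .
  qed
  show ?thesis
    unfolding growth_bound_def
  proof (intro allI impI ballI)
    fix \<tau> \<zeta> assume *: "(0::real) \<le> \<tau>" "\<zeta> \<in> \<Gamma>"
    have "(\<lambda>n. Q / 2 ^ n) \<longlonglongrightarrow> 0"
      by (rule LIMSEQ_divide_realpow_zero) simp
    then have lim: "(\<lambda>n. 2 * C + Q / 2 ^ n) \<longlonglongrightarrow> 2 * C + 0"
      by (rule tendsto_add[OF tendsto_const])
    have "(\<lambda>n. (2 * C + Q / 2 ^ n) * exp (\<sigma> * \<tau> + V \<sigma> \<zeta>) / weight p s \<rho> \<zeta>) \<longlonglongrightarrow>
        (2 * C + 0) * exp (\<sigma> * \<tau> + V \<sigma> \<zeta>) / weight p s \<rho> \<zeta>"
      using weight_pos[of \<zeta>] by (intro tendsto_divide[OF tendsto_mult[OF lim tendsto_const] tendsto_const]) simp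
    moreover have "norm (F (T + of_real \<tau>) \<zeta>) \<le>
        (2 * C + Q / 2 ^ n) * exp (\<sigma> * \<tau> + V \<sigma> \<zeta>) / weight p s \<rho> \<zeta>" for n
      using iter[of n] * unfolding growth_bound_def by blast
    ultimately show "norm (F (T + of_real \<tau>) \<zeta>) \<le> 2 * C * exp (\<sigma> * \<tau> + V \<sigma> \<zeta>) / weight p s \<rho> \<zeta>"
      using LIMSEQ_le_const by fastforce
  qed
qed

subsection \<open>The remainder\<close>

lemma C_const_bound:
  assumes r: "0 < r" "r < d" and T: "norm T = 2 * r" and \<xi>: "\<xi> \<in> \<Gamma>"
  shows "norm (F T \<xi>) \<le> C_const p s \<rho> \<Gamma> F r / 2 / weight p s \<rho> \<xi>"
proof -
  define W :: "complex \<times> 'a \<Rightarrow> real" where "W = (\<lambda>(t, \<xi>). weight p s \<rho> \<xi> * norm (F t \<xi>))"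
  \<comment> \<open>A radius strictly between \<open>r\<close> and \<open>d\<close> puts the whole
    circle of radius \<open>2 * r\<close> inside a half-strip where \<open>F\<close> is controlled.
    The supremum is then finite, as the bound by it requires.\<close>
  define r' where "r' = (r + d) / 2"
  have r': "0 < r'" "r' < d" "r < r'" using r by (auto simp: r'_def)
  obtain K where K: "K > 0"
    "\<And>t \<xi>. t \<in> U_region (2 * r') \<Longrightarrow> \<xi> \<in> \<Gamma> \<Longrightarrow> norm (F t \<xi>) \<le> K * exp (1 * Re t) / weight p s \<rho> \<xi>"
    using F_growth[OF zero_less_one r'(1,2)] by blast
  have "bdd_above (W ` (sphere 0 (2 * r) \<times> \<Gamma>))"
  proof (rule bdd_aboveI2)
    fix x assume "x \<in> sphere (0::complex) (2 * r) \<times> \<Gamma>"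
    then obtain t \<xi> where x: "x = (t, \<xi>)" "norm t = 2 * r" "\<xi> \<in> \<Gamma>" by auto
    have "t \<in> U_region (2 * r')" using x(2) r' by (simp add: U_region_def)
    then have "norm (F t \<xi>) \<le> K * exp (1 * Re t) / weight p s \<rho> \<xi>" using x(3) by (rule K(2))
    then have "W x \<le> K * exp (Re t)"
      using weight_pos[of \<xi>] by (simp add: W_def x(1) pos_le_divide_eq mult.commute)
    also have "\<dots> \<le> K * exp (2 * r)"
      using K(1) complex_Re_le_cmod[of t] x(2) by simp
    finally show "W x \<le> K * exp (2 * r)" .
  qed
  then have "W (T, \<xi>) \<le> (SUP x \<in> sphere 0 (2 * r) \<times> \<Gamma>. W x)"
    by (rule cSUP_upper[rotated]) (use T \<xi> in auto)
  then have "weight p s \<rho> \<xi> * norm (F T \<xi>) \<le> C_const p s \<rho> \<Gamma> F r / 2"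
    by (simp add: C_const_def W_def)
  then show ?thesis
    using weight_pos[of \<xi>] by (simp add: pos_le_divide_eq mult.commute)
qed

lemma C_const_nonneg:
  assumes r: "0 < r" "r < d"
  shows "0 \<le> C_const p s \<rho> \<Gamma> F r"
proof -
  obtain \<xi> where \<xi>: "\<xi> \<in> \<Gamma>" using adm by (auto simp: admissible_subdomain_def is_domain_def)
  have "0 \<le> C_const p s \<rho> \<Gamma> F r / 2 / weight p s \<rho> \<xi>"
    using r by (intro order_trans[OF norm_ge_zero C_const_bound[OF r _ \<xi>, of "of_real (2 * r)"]]) simp
  then show ?thesis
    using weight_pos[of \<xi>] by (simp add: zero_le_divide_iff)
qed

lemma F_bound:
  assumes \<sigma>: "0 < \<sigma>" and r: "0 < r" "r < d" and T: "norm T = 2 * r" and \<tau>: "0 \<le> \<tau>" and \<xi>: "\<xi> \<in> \<Gamma>"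
  shows "norm (F (T + of_real \<tau>) \<xi>) \<le>
    C_const p s \<rho> \<Gamma> F r * exp (\<sigma> * \<tau> + V \<sigma> \<xi>) / weight p s \<rho> \<xi>"
proof -
  have "growth_bound T \<sigma> (2 * (C_const p s \<rho> \<Gamma> F r / 2))"
    using C_const_nonneg[OF r] C_const_bound[OF r T] T r by (intro growth_bound_initial[OF \<sigma>]) auto
  then show ?thesis
    using \<tau> \<xi> unfolding growth_bound_def by simp
qed

text \<open>The circle of radius \<open>2 * r\<close> about \<open>t\<close> consists of the points
  \<open>T + t\<close> with \<open>norm T = 2 * r\<close>, which are the points reached by the
  growth estimate.\<close>

lemma F_Cauchy:
  assumes r: "0 < r" "r < d" and t: "0 \<le> t" and \<xi>: "\<xi> \<in> \<Gamma>"
    and B: "\<And>T. norm T = 2 * r \<Longrightarrow> norm (F (T + of_real t) \<xi>) \<le> B"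
  shows "norm ((deriv ^^ k) (\<lambda>t. F t \<xi>) (of_real t)) \<le> fact k * B / (2 * r) ^ k"
proof (rule Cauchy_inequality)
  have sub: "cball (of_real t :: complex) (2 * r) \<subseteq> U"
  proof
    fix z :: complex assume "z \<in> cball (of_real t) (2 * r)"
    then have "(z - of_real t) + of_real t \<in> U"
      using r t by (intro U_region_add) (auto simp: dist_norm norm_minus_commute)
    then show "z \<in> U" by simp
  qed
  show "(\<lambda>t. F t \<xi>) holomorphic_on ball (of_real t) (2 * r)"
    using sub ball_subset_cball by (intro holomorphic_on_subset[OF F_holomorphic[OF \<xi>]]) blast
  show "continuous_on (cball (of_real t) (2 * r)) (\<lambda>t. F t \<xi>)"
    by (intro holomorphic_on_imp_continuous_on holomorphic_on_subset[OF F_holomorphic[OF \<xi>] sub])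
  show "norm (F z \<xi>) \<le> B" if "norm (of_real t - z) = 2 * r" for z
    using B[of "z - of_real t"] that by (simp add: norm_minus_commute)
qed (use r in simp)

text \<open>Integrating by parts \<open>N\<close> times produces one term,
  \<open>A N \<xi> / u ^ N\<close>, beyond the sum of the claim. Moved into the remainder it
  accounts for \<open>2 * r / N\<close>, while the last integral accounts for
  \<open>1 / (Re u - \<sigma>)\<close>.\<close>

lemma remainder_bound:
  assumes \<sigma>: "0 < \<sigma>" and r: "0 < r" "r < d" and u: "Re u > \<sigma>" and \<xi>: "\<xi> \<in> \<Gamma>" and N: "N \<ge> 1"
    and int: "((\<lambda>t. exp (- u * of_real t) * F (of_real t) \<xi>) has_integral I) {0..}"
  shows "norm (I - (\<Sum>n=1..<N. A n \<xi> / u ^ n)) \<le>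
    C_const p s \<rho> \<Gamma> F r * (2 * r / real N + 1 / (Re u - \<sigma>))
          * (exp (V \<sigma> \<xi>) / weight p s \<rho> \<xi>) * (fact N / (2 * r * norm u) ^ N)"
proof -
  define C where "C = C_const p s \<rho> \<Gamma> F r"
  define E where "E = exp (V \<sigma> \<xi>) / weight p s \<rho> \<xi>"
  have C: "0 \<le> C" using C_const_nonneg[OF r] by (simp add: C_def)
  have u0: "u \<noteq> 0" using u \<sigma> by auto
  obtain m where m: "N = Suc m" using N by (cases N) auto
  have rem: "norm (I - (\<Sum>k<N. (deriv ^^ k) (\<lambda>t. F t \<xi>) 0 / u ^ Suc k)) \<le>
      (fact N * (C * E) / (2 * r) ^ N) / (Re u - \<sigma>) / norm u ^ N"
  proof (rule laplace_remainder[OF F_holomorphic[OF \<xi>] open_U _ u u0 _ int])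
    show "of_real t \<in> U" if "t \<ge> 0" for t
      using U_region_add[of 0 "2 * d" t] that d by simp
    show "norm ((deriv ^^ k) (\<lambda>t. F t \<xi>) (of_real t)) \<le> (fact k * (C * E) / (2 * r) ^ k) * exp (\<sigma> * t)"
      if "t \<ge> 0" for k t
    proof -
      have "norm ((deriv ^^ k) (\<lambda>t. F t \<xi>) (of_real t)) \<le>
          fact k * (C * exp (\<sigma> * t + V \<sigma> \<xi>) / weight p s \<rho> \<xi>) / (2 * r) ^ k"
        unfolding C_def using that by (intro F_Cauchy[OF r _ \<xi>] F_bound[OF \<sigma> r _ _ \<xi>])
      then show ?thesis by (simp add: E_def exp_add mult_ac)
    qed
  qed
  have sum: "(\<Sum>k<N. (deriv ^^ k) (\<lambda>t. F t \<xi>) 0 / u ^ Suc k) =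
      (\<Sum>n=1..<N. A n \<xi> / u ^ n) + A N \<xi> / u ^ N"
  proof -
    have "(\<Sum>k<N. (deriv ^^ k) (\<lambda>t. F t \<xi>) 0 / u ^ Suc k) = (\<Sum>k<Suc m. A (Suc k) \<xi> / u ^ Suc k)"
      by (simp only: F_higher_deriv_0[OF \<xi>] m)
    also have "\<dots> = (\<Sum>k<m. A (Suc k) \<xi> / u ^ Suc k) + A (Suc m) \<xi> / u ^ Suc m"
      by (rule sum.lessThan_Suc)
    also have "(\<Sum>k<m. A (Suc k) \<xi> / u ^ Suc k) = (\<Sum>n=1..<Suc m. A n \<xi> / u ^ n)"
      by (simp only: lessThan_atLeast0 sum.shift_bounds_Suc_ivl One_nat_def)
    finally show ?thesis by (simp only: m)
  qed
  \<comment> \<open>\<open>A N\<close> is a derivative of order \<open>N - 1\<close> at 0, so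
    Cauchy's inequality has one factor \<open>N / (2 * r)\<close> less than for order
    \<open>N\<close>. At \<open>t = 0\<close> the supremum in \<open>C_const\<close> is used
    directly, and \<open>exp V \<ge> 1\<close> brings the result to the common form.\<close>
  have last: "norm (A N \<xi> / u ^ N) \<le> (2 * r / real N) * (fact N * (C * E) / (2 * r) ^ N) / norm u ^ N"
  proof -
    have "norm ((deriv ^^ m) (\<lambda>t. F t \<xi>) (of_real 0)) \<le> fact m * (C / 2 / weight p s \<rho> \<xi>) / (2 * r) ^ m"
      unfolding C_def using C_const_bound[OF r _ \<xi>] by (intro F_Cauchy[OF r _ \<xi>]) auto
    then have "norm (A N \<xi>) \<le> fact m * (C / 2 / weight p s \<rho> \<xi>) / (2 * r) ^ m"
      using F_higher_deriv_0[OF \<xi>, of m] m by (simp only: of_real_0)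
    also have "\<dots> \<le> fact m * (C * E) / (2 * r) ^ m"
    proof (intro divide_right_mono mult_left_mono)
      have "C / 2 \<le> C * exp (V \<sigma> \<xi>)"
        using mult_left_mono[of "1/2" "exp (V \<sigma> \<xi>)" C] one_le_exp_iff[THEN iffD2, OF V_nonneg[OF \<xi> \<sigma>]] C
        by linarith
      then show "C / 2 / weight p s \<rho> \<xi> \<le> C * E"
        using weight_pos[of \<xi>] divide_right_mono[of "C / 2" "C * exp (V \<sigma> \<xi>)" "weight p s \<rho> \<xi>"]
        by (simp add: E_def)
    qed (use r in auto)
    also have "\<dots> = (2 * r / real N) * (fact N * (C * E) / (2 * r) ^ N)"
    proof -
      have "fact m * x / R ^ m = (R / real (Suc m)) * (fact (Suc m) * x / R ^ Suc m)"
        if "R \<noteq> 0" for x R :: real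
        using that by (simp add: field_simps del: of_nat_Suc)
      from this[of "2 * r"] r(1) show ?thesis unfolding m by simp
    qed
    finally show ?thesis
      unfolding norm_divide norm_power by (rule divide_right_mono) simp
  qed
  have "norm (I - (\<Sum>n=1..<N. A n \<xi> / u ^ n)) \<le>
      norm (I - ((\<Sum>n=1..<N. A n \<xi> / u ^ n) + A N \<xi> / u ^ N)) + norm (A N \<xi> / u ^ N)"
    using norm_triangle_ineq[of "I - ((\<Sum>n=1..<N. A n \<xi> / u ^ n) + A N \<xi> / u ^ N)" "A N \<xi> / u ^ N"] by simp
  also have "\<dots> \<le>
      (fact N * (C * E) / (2 * r) ^ N) / (Re u - \<sigma>) / norm u ^ N
      + (2 * r / real N) * (fact N * (C * E) / (2 * r) ^ N) / norm u ^ N"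
    using rem last unfolding sum by (rule add_mono)
  also have "\<dots> = C * (2 * r / real N + 1 / (Re u - \<sigma>)) * E * (fact N / (2 * r * norm u) ^ N)"
  proof -
    have "x * (c * e) / R / a / v + b * (x * (c * e) / R) / v = c * (b + 1 / a) * e * (x / (R * v))"
      for x c e R a v b :: real
      by (simp add: algebra_simps add_divide_distrib)
    then show ?thesis unfolding power_mult_distrib[of "2 * r" "norm u" N] .
  qed
  finally show ?thesis by (simp only: C_def E_def)
qed

end

theorem theorem1p2:
  fixes p :: "'a::t2_space \<Rightarrow> complex"
    and G \<Delta> \<Gamma> :: "'a set"
    and \<phi> \<psi> \<Phi> :: "'a \<Rightarrow> complex"
    and \<eta> F :: "complex \<Rightarrow> 'a \<Rightarrow> complex"
    and s \<rho> d :: real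
    and N :: nat
  assumes "s = 1 \<or> s = -1"
    and "is_domain G" and "spread_over_plane p G"
    and "surface_holomorphic_on p \<phi> G" and "surface_holomorphic_on p \<psi> G"
    and "is_domain \<Delta>" and "\<Delta> \<subseteq> G"
    and "condC1 p \<Delta> \<phi> \<psi> \<rho> \<or> condC2 p \<Delta> \<phi> \<psi> \<rho>"
    and "d > 0" and "admissible_subdomain p \<Delta> s d \<Gamma>"
    and "\<forall>\<xi>\<in>\<Gamma>. has_coord_deriv p \<Phi> (\<phi> \<xi>) \<xi>"
    and "is_eta p s \<Gamma> \<phi> \<psi> \<Phi> \<eta>"
    and "is_Borel_transform p s \<rho> d \<Gamma> \<phi> \<psi> \<eta> F"
    and "N \<ge> 1"
  shows "\<exists>R :: complex \<Rightarrow> 'a \<Rightarrow> complex.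
     (\<forall>u. Re u > 0 \<longrightarrow> (\<forall>\<xi>\<in>\<Gamma>.
        \<eta> u \<xi> = (\<Sum>n=1..<N. A_coeff p s \<Gamma> \<phi> \<psi> n \<xi> / u ^ n) + R u \<xi>)) \<and>
     (\<forall>\<sigma> r u. \<sigma> > 0 \<and> 0 < r \<and> r < d \<and> Re u > \<sigma> \<longrightarrow> (\<forall>\<xi>\<in>\<Gamma>.
        cmod (R u \<xi>) \<le>
          C_const p s \<rho> \<Gamma> F r * (2 * r / real N + 1 / (Re u - \<sigma>))
          * (exp (V_bound p s G \<Gamma> \<phi> \<psi> \<sigma> \<xi>) / weight p s \<rho> \<xi>)
          * (fact N / (2 * r * cmod u) ^ N)))"
proof -
  note borel = assms(13)[unfolded is_Borel_transform_def]
  interpret borel_setting p G \<Delta> \<Gamma> \<phi> \<psi> F s \<rho> d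
    by (unfold_locales; (use assms(1-10) borel in blast)?)
  show ?thesis
  \<comment> \<open>The remainder is taken to be the difference itself, so that all the content lies
    in its estimate.\<close>
  proof (intro exI[of _ "\<lambda>u \<xi>. \<eta> u \<xi> - (\<Sum>n=1..<N. A n \<xi> / u ^ n)"] conjI allI impI ballI; (elim conjE)?)
    fix \<sigma> r u \<xi> assume *: "\<sigma> > 0" "0 < r" "r < d" "Re u > \<sigma>" "\<xi> \<in> \<Gamma>"
    have "((\<lambda>t. exp (- u * of_real t) * F (of_real t) \<xi>) has_integral \<eta> u \<xi>) {0..}"
      using borel * by auto
    then show "norm (\<eta> u \<xi> - (\<Sum>n=1..<N. A n \<xi> / u ^ n)) \<le>
          C_const p s \<rho> \<Gamma> F r * (2 * r / real N + 1 / (Re u - \<sigma>))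
          * (exp (V_bound p s G \<Gamma> \<phi> \<psi> \<sigma> \<xi>) / weight p s \<rho> \<xi>)
          * (fact N / (2 * r * cmod u) ^ N)"
      unfolding V_bound_eq by (intro remainder_bound * assms(14))
  qed simp
qed

end
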